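(* Assume hypothesis (H). Then $$\sum_{N>0}\dim_{\mathbb Q}\ker C_{N,4}\, x^N\;\ge\; 3\,\mathbb O(x)^2\mathbb S(x)-\mathbb S(x)^2,$$ coefficientwise.
   Context: For integers $N,r\ge1$ let $S_{N,r}=\{(n_1,\dots,n_r)\in\mathbb Z^r:\ n_1+\dots+n_r=N,\ \text{each } n_i\ge3 \text{ odd}\}$; when used as an index set it is ordered lexicographically decreasingly. For $m=(m_1,\dots,m_r)$ and $n=(n_1,\dots,n_r)$ let $\delta\binom{m}{n}=1$ if $m_i=n_i$ for all $i$, and $0$ otherwise. $\mathbf V_{N,r}$ is the $\mathbb Q$-span of the monomials $x_1^{n_1-1}\cdots x_r^{n_r-1}$ with $(n_1,\dots,n_r)\in S_{N,r}$. $\mathsf{Vect}_{N,r}=\mathbb Q^{S_{N,r}}$ (row vectors), and $\pi:\mathbf V_{N,r}\to\mathsf{Vect}_{N,r}$ is the isomorphism sending $\sum a_{n_1,\dots,n_r}x_1^{n_1-1}\cdots x_r^{n_r-1}$ to $(a_{n_1,\dots,n_r})_{(n_1,\dots,n_r)\in S_{N,r}}$. For $r\ge2$, $\mathbf W_{N,r}=\{P\in\mathbf V_{N,r}: P(x_1,\dots,x_r)=P(x_2-x_1,x_2,x_3,\dots,x_r)-P(x_2-x_1,x_1,x_3,\dots,x_r)\}$. Ihara action: for $f\in\mathbb Q[t]$ and a polynomial $g$ in $r-1$ variables, $(f\mathbin{\underline\circ}g)(x_1,\dots,x_r)=f(x_1)g(x_2,\dots,x_r)+\sum_{i=1}^{r-1}\big(f(x_{i+1}-x_i)g(x_1,\dots,\widehat{x_{i+1}},\dots,x_r)-(-1)^{\deg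 f}f(x_i-x_{i+1})g(x_1,\dots,\widehat{x_i},\dots,x_r)\big)$ (hats denote omitted variables). For positive integers $m_i,n_i$, $e\binom{m_1,\dots,m_r}{n_1,\dots,n_r}$ is the coefficient of $x_1^{n_1-1}\cdots x_r^{n_r-1}$ in $t^{m_1-1}\mathbin{\underline\circ}\,(y_1^{m_2-1}\cdots y_{r-1}^{m_r-1})$. $E_{N,r}$ is the $S_{N,r}\times S_{N,r}$ matrix with $(m,n)$-entry $e\binom{m}{n}$. For $2\le j\le r$, $E^{(j)}_{N,r}$ is the $S_{N,r}\times S_{N,r}$ matrix with $(m,n)$-entry $\delta\binom{m_1,\dots,m_{r-j}}{n_1,\dots,n_{r-j}}\,e\binom{m_{r-j+1},\dots,m_r}{n_{r-j+1},\dots,n_r}$ (so $E^{(r)}_{N,r}=E_{N,r}$). $C_{N,r}=E^{(2)}_{N,r}E^{(3)}_{N,r}\cdots E^{(r-1)}_{N,r}E_{N,r}$ (so $C_{N,2}=E_{N,2}$), and $F_{N,r}=E_{N,r}-\mathrm{id}$. For a matrix $A$, $\ker A$ denotes its right kernel (column vectors $v$ with $Av=0$). $\mathbb O(x)=\frac{x^3}{1-x^2}$, $\mathbb S(x)=\frac{x^{12}}{(1-x^4)(1-x^6)}$. It is known (Tasaka) that for $r\ge2$ and $P\in\mathbf W_{N,r}$, $\pi(P)F_{N,r}$ lies in the left kernel $\{v: vE_{N,r}=0\}$. Hypothesis (H): for all $N$ and all $r\ge2$ the linear map $\mathbf W_{N,r}\to\{v\in\mathsf{Vect}_{N,r}: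 vE_{N,r}=0\}$, $P\mapsto\pi(P)F_{N,r}$, is injective. *)

theory Defs
  imports "HOL-Library.Poly_Mapping" "HOL-Library.Function_Algebras" "HOL-Computational_Algebra.Formal_Power_Series"
begin

text \<open>Multivariate polynomials over Q: finitely supported maps from exponent vectors
  (nat =>0 nat) to rat. Variable x_(k+1) of the paper is mvar k (0-based indexing).\<close>

type_synonym mpoly = "(nat \<Rightarrow>\<^sub>0 nat) \<Rightarrow>\<^sub>0 rat"

definition mconst :: "rat \<Rightarrow> mpoly" where
  "mconst c = Poly_Mapping.single 0 c"

definition mvar :: "nat \<Rightarrow> mpoly" where
  "mvar k = Poly_Mapping.single (Poly_Mapping.single k 1) 1"

definition expo :: "nat list \<Rightarrow> (nat \<Rightarrow>\<^sub>0 nat)" where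
  "expo n = (\<Sum>i<length n. Poly_Mapping.single i (n ! i - 1))"

definition coeff_at :: "mpoly \<Rightarrow> nat list \<Rightarrow> rat" where
  "coeff_at P n = Poly_Mapping.lookup P (expo n)"

definition msubst :: "(nat \<Rightarrow> mpoly) \<Rightarrow> mpoly \<Rightarrow> mpoly" where
  "msubst \<sigma> P = (\<Sum>m\<in>Poly_Mapping.keys P.
      mconst (Poly_Mapping.lookup P m) * (\<Prod>i\<in>Poly_Mapping.keys m. \<sigma> i ^ Poly_Mapping.lookup m i))"

definition Sset :: "nat \<Rightarrow> nat \<Rightarrow> nat list set" where
  "Sset N r = {n. length n = r \<and> sum_list n = N \<and> (\<forall>i<r. 3 \<le> n ! i \<and> odd (n ! i))}"

definition Vsp :: "nat \<Rightarrow> nat \<Rightarrow> mpoly set" where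
  "Vsp N r = {P. Poly_Mapping.keys P \<subseteq> expo ` Sset N r}"

definition piv :: "nat \<Rightarrow> nat \<Rightarrow> mpoly \<Rightarrow> (nat list \<Rightarrow> rat)" where
  "piv N r P = (\<lambda>n. if n \<in> Sset N r then coeff_at P n else 0)"

definition Wsp :: "nat \<Rightarrow> nat \<Rightarrow> mpoly set" where
  "Wsp N r = {P \<in> Vsp N r.
     P = msubst (\<lambda>k. if k = 0 then mvar 1 - mvar 0 else mvar k) P
       - msubst (\<lambda>k. if k = 0 then mvar 1 - mvar 0 else if k = 1 then mvar 0 else mvar k) P}"

definition gmono :: "nat list \<Rightarrow> mpoly list \<Rightarrow> mpoly" where
  "gmono bs vs = (\<Prod>j<length bs. (vs ! j) ^ (bs ! j))"

definition del_nth :: "nat \<Rightarrow> 'a list \<Rightarrow> 'a list" where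
  "del_nth k xs = take k xs @ drop (Suc k) xs"

text \<open>Ihara action t^a o (y_1^(b_1) ... y_(r-1)^(b_(r-1))) in r variables x_1..x_r
  (paper index i in 1..r-1; x_i is mvar (i-1), x_(i+1) is mvar i).\<close>
definition ihara :: "nat \<Rightarrow> nat list \<Rightarrow> mpoly" where
  "ihara a bs = (let r = Suc (length bs); xs = map mvar [0..<r] in
     (mvar 0) ^ a * gmono bs (del_nth 0 xs)
     + (\<Sum>i\<in>{1..<r}.
          (mvar i - mvar (i - 1)) ^ a * gmono bs (del_nth i xs)
          - (-1) ^ a * (mvar (i - 1) - mvar i) ^ a * gmono bs (del_nth (i - 1) xs)))"

definition ecoef :: "nat list \<Rightarrow> nat list \<Rightarrow> rat" where
  "ecoef m n = coeff_at (ihara (hd m - 1) (map (\<lambda>k. k - 1) (tl m))) n"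

text \<open>Matrices indexed by S_{N,r} x S_{N,r}, as functions.\<close>
definition Emat :: "nat \<Rightarrow> nat \<Rightarrow> nat list \<Rightarrow> nat list \<Rightarrow> rat" where
  "Emat N r m n = ecoef m n"

definition Ejmat :: "nat \<Rightarrow> nat \<Rightarrow> nat \<Rightarrow> nat list \<Rightarrow> nat list \<Rightarrow> rat" where
  "Ejmat j N r m n = (if take (r - j) m = take (r - j) n then ecoef (drop (r - j) m) (drop (r - j) n) else 0)"

definition matmul :: "nat \<Rightarrow> nat \<Rightarrow> (nat list \<Rightarrow> nat list \<Rightarrow> rat) \<Rightarrow> (nat list \<Rightarrow> nat list \<Rightarrow> rat)
    \<Rightarrow> nat list \<Rightarrow> nat list \<Rightarrow> rat" where
  "matmul N r A B m n = (\<Sum>k\<in>Sset N r. A m k * B k n)"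

definition Cmat4 :: "nat \<Rightarrow> nat list \<Rightarrow> nat list \<Rightarrow> rat" where
  "Cmat4 N = matmul N 4 (matmul N 4 (Ejmat 2 N 4) (Ejmat 3 N 4)) (Emat N 4)"

definition Fmat :: "nat \<Rightarrow> nat \<Rightarrow> nat list \<Rightarrow> nat list \<Rightarrow> rat" where
  "Fmat N r m n = Emat N r m n - (if m = n then 1 else 0)"

definition rowmul :: "nat \<Rightarrow> nat \<Rightarrow> (nat list \<Rightarrow> rat) \<Rightarrow> (nat list \<Rightarrow> nat list \<Rightarrow> rat) \<Rightarrow> nat list \<Rightarrow> rat" where
  "rowmul N r v A = (\<lambda>n. if n \<in> Sset N r then (\<Sum>m\<in>Sset N r. v m * A m n) else 0)"

definition rker :: "nat \<Rightarrow> nat \<Rightarrow> (nat list \<Rightarrow> nat list \<Rightarrow> rat) \<Rightarrow> (nat list \<Rightarrow> rat) set" where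
  "rker N r A = {v. (\<forall>n. n \<notin> Sset N r \<longrightarrow> v n = 0) \<and>
                    (\<forall>m\<in>Sset N r. (\<Sum>n\<in>Sset N r. A m n * v n) = 0)}"

definition qdim :: "(nat list \<Rightarrow> rat) set \<Rightarrow> nat" where
  "qdim V = vector_space.dim (\<lambda>(c::rat) (v::nat list \<Rightarrow> rat) n. c * v n) V"

definition hypH :: bool where
  "hypH \<longleftrightarrow> (\<forall>N r. 2 \<le> r \<longrightarrow> inj_on (\<lambda>P. rowmul N r (piv N r P) (Fmat N r)) (Wsp N r))"

definition fpsO :: "rat fps" where
  "fpsO = fps_X ^ 3 * inverse (1 - fps_X ^ 2)"

definition fpsS :: "rat fps" where
  "fpsS = fps_X ^ 12 * inverse ((1 - fps_X ^ 4) * (1 - fps_X ^ 6))"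

end

theory Submission
  imports Defs "HOL-Computational_Algebra.Polynomial"
begin

text \<open>
  Identify a row vector with the polynomial function \<open>G\<close> that it represents. Multiplication by \<open>E\<^sup>(\<^sup>j\<^sup>)\<close>
  becomes an explicit sum of substitutions followed by the projection onto monomials all of whose exponents
  are even and positive, and this projection may be omitted before a further factor. Let \<open>W\<close> be the even
  period polynomials in two variables, \<open>A\<^sub>k\<close> the row vectors of depth \<open>k\<close>, and \<open>L\<close> the left kernel of
  the depth 2 matrix. The period relation gives \<open>v F = - v E\<^sup>(\<^sup>r\<^sup>-\<^sup>1\<^sup>)\<close> and \<open>v E\<^sup>(\<^sup>r\<^sup>-\<^sup>1\<^sup>) E = 0\<close> for
  \<open>v \<in> W \<otimes> A\<^sub>r\<^sub>-\<^sub>2\<close>, so that (H) says that \<open>E\<^sup>(\<^sup>r\<^sup>-\<^sup>1\<^sup>)\<close> is injective there. Hence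
  \<open>A\<^sub>2 \<otimes> L\<close>, \<open>A\<^sub>1 \<otimes> W \<otimes> A\<^sub>1\<close> and \<open>W \<otimes> M\<close>, with \<open>M\<close> a complement of \<open>L\<close> in \<open>A\<^sub>2\<close>,
  lie in the left kernel of the product matrix and form a direct sum: apply the factors one after another.
  Since \<open>W \<subseteq> L\<close>, counting dimensions leaves the inequality \<open>dim W \<ge> dim S\<close> in each weight, where \<open>S\<close> has
  generating series \<open>x\<^sup>1\<^sup>2 / ((1 - x\<^sup>4)(1 - x\<^sup>6))\<close>. An antisymmetric even polynomial \<open>P\<close> of degree \<open>2h\<close> lies
  in \<open>W\<close> as soon as \<open>T(x) = P(x,1) - P(1-x,1) + P(1-x,x)\<close>
  vanishes at \<open>h div 3\<close> generic points, because \<open>T\<close> alternates under the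
  group of order 6 generated by \<open>x \<mapsto> 1 - x\<close> and \<open>x \<mapsto> 1/x\<close>.
\<close>

section \<open>Evaluation of polynomials\<close>

definition mono_eval :: "(nat \<Rightarrow>\<^sub>0 nat) \<Rightarrow> (nat \<Rightarrow> rat) \<Rightarrow> rat" where
  "mono_eval k x = (\<Prod>i\<in>Poly_Mapping.keys k. x i ^ Poly_Mapping.lookup k i)"

definition mpoly_eval :: "mpoly \<Rightarrow> (nat \<Rightarrow> rat) \<Rightarrow> rat" where
  "mpoly_eval P x = (\<Sum>k\<in>Poly_Mapping.keys P. Poly_Mapping.lookup P k * mono_eval k x)"

lemma mono_eval_superset:
  assumes "finite A" "Poly_Mapping.keys k \<subseteq> A"
  shows "mono_eval k x = (\<Prod>i\<in>A. x i ^ Poly_Mapping.lookup k i)"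
  unfolding mono_eval_def using assms
  by (intro prod.mono_neutral_left) (auto simp: in_keys_iff)

lemma mpoly_eval_superset:
  assumes "finite A" "Poly_Mapping.keys P \<subseteq> A"
  shows "mpoly_eval P x = (\<Sum>k\<in>A. Poly_Mapping.lookup P k * mono_eval k x)"
  unfolding mpoly_eval_def using assms
  by (intro sum.mono_neutral_left) (auto simp: in_keys_iff)

lemma mono_eval_add: "mono_eval (k + l) x = mono_eval k x * mono_eval l x"
proof -
  let ?A = "Poly_Mapping.keys k \<union> Poly_Mapping.keys l"
  have "Poly_Mapping.keys (k + l) \<subseteq> ?A" by (rule Poly_Mapping.keys_add)
  then show ?thesis
    using mono_eval_superset[of ?A "k + l" x] mono_eval_superset[of ?A k x] mono_eval_superset[of ?A l x]
    by (simp add: lookup_add power_add prod.distrib)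
qed

lemma mono_eval_zero [simp]: "mono_eval 0 x = 1"
  by (simp add: mono_eval_def)

lemma mpoly_eval_zero [simp]: "mpoly_eval 0 x = 0"
  by (simp add: mpoly_eval_def)

lemma mpoly_eval_add: "mpoly_eval (P + Q) x = mpoly_eval P x + mpoly_eval Q x"
proof -
  let ?A = "Poly_Mapping.keys P \<union> Poly_Mapping.keys Q"
  have "Poly_Mapping.keys (P + Q) \<subseteq> ?A" by (rule Poly_Mapping.keys_add)
  then show ?thesis
    using mpoly_eval_superset[of ?A "P + Q" x] mpoly_eval_superset[of ?A P x] mpoly_eval_superset[of ?A Q x]
    by (simp add: lookup_add distrib_right sum.distrib)
qed

lemma mpoly_eval_single: "mpoly_eval (Poly_Mapping.single k c) x = c * mono_eval k x"
  by (simp add: mpoly_eval_def)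

lemma mpoly_eval_uminus: "mpoly_eval (- P) x = - mpoly_eval P x"
  using mpoly_eval_add[of P "- P" x] by simp

lemma mpoly_eval_diff: "mpoly_eval (P - Q) x = mpoly_eval P x - mpoly_eval Q x"
  using mpoly_eval_add[of P "- Q" x] mpoly_eval_uminus[of Q x] by simp

lemma mpoly_eval_sum: "mpoly_eval (\<Sum>i\<in>I. f i) x = (\<Sum>i\<in>I. mpoly_eval (f i) x)"
  by (induction I rule: infinite_finite_induct) (simp_all add: mpoly_eval_add)

lemma mpoly_as_sum_single:
  "P = (\<Sum>k\<in>Poly_Mapping.keys P. Poly_Mapping.single k (Poly_Mapping.lookup P k))" for P :: mpoly
  by (rule poly_mapping_eqI)
     (simp add: lookup_sum lookup_single when_def in_keys_iff sum.If_cases)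

lemma mpoly_eval_mult: "mpoly_eval (P * Q) x = mpoly_eval P x * mpoly_eval Q x"
proof -
  let ?p = "Poly_Mapping.lookup P" and ?q = "Poly_Mapping.lookup Q"
  let ?A = "Poly_Mapping.keys P" and ?B = "Poly_Mapping.keys Q"
  have "P * Q = (\<Sum>k\<in>?A. Poly_Mapping.single k (?p k)) * (\<Sum>l\<in>?B. Poly_Mapping.single l (?q l))"
    using mpoly_as_sum_single[of P] mpoly_as_sum_single[of Q] by simp
  also have "\<dots> = (\<Sum>k\<in>?A. \<Sum>l\<in>?B. Poly_Mapping.single (k + l) (?p k * ?q l))"
    by (simp add: sum_product mult_single)
  finally have "mpoly_eval (P * Q) x = (\<Sum>k\<in>?A. \<Sum>l\<in>?B. (?p k * ?q l) * mono_eval (k + l) x)"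
    by (simp add: mpoly_eval_sum mpoly_eval_single)
  also have "\<dots> = mpoly_eval P x * mpoly_eval Q x"
    by (simp add: mpoly_eval_def sum_product mono_eval_add mult_ac)
  finally show ?thesis .
qed

lemma mpoly_eval_one [simp]: "mpoly_eval 1 x = 1"
  using mpoly_eval_single[of 0 1 x] by simp

lemma mpoly_eval_power: "mpoly_eval (P ^ n) x = mpoly_eval P x ^ n"
  by (induction n) (simp_all add: mpoly_eval_mult)

lemma mpoly_eval_prod: "mpoly_eval (\<Prod>i\<in>I. f i) x = (\<Prod>i\<in>I. mpoly_eval (f i) x)"
  by (induction I rule: infinite_finite_induct) (simp_all add: mpoly_eval_mult)

lemma mpoly_eval_mconst: "mpoly_eval (mconst c) x = c"
  by (simp add: mconst_def mpoly_eval_single)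

lemma mpoly_eval_mvar: "mpoly_eval (mvar i) x = x i"
  by (simp add: mvar_def mpoly_eval_single mono_eval_def)

lemma mpoly_eval_msubst: "mpoly_eval (msubst \<sigma> P) x = mpoly_eval P (\<lambda>i. mpoly_eval (\<sigma> i) x)"
  by (simp add: msubst_def mpoly_eval_sum mpoly_eval_mult mpoly_eval_mconst mpoly_eval_prod mpoly_eval_power)
     (simp add: mpoly_eval_def mono_eval_def)

text \<open>Induction on the number of variables: with the others fixed, the sum is a polynomial in
  the last variable that vanishes at every rational, so each of its coefficients vanishes, and such
  a coefficient is a sum of the same kind in fewer variables. The abstract index type serves both
  exponent vectors and lists.\<close>

lemma monomials_independent:
  fixes c :: "'k \<Rightarrow> rat" and e :: "'k \<Rightarrow> nat \<Rightarrow> nat"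
  assumes "finite V" "finite K"
    and "\<And>k l. k \<in> K \<Longrightarrow> l \<in> K \<Longrightarrow> (\<And>i. i \<in> V \<Longrightarrow> e k i = e l i) \<Longrightarrow> k = l"
    and "\<And>x. (\<Sum>k\<in>K. c k * (\<Prod>i\<in>V. x i ^ e k i)) = 0"
    and "k \<in> K"
  shows "c k = 0"
  using assms
proof (induction V arbitrary: K k rule: finite_induct)
  case empty
  have "K = {k}" using empty.prems(2)[OF _ \<open>k \<in> K\<close>] \<open>k \<in> K\<close> by blast
  then show ?case using empty.prems(3) by simp
next
  case (insert v V)
  define K' where "K' = {l \<in> K. e l v = e k v}"
  show ?case
  proof (rule insert.IH[of K' k])
    show "finite K'" "k \<in> K'" using insert.prems by (auto simp: K'_def)
    show "k1 = l" if "k1 \<in> K'" "l \<in> K'" "\<And>i. i \<in> V \<Longrightarrow> e k1 i = e l i" for k1 l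
      using that by (intro insert.prems(2)) (auto simp: K'_def)
    fix x :: "nat \<Rightarrow> rat"
    let ?m = "\<lambda>l. c l * (\<Prod>i\<in>V. x i ^ e l i)"
    define p where "p = (\<Sum>l\<in>K. monom (?m l) (e l v))"
    have "poly p t = 0" for t
    proof -
      have *: "(\<Prod>i\<in>V. (x(v := t)) i ^ e l i) = (\<Prod>i\<in>V. x i ^ e l i)" for l
        using insert.hyps by (intro prod.cong) auto
      have "(\<Sum>l\<in>K. c l * (\<Prod>i\<in>insert v V. (x(v := t)) i ^ e l i)) = 0"
        by (rule insert.prems(3))
      then show ?thesis
        using insert.hyps by (simp add: p_def poly_sum poly_monom * mult_ac del: fun_upd_apply add: fun_upd_same)
    qed
    then have "p = 0" using poly_all_0_iff_0 by blast
    then have "coeff p (e k v) = 0" by simp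
    then show "(\<Sum>l\<in>K'. ?m l) = 0"
      using insert.prems(1) by (simp add: p_def coeff_sum coeff_monom K'_def sum.inter_filter)
  qed
qed

lemma mpoly_eval_eq_zero_imp:
  assumes "\<And>x. mpoly_eval P x = 0"
  shows "P = 0"
proof (rule ccontr)
  assume "P \<noteq> 0"
  then obtain k where k: "k \<in> Poly_Mapping.keys P" by fastforce
  define V where "V = (\<Union>l\<in>Poly_Mapping.keys P. Poly_Mapping.keys l)"
  have V: "finite V" "\<And>l. l \<in> Poly_Mapping.keys P \<Longrightarrow> Poly_Mapping.keys l \<subseteq> V"
    by (auto simp: V_def)
  have "Poly_Mapping.lookup P k = 0"
  proof (rule monomials_independent[OF V(1), of "Poly_Mapping.keys P" Poly_Mapping.lookup])
    show "l = l'" if "l \<in> Poly_Mapping.keys P" "l' \<in> Poly_Mapping.keys P"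
      "\<And>i. i \<in> V \<Longrightarrow> Poly_Mapping.lookup l i = Poly_Mapping.lookup l' i" for l l'
    proof (rule poly_mapping_eqI)
      fix i
      show "Poly_Mapping.lookup l i = Poly_Mapping.lookup l' i"
        using that(3) V(2)[OF that(1)] V(2)[OF that(2)]
        by (cases "i \<in> V") (simp, metis in_keys_iff subsetD)
    qed
    show "(\<Sum>l\<in>Poly_Mapping.keys P. Poly_Mapping.lookup P l * (\<Prod>i\<in>V. x i ^ Poly_Mapping.lookup l i)) = 0" for x
      using assms[of x] mono_eval_superset[OF V(1) V(2), of _ x] by (simp add: mpoly_eval_def)
  qed (use k in auto)
  then show False using k by (simp add: in_keys_iff)
qed

section \<open>Monomials indexed by lists, and homogeneous polynomials\<close>

definition list_monom :: "nat list \<Rightarrow> (nat \<Rightarrow> rat) \<Rightarrow> rat" where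
  "list_monom n x = (\<Prod>i<length n. x i ^ (n ! i - 1))"

text \<open>Entries are exponents plus one, so these lists index all monomials of degree
  \<open>N - r\<close> in \<open>r\<close> variables, not only those with even positive
  exponents.\<close>

definition Lset :: "nat \<Rightarrow> nat \<Rightarrow> nat list set" where
  "Lset N r = {n. length n = r \<and> sum_list n = N \<and> (\<forall>i<r. 1 \<le> n ! i)}"

lemma finite_Lset: "finite (Lset N r)"
proof (rule finite_subset)
  show "Lset N r \<subseteq> {n. set n \<subseteq> {..N} \<and> length n = r}"
    by (auto simp: Lset_def dest: member_le_sum_list)
qed (simp add: finite_lists_length_eq)

lemma Sset_subset_Lset: "Sset N r \<subseteq> Lset N r"
  by (auto simp: Sset_def Lset_def)

lemma finite_Sset [simp]: "finite (Sset N r)"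
  using finite_subset[OF Sset_subset_Lset finite_Lset] .

lemma lookup_expo: "Poly_Mapping.lookup (expo n) i = (if i < length n then n ! i - 1 else 0)"
  by (auto simp: expo_def lookup_sum lookup_single when_def)

lemma keys_expo: "Poly_Mapping.keys (expo n) \<subseteq> {..<length n}"
  by (auto simp: in_keys_iff lookup_expo split: if_splits)

lemma mono_eval_expo: "mono_eval (expo n) x = list_monom n x"
  using mono_eval_superset[OF _ keys_expo, of n x]
  by (auto simp: list_monom_def lookup_expo intro!: prod.cong)

lemma expo_eq_imp:
  assumes "expo n = expo m" "n \<in> Lset N r" "m \<in> Lset N' r"
  shows "n = m"
proof (rule nth_equalityI)
  show "length n = length m" using assms by (simp add: Lset_def)
  fix i assume i: "i < length n"
  have "n ! i - 1 = m ! i - 1"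
    using arg_cong[OF assms(1), of "\<lambda>k. Poly_Mapping.lookup k i"] i assms(2,3)
    by (auto simp: lookup_expo Lset_def)
  then show "n ! i = m ! i" using i assms(2,3) by (auto simp: Lset_def) (metis Suc_pred less_eq_Suc_le)
qed

lemma inj_on_expo: "inj_on expo (Lset N r)"
  using expo_eq_imp by (auto simp: inj_on_def)

definition homog :: "nat \<Rightarrow> nat \<Rightarrow> mpoly set" where
  "homog r d = {P. \<forall>k\<in>Poly_Mapping.keys P. Poly_Mapping.keys k \<subseteq> {..<r} \<and> (\<Sum>i<r. Poly_Mapping.lookup k i) = d}"

lemma homog_add: "P \<in> homog r d \<Longrightarrow> Q \<in> homog r d \<Longrightarrow> P + Q \<in> homog r d"
  using Poly_Mapping.keys_add[of P Q] by (auto simp: homog_def)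

lemma homog_uminus: "P \<in> homog r d \<Longrightarrow> - P \<in> homog r d"
  by (auto simp: homog_def)

lemma homog_diff: "P \<in> homog r d \<Longrightarrow> Q \<in> homog r d \<Longrightarrow> P - Q \<in> homog r d"
  using homog_add[of P r d "- Q"] homog_uminus[of Q r d] by simp

lemma homog_zero: "0 \<in> homog r d"
  by (simp add: homog_def)

lemma homog_sum: "(\<And>i. i \<in> I \<Longrightarrow> f i \<in> homog r d) \<Longrightarrow> (\<Sum>i\<in>I. f i) \<in> homog r d"
  by (induction I rule: infinite_finite_induct) (auto simp: homog_zero homog_add)

lemma homog_mult:
  assumes "P \<in> homog r d" "Q \<in> homog r d'"
  shows "P * Q \<in> homog r (d + d')"
  unfolding homog_def
proof (intro CollectI ballI)
  fix k assume "k \<in> Poly_Mapping.keys (P * Q)"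
  then obtain a b where ab: "k = a + b" "a \<in> Poly_Mapping.keys P" "b \<in> Poly_Mapping.keys Q"
    using keys_mult[of P Q] by blast
  then have "Poly_Mapping.keys a \<subseteq> {..<r}" "Poly_Mapping.keys b \<subseteq> {..<r}"
    "(\<Sum>i<r. Poly_Mapping.lookup a i) = d" "(\<Sum>i<r. Poly_Mapping.lookup b i) = d'"
    using assms by (auto simp: homog_def)
  then show "Poly_Mapping.keys k \<subseteq> {..<r} \<and> (\<Sum>i<r. Poly_Mapping.lookup k i) = d + d'"
    using ab(1) Poly_Mapping.keys_add[of a b] by (auto simp: lookup_add sum.distrib)
qed

lemma homog_one: "1 \<in> homog r 0"
  by (auto simp: homog_def)

lemma homog_power: "P \<in> homog r d \<Longrightarrow> P ^ n \<in> homog r (n * d)"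
  by (induction n) (use homog_one homog_mult in auto)

lemma homog_prod: "(\<And>i. i \<in> I \<Longrightarrow> f i \<in> homog r (d i)) \<Longrightarrow> (\<Prod>i\<in>I. f i) \<in> homog r (\<Sum>i\<in>I. d i)"
  by (induction I rule: infinite_finite_induct) (auto simp: homog_one homog_mult)

lemma homog_mvar: "i < r \<Longrightarrow> mvar i \<in> homog r 1"
  by (auto simp: homog_def mvar_def lookup_single when_def)

text \<open>Adding one to each of the \<open>r\<close> exponents turns a monomial of degree
  \<open>d\<close> into a list of sum \<open>d + r\<close>, so the expansion runs over a fixed
  finite set.\<close>

lemma mpoly_eval_homog:
  assumes "P \<in> homog r d"
  shows "mpoly_eval P x = (\<Sum>n\<in>Lset (d + r) r. coeff_at P n * list_monom n x)"
proof -
  have "k \<in> expo ` Lset (d + r) r" if "k \<in> Poly_Mapping.keys P" for k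
  proof -
    let ?n = "map (\<lambda>i. Suc (Poly_Mapping.lookup k i)) [0..<r]"
    have k: "Poly_Mapping.keys k \<subseteq> {..<r}" "(\<Sum>i<r. Poly_Mapping.lookup k i) = d"
      using that assms by (auto simp: homog_def)
    have "k = expo ?n"
      using k(1) by (intro poly_mapping_eqI) (force simp: lookup_expo in_keys_iff)
    moreover have "?n \<in> Lset (d + r) r"
      using k(2) by (auto simp: Lset_def interv_sum_list_conv_sum_set_nat sum_Suc atLeast0LessThan)
    ultimately show ?thesis by blast
  qed
  then have "mpoly_eval P x = (\<Sum>k\<in>expo ` Lset (d + r) r. Poly_Mapping.lookup P k * mono_eval k x)"
    by (intro mpoly_eval_superset) (auto simp: finite_Lset)
  then show ?thesis
    by (simp add: sum.reindex[OF inj_on_expo] mono_eval_expo coeff_at_def)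
qed

text \<open>In the \<open>i\<close>-th pair of terms of the Ihara action, applied to the variables from position \<open>p\<close> on,
  \<open>shl\<close> omits \<open>x i\<close> and \<open>shr\<close> omits \<open>x (i - 1)\<close>; the difference of the two is placed at position \<open>p\<close>.\<close>

definition shl :: "nat \<Rightarrow> nat \<Rightarrow> (nat \<Rightarrow> rat) \<Rightarrow> nat \<Rightarrow> rat" where
  "shl p i x j = (if j < p then x j else if j = p then x i - x (i - 1) else if j \<le> i then x (j - 1) else x j)"

definition shr :: "nat \<Rightarrow> nat \<Rightarrow> (nat \<Rightarrow> rat) \<Rightarrow> nat \<Rightarrow> rat" where
  "shr p i x j = (if j < p then x j else if j = p then x i - x (i - 1) else if j < i then x (j - 1) else x j)"

text \<open>For \<open>p = 0\<close> and \<open>G\<close> the product of an even \<open>f\<close> in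
  the first variable with \<open>g\<close> in the others, this is the Ihara action of
  \<open>f\<close> on \<open>g\<close>; its leading term is \<open>G\<close> itself. For larger
  \<open>p\<close> the first \<open>p\<close> variables are parameters, which models
  \<open>Ejmat (r - p)\<close>.\<close>

definition ihara_op :: "nat \<Rightarrow> nat \<Rightarrow> ((nat \<Rightarrow> rat) \<Rightarrow> rat) \<Rightarrow> (nat \<Rightarrow> rat) \<Rightarrow> rat" where
  "ihara_op p r G x = G x + (\<Sum>i\<in>{p+1..<r}. G (shl p i x) - G (shr p i x))"

lemma del_nth_nth:
  "k < length xs \<Longrightarrow> j < length xs - 1 \<Longrightarrow> del_nth k xs ! j = (if j < k then xs ! j else xs ! Suc j)"
  by (simp add: del_nth_def nth_append min_def)

lemma gmono_del_nth_homog: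
  assumes "k < Suc (length bs)"
  shows "gmono bs (del_nth k (map mvar [0..<Suc (length bs)])) \<in> homog (Suc (length bs)) (sum_list bs)"
proof -
  have "gmono bs (del_nth k (map mvar [0..<Suc (length bs)])) \<in>
        homog (Suc (length bs)) (\<Sum>j<length bs. bs ! j * 1)"
    unfolding gmono_def
    using assms by (intro homog_prod homog_power)
      (auto simp: del_nth_nth simp del: upt_Suc intro!: homog_mvar[unfolded One_nat_def])
  then show ?thesis by (simp add: sum_list_sum_nth atLeast0LessThan)
qed

lemma ihara_homog: "ihara a bs \<in> homog (Suc (length bs)) (a + sum_list bs)"
proof -
  let ?r = "Suc (length bs)"
  have d: "(mvar i - mvar j) ^ a \<in> homog ?r a" if "i < ?r" "j < ?r" for i j
    using homog_power[OF homog_diff[OF homog_mvar[OF that(1)] homog_mvar[OF that(2)]], of a] by simp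
  have s: "(-1) ^ a * P \<in> homog ?r a" if "P \<in> homog ?r a" for P :: mpoly
    using that homog_uminus by (cases "even a") auto
  have "mvar 0 ^ a \<in> homog ?r a"
    using homog_power[OF homog_mvar[of 0 ?r], of a] by simp
  then show ?thesis
    unfolding ihara_def Let_def
    by (intro homog_add homog_sum homog_diff homog_mult gmono_del_nth_homog d s)
       auto
qed

text \<open>An even exponent removes the sign \<open>(-1) ^ a\<close> and lets both terms use the
  same difference \<open>x i - x (i - 1)\<close>; the arguments left after the omissions are those
  of \<open>shl\<close> and \<open>shr\<close>.\<close>

lemma mpoly_eval_ihara:
  assumes "even a"
  shows "mpoly_eval (ihara a bs) x = ihara_op 0 (Suc (length bs)) (list_monom (Suc a # map Suc bs)) x"
proof -
  let ?r = "Suc (length bs)"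
  have g: "mpoly_eval (gmono bs (del_nth k (map mvar [0..<?r]))) x
      = (\<Prod>j<length bs. (if j < k then x j else x (Suc j)) ^ (bs ! j))" if "k < ?r" for k
    unfolding gmono_def mpoly_eval_prod mpoly_eval_power using that
    by (intro prod.cong) (auto simp: del_nth_nth mpoly_eval_mvar simp del: upt_Suc)
  have m: "list_monom (Suc a # map Suc bs) y = y 0 ^ a * (\<Prod>j<length bs. y (Suc j) ^ (bs ! j))" for y
    by (simp add: list_monom_def lessThan_Suc_eq_insert_0 prod.reindex)
  have sgn: "(x (i - 1) - x i) ^ a = (x i - x (i - 1)) ^ a" for i
    using assms by (metis minus_diff_eq power_minus_even)
  show ?thesis
    unfolding ihara_def Let_def ihara_op_def mpoly_eval_add mpoly_eval_sum mpoly_eval_diff mpoly_eval_mult mpoly_eval_power mpoly_eval_mvar m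
  proof (intro arg_cong2[of _ _ _ _ "(+)"] sum.cong arg_cong2[of _ _ _ _ "(-)"])
    show "x 0 ^ a * mpoly_eval (gmono bs (del_nth 0 (map mvar [0..<?r]))) x = x 0 ^ a * (\<Prod>j<length bs. x (Suc j) ^ bs ! j)"
      by (subst g) auto
    show "{1..<?r} = {0 + 1..<?r}" by simp
  next
    fix i assume i: "i \<in> {0 + 1..<?r}"
    show "(x i - x (i - 1)) ^ a * mpoly_eval (gmono bs (del_nth i (map mvar [0..<?r]))) x =
         shl 0 i x 0 ^ a * (\<Prod>j<length bs. shl 0 i x (Suc j) ^ bs ! j)"
      using i by (subst g) (auto simp: shl_def Suc_le_eq cong: if_cong)
    show "mpoly_eval (- 1) x ^ a * (x (i - 1) - x i) ^ a * mpoly_eval (gmono bs (del_nth (i - 1) (map mvar [0..<?r]))) x =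
         shr 0 i x 0 ^ a * (\<Prod>j<length bs. shr 0 i x (Suc j) ^ bs ! j)"
    proof -
      have *: "(if j < i - 1 then x j else x (Suc j)) = shr 0 i x (Suc j)" for j
        using i by (auto simp: shr_def)
      have "i - 1 < ?r" "shr 0 i x 0 = x i - x (i - 1)" using i by (auto simp: shr_def)
      then show ?thesis
        unfolding g[OF \<open>i - 1 < ?r\<close>] * using assms sgn[of i] by (simp add: mpoly_eval_uminus)
    qed
  qed
qed

section \<open>The matrices as operators on polynomial functions\<close>

text \<open>On a monomial this is the identity if the exponent of \<open>x i\<close> is even and positive, and zero otherwise.\<close>

definition evenpos_at :: "nat \<Rightarrow> ((nat \<Rightarrow> rat) \<Rightarrow> rat) \<Rightarrow> (nat \<Rightarrow> rat) \<Rightarrow> rat" where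
  "evenpos_at i G x = (G x + G (x(i := - x i))) / 2 - G (x(i := 0))"

primrec evenpos :: "nat \<Rightarrow> ((nat \<Rightarrow> rat) \<Rightarrow> rat) \<Rightarrow> (nat \<Rightarrow> rat) \<Rightarrow> rat" where
  "evenpos 0 G = G"
| "evenpos (Suc r) G = evenpos_at r (evenpos r G)"

lemma evenpos_at_sum: "evenpos_at i (\<lambda>x. \<Sum>j\<in>J. c j * g j x) = (\<lambda>x. \<Sum>j\<in>J. c j * evenpos_at i (g j) x)"
  by (simp add: fun_eq_iff evenpos_at_def sum.distrib sum_subtractf sum_divide_distrib algebra_simps add_divide_distrib)

lemma evenpos_sum: "evenpos r (\<lambda>x. \<Sum>j\<in>J. c j * g j x) = (\<lambda>x. \<Sum>j\<in>J. c j * evenpos r (g j) x)"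
  by (induction r) (simp_all add: evenpos_at_sum)

lemma evenpos_add: "evenpos r (\<lambda>x. G x + H x) = (\<lambda>x. evenpos r G x + evenpos r H x)"
  by (induction r) (simp_all add: evenpos_at_def fun_eq_iff add_divide_distrib)

lemma evenpos_diff: "evenpos r (\<lambda>x. G x - H x) = (\<lambda>x. evenpos r G x - evenpos r H x)"
  by (induction r) (simp_all add: evenpos_at_def fun_eq_iff diff_divide_distrib add_divide_distrib)

lemma evenpos_uminus: "evenpos r (\<lambda>x. - G x) = (\<lambda>x. - evenpos r G x)"
  by (induction r) (simp_all add: evenpos_at_def fun_eq_iff add_divide_distrib)

lemma evenpos_zero: "evenpos r (\<lambda>x. 0) = (\<lambda>x. 0)"
  by (induction r) (simp_all add: evenpos_at_def fun_eq_iff)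

lemma evenpos_sum_simple: "evenpos r (\<lambda>x. \<Sum>j\<in>J. g j x) = (\<lambda>x. \<Sum>j\<in>J. evenpos r (g j) x)"
  using evenpos_sum[of r "\<lambda>_. 1" g J] by simp

text \<open>The projection touches only variables below \<open>r\<close>, so it cannot disturb a
  transformation rule in the variable \<open>k\<close>.\<close>

lemma evenpos_upd_commute:
  assumes "r \<le> k" "\<And>x. T (x(k := f (x k))) = c * T x"
  shows "evenpos r T (x(k := f (x k))) = c * evenpos r T x"
  using assms(1)
proof (induction r arbitrary: x)
  case 0
  show ?case unfolding evenpos.simps by (rule assms(2))
next
  case (Suc r)
  note IH = Suc.IH[OF Suc_leD[OF Suc.prems]]
  have kr: "k \<noteq> r" using Suc.prems by simp
  have IH': "evenpos r T (x(k := f (x k), r := t)) = c * evenpos r T (x(r := t))" for t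
    using IH[of "x(r := t)"] kr by (metis fun_upd_other fun_upd_twist)
  show ?case
    unfolding evenpos.simps evenpos_at_def fun_upd_other[OF kr[symmetric]] IH IH'
    by (simp add: algebra_simps add_divide_distrib)
qed

lemma evenpos_flip_ge:
  assumes "r \<le> k"
  shows "evenpos r (\<lambda>x. T (x(k := - x k))) x = evenpos r T (x(k := - x k))"
  using assms
proof (induction r arbitrary: x)
  case (Suc r)
  note IH = Suc.IH[OF Suc_leD[OF Suc.prems]]
  have kr: "k \<noteq> r" using Suc.prems by simp
  have *: "(x(r := t))(k := - (x(r := t)) k) = x(k := - x k, r := t)" for t
    using kr by (auto simp: fun_eq_iff)
  show ?case
    unfolding evenpos.simps evenpos_at_def IH fun_upd_other[OF kr[symmetric]] * ..
qed simp

text \<open>Up to stage \<open>k\<close> the flip passes through the projection; at stage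
  \<open>k\<close> the average over both signs absorbs it.\<close>

lemma evenpos_flip:
  assumes "k < r"
  shows "evenpos r (\<lambda>x. T (x(k := - x k))) = evenpos r T"
  using assms
proof (induction r)
  case (Suc r)
  show ?case
  proof (cases "k = r")
    case True
    have *: "evenpos k (\<lambda>x. T (x(k := - x k))) x = evenpos k T (x(k := - x k))" for x
      by (intro evenpos_flip_ge) simp
    have **: "(x(k := t))(k := u) = x(k := u)" for x :: "nat \<Rightarrow> rat" and t u by simp
    show ?thesis
      unfolding evenpos.simps evenpos_at_def True[symmetric] * ** fun_upd_same by (auto simp: fun_eq_iff add.commute)
  next
    case False
    then show ?thesis using Suc by simp
  qed
qed simp

lemma evenpos_odd:
  assumes "k < r" "\<And>x. T (x(k := - x k)) = - T x"
  shows "evenpos r T = (\<lambda>x. 0)"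
proof
  fix x
  have "evenpos r T x = evenpos r (\<lambda>x. - T x) x" using evenpos_flip[OF assms(1), of T] assms(2) by simp
  then show "evenpos r T x = 0" by (simp add: evenpos_uminus)
qed

text \<open>The projection does not see either flip, so a function negated by the double flip has a
  projection equal to its own negative.\<close>

lemma evenpos_odd2:
  assumes "k < r" "l < r" "\<And>x. T ((x(k := - x k))(l := - (x(k := - x k)) l)) = - T x"
  shows "evenpos r T = (\<lambda>x. 0)"
proof
  fix x
  define H where "H = (\<lambda>x. T (x(l := - x l)))"
  have "evenpos r (\<lambda>x. H (x(k := - x k))) = evenpos r H" by (rule evenpos_flip[OF assms(1)])
  moreover have "(\<lambda>x. H (x(k := - x k))) = (\<lambda>x. - T x)" using assms(3) by (simp add: H_def)
  moreover have "evenpos r H = evenpos r T" unfolding H_def by (rule evenpos_flip[OF assms(2)])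
  ultimately have "evenpos r T = evenpos r (\<lambda>x. - T x)" by (simp only:)
  then have "evenpos r T = (\<lambda>x. - evenpos r T x)" unfolding evenpos_uminus .
  then have "evenpos r T x = - evenpos r T x" by (rule fun_cong)
  then show "evenpos r T x = 0" by simp
qed

text \<open>At stage \<open>k\<close> the average over the signs and the value at 0 coincide, hence
  cancel.\<close>

lemma evenpos_indep:
  assumes "k < r" "\<And>x c. T (x(k := c)) = T x"
  shows "evenpos r T = (\<lambda>x. 0)"
  using assms(1)
proof (induction r)
  case (Suc r)
  show ?case
  proof (cases "k = r")
    case True
    have "evenpos r T (x(k := c)) = evenpos r T x" for x c
      using evenpos_upd_commute[of r k T "\<lambda>_. c" 1 x] True assms(2) by simp
    then show ?thesis using True by (simp add: evenpos_at_def fun_eq_iff)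
  next
    case False
    then show ?thesis using Suc by (simp add: evenpos_at_def fun_eq_iff)
  qed
qed simp

lemma evenpos_at_monomial:
  fixes e :: "nat \<Rightarrow> nat"
  assumes "i < s"
  shows "evenpos_at i (\<lambda>x. \<Prod>j<s. x j ^ e j) = (\<lambda>x. if even (e i) \<and> 2 \<le> e i then \<Prod>j<s. x j ^ e j else 0)"
proof
  fix x :: "nat \<Rightarrow> rat"
  let ?R = "\<Prod>j\<in>{..<s} - {i}. x j ^ e j"
  have *: "(\<Prod>j<s. (x(i := t)) j ^ e j) = t ^ e i * ?R" for t
    using assms by (subst prod.remove[of _ i]) (auto intro!: prod.cong)
  have **: "(\<Prod>j<s. x j ^ e j) = x i ^ e i * ?R"
    using assms by (subst prod.remove[of _ i]) auto
  \<comment> \<open>Odd exponents die in the average. The exponent 0 survives it, but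
    \<open>0 ^ 0 = 1\<close> makes the subtracted value at 0 cancel it.\<close>
  consider "even (e i)" "2 \<le> e i" | "e i = 0" | "odd (e i)"
    by (metis One_nat_def Suc_1 Suc_leI bot_nat_0.not_eq_extremum nat_less_le odd_one)
  then show "evenpos_at i (\<lambda>x. \<Prod>j<s. x j ^ e j) x = (if even (e i) \<and> 2 \<le> e i then \<Prod>j<s. x j ^ e j else 0)"
    unfolding evenpos_at_def * ** by cases (auto simp: odd_pos)
qed

lemma evenpos_monomial:
  fixes e :: "nat \<Rightarrow> nat"
  assumes "r \<le> s"
  shows "evenpos r (\<lambda>x. \<Prod>j<s. x j ^ e j) = (\<lambda>x. if \<forall>i<r. even (e i) \<and> 2 \<le> e i then \<Prod>j<s. x j ^ e j else 0)"
  using assms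
proof (induction r)
  case (Suc r)
  show ?case
  proof (cases "\<forall>i<r. even (e i) \<and> 2 \<le> e i")
    case True
    then have "evenpos (Suc r) (\<lambda>x. \<Prod>j<s. x j ^ e j) = evenpos_at r (\<lambda>x. \<Prod>j<s. x j ^ e j)"
      using Suc by simp
    then show ?thesis using True Suc.prems evenpos_at_monomial[of r s e] by (auto simp: fun_eq_iff less_Suc_eq)
  next
    case False
    then have "evenpos r (\<lambda>x. \<Prod>j<s. x j ^ e j) = (\<lambda>x. 0)"
      by (simp only: Suc.IH[OF Suc_leD[OF Suc.prems]] if_False)
    moreover have "\<not> (\<forall>i<Suc r. even (e i) \<and> 2 \<le> e i)" using False less_Suc_eq by blast
    ultimately show ?thesis by (simp only: evenpos.simps if_False) (simp add: evenpos_at_def fun_eq_iff)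
  qed
qed simp

text \<open>An entry that is odd and at least 3 means an exponent that is even and positive, so the
  projection cuts \<open>Lset\<close> down to the index set of the matrices.\<close>

lemma evenpos_list_monom:
  assumes "n \<in> Lset N r"
  shows "evenpos r (list_monom n) = (\<lambda>x. if n \<in> Sset N r then list_monom n x else 0)"
proof -
  have n: "length n = r" "sum_list n = N" "\<And>i. i < r \<Longrightarrow> 1 \<le> n ! i" using assms by (auto simp: Lset_def)
  have "even (n ! i - 1) \<and> 2 \<le> n ! i - 1 \<longleftrightarrow> 3 \<le> n ! i \<and> odd (n ! i)" if "i < r" for i
    using n(3)[OF that] by auto
  then have "n \<in> Sset N r \<longleftrightarrow> (\<forall>i<r. even (n ! i - 1) \<and> 2 \<le> n ! i - 1)"
    using n by (auto simp: Sset_def)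
  then show ?thesis
    using evenpos_monomial[of r r "\<lambda>i. n ! i - 1"] unfolding list_monom_def[abs_def] n(1) by simp
qed

section \<open>Row vectors as polynomial functions\<close>

definition vec_eval :: "nat \<Rightarrow> nat \<Rightarrow> (nat list \<Rightarrow> rat) \<Rightarrow> (nat \<Rightarrow> rat) \<Rightarrow> rat" where
  "vec_eval N r v x = (\<Sum>n\<in>Sset N r. v n * list_monom n x)"

lemma vec_eval_eq_zero_imp:
  assumes "\<And>x. vec_eval N r v x = 0" "n \<in> Sset N r"
  shows "v n = 0"
proof (rule monomials_independent[of "{..<r}" "Sset N r" "\<lambda>n i. n ! i - 1"])
  show "k = l" if "k \<in> Sset N r" "l \<in> Sset N r" "\<And>i. i \<in> {..<r} \<Longrightarrow> k ! i - 1 = l ! i - 1" for k l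
  proof (rule nth_equalityI)
    show "length k = length l" using that by (simp add: Sset_def)
    fix i assume "i < length k"
    then have "i < r" "3 \<le> k ! i" "3 \<le> l ! i" using that(1,2) by (auto simp: Sset_def)
    then show "k ! i = l ! i" using that(3)[of i] by simp
  qed
  show "(\<Sum>k\<in>Sset N r. v k * (\<Prod>i\<in>{..<r}. x i ^ (k ! i - 1))) = 0" for x
    using assms(1)[of x] by (simp add: vec_eval_def list_monom_def Sset_def cong: sum.cong) (auto simp: Sset_def)
qed (use assms in auto)

lemma list_monom_append: "list_monom (a @ b) x = list_monom a x * list_monom b (\<lambda>i. x (length a + i))"
proof -
  have "(\<Prod>i<m + length b. x i ^ ((a @ b) ! i - 1))
      = (\<Prod>i<m. x i ^ (a ! i - 1)) * (\<Prod>i<length b. x (m + i) ^ (b ! i - 1))" if "m = length a" for m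
    using that
  proof (induction b rule: rev_induct)
    case (snoc c b)
    have "(\<Prod>i<m + length b. x i ^ ((a @ b @ [c]) ! i - 1)) = (\<Prod>i<m + length b. x i ^ ((a @ b) ! i - 1))"
      using snoc.prems by (intro prod.cong) (auto simp: nth_append)
    moreover have "(\<Prod>i<length b. x (m + i) ^ ((b @ [c]) ! i - 1)) = (\<Prod>i<length b. x (m + i) ^ (b ! i - 1))"
      by (intro prod.cong) (auto simp: nth_append)
    ultimately show ?case using snoc by (simp add: nth_append mult.assoc)
  qed simp
  then show ?thesis by (simp add: list_monom_def)
qed

lemma list_monom_cong: "(\<And>i. i < length n \<Longrightarrow> x i = y i) \<Longrightarrow> list_monom n x = list_monom n y"
  by (simp add: list_monom_def)

text \<open>From position \<open>p\<close> on, \<open>shl p\<close> and \<open>shr p\<close> are the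
  substitutions at position 0 applied to the tail of the variables; earlier positions are left
  alone, so the factor of \<open>a\<close> splits off.\<close>

lemma ihara_op_list_monom_append:
  assumes "length a = p" "p < r"
  shows "ihara_op p r (list_monom (a @ b)) x = list_monom a x * ihara_op 0 (r - p) (list_monom b) (\<lambda>i. x (p + i))"
proof -
  let ?y = "\<lambda>i. x (p + i)"
  have l: "list_monom (a @ b) (shl p (i + p) x) = list_monom a x * list_monom b (shl 0 i ?y)"
    and r: "list_monom (a @ b) (shr p (i + p) x) = list_monom a x * list_monom b (shr 0 i ?y)" if "i \<ge> 1" for i
  proof -
    have "shl p (i + p) x (p + j) = shl 0 i ?y j" "shr p (i + p) x (p + j) = shr 0 i ?y j" for j
      using that by (auto simp: shl_def shr_def add.commute[of i p])
    moreover have "list_monom a (shl p (i + p) x) = list_monom a x" "list_monom a (shr p (i + p) x) = list_monom a x"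
      using assms by (auto intro!: list_monom_cong simp: shl_def shr_def)
    ultimately show "list_monom (a @ b) (shl p (i + p) x) = list_monom a x * list_monom b (shl 0 i ?y)"
      "list_monom (a @ b) (shr p (i + p) x) = list_monom a x * list_monom b (shr 0 i ?y)"
      using assms by (simp_all add: list_monom_append)
  qed
  have "(\<Sum>i\<in>{p+1..<r}. list_monom (a @ b) (shl p i x) - list_monom (a @ b) (shr p i x))
      = (\<Sum>i\<in>{1..<r-p}. list_monom (a @ b) (shl p (i + p) x) - list_monom (a @ b) (shr p (i + p) x))"
    using sum.shift_bounds_nat_ivl[of "\<lambda>i. list_monom (a @ b) (shl p i x) - list_monom (a @ b) (shr p i x)" 1 p "r - p"] assms
    by (simp add: add.commute)
  also have "\<dots> = list_monom a x * (\<Sum>i\<in>{1..<r-p}. list_monom b (shl 0 i ?y) - list_monom b (shr 0 i ?y))"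
    using l r by (simp add: sum_distrib_left right_diff_distrib)
  finally show ?thesis
    using assms by (simp add: ihara_op_def list_monom_append distrib_left)
qed

text \<open>The Ihara polynomial is homogeneous of the degree of the given monomial, so its
  expansion over \<open>Lset N r\<close> has the numbers \<open>ecoef m n\<close> as coefficients,
  including those at columns outside the index set.\<close>

lemma ihara_op_list_monom_zero:
  assumes "m \<in> Sset N r" "0 < r"
  shows "ihara_op 0 r (list_monom m) x = (\<Sum>n\<in>Lset N r. ecoef m n * list_monom n x)"
proof -
  have m: "length m = r" "sum_list m = N" "\<And>i. i < r \<Longrightarrow> 3 \<le> m ! i \<and> odd (m ! i)"
    using assms(1) by (auto simp: Sset_def)
  then obtain a bs where mab: "m = a # bs" using assms(2) by (cases m) auto
  have a: "3 \<le> a" "odd a" using m(3)[of 0] assms(2) mab by auto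
  have b: "3 \<le> b" if "b \<in> set bs" for b
    using that m(1,3) mab by (metis in_set_conv_nth list.set_intros(2))
  let ?bs = "map (\<lambda>k. k - 1) bs"
  have bs: "map Suc ?bs = bs" using b by (auto intro!: map_idI) (metis Suc_pred gr0I not_numeral_le_zero)
  have "sum_list ?bs + length bs = sum_list bs" using b by (induction bs) fastforce+
  then have deg: "(a - 1) + sum_list ?bs + Suc (length ?bs) = N"
    using a m(2) mab by simp
  have "ihara_op 0 r (list_monom m) x = mpoly_eval (ihara (a - 1) ?bs) x"
    using a m(1) mab bs by (subst mpoly_eval_ihara) auto
  also have "\<dots> = (\<Sum>n\<in>Lset N r. coeff_at (ihara (a - 1) ?bs) n * list_monom n x)"
    using mpoly_eval_homog[OF ihara_homog[of "a - 1" ?bs], of x] deg m(1) mab by simp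
  finally show ?thesis by (simp add: ecoef_def mab)
qed

lemma Sset_iff: "n \<in> Sset N r \<longleftrightarrow> length n = r \<and> sum_list n = N \<and> (\<forall>k\<in>set n. 3 \<le> k \<and> odd k)"
  unfolding Sset_def all_set_conv_all_nth by blast

text \<open>The conjunct \<open>sum_list s \<le> N\<close> guards the truncated subtraction
  \<open>N - sum_list s\<close>.\<close>

lemma Sset_append_iff:
  assumes "length s = p" "p \<le> r"
  shows "s @ n \<in> Sset N r \<longleftrightarrow>
     s \<in> Sset (sum_list s) p \<and> n \<in> Sset (N - sum_list s) (r - p) \<and> sum_list s \<le> N"
proof -
  have "length (s @ n) = r \<longleftrightarrow> length n = r - p" using assms by auto
  moreover have "sum_list (s @ n) = N \<longleftrightarrow> sum_list n = N - sum_list s \<and> sum_list s \<le> N" by auto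
  ultimately show ?thesis unfolding Sset_iff set_append ball_Un using assms(1) by blast
qed

lemma Sset_split:
  assumes "n \<in> Sset N r" "p \<le> r"
  shows "take p n \<in> Sset (sum_list (take p n)) p" "drop p n \<in> Sset (sum_list (drop p n)) (r - p)"
    "sum_list (take p n) + sum_list (drop p n) = N" "length (take p n) = p"
proof -
  show l: "length (take p n) = p" using assms by (simp add: Sset_def)
  show s: "sum_list (take p n) + sum_list (drop p n) = N"
    using assms by (metis (mono_tags, lifting) Sset_def append_take_drop_id mem_Collect_eq sum_list_append)
  then show "take p n \<in> Sset (sum_list (take p n)) p" "drop p n \<in> Sset (sum_list (drop p n)) (r - p)"
    using Sset_append_iff[OF l assms(2), of "drop p n" N] assms(1) by (auto simp flip: s)
qed

lemma Sset_prefix_eq: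
  assumes s: "s \<in> Sset (sum_list s) p" and "sum_list s \<le> N" "p \<le> r"
  shows "(@) s ` Sset (N - sum_list s) (r - p) = {n \<in> Sset N r. take p n = s}"
proof (intro equalityI subsetI)
  have l: "length s = p" using s by (simp add: Sset_def)
  fix n assume "n \<in> (@) s ` Sset (N - sum_list s) (r - p)"
  then obtain k where k: "n = s @ k" "k \<in> Sset (N - sum_list s) (r - p)" by blast
  then have "n \<in> Sset N r" using Sset_append_iff[OF l assms(3), of k N] assms(1,2) by blast
  then show "n \<in> {n \<in> Sset N r. take p n = s}" using k(1) l by simp
next
  fix n assume "n \<in> {n \<in> Sset N r. take p n = s}"
  then have n: "n \<in> Sset N r" "take p n = s" by auto
  have "drop p n \<in> Sset (sum_list (drop p n)) (r - p)" "sum_list s + sum_list (drop p n) = N"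
    using Sset_split[OF n(1) assms(3)] n(2) by auto
  moreover have "n = s @ drop p n" using n(2) by auto
  ultimately show "n \<in> (@) s ` Sset (N - sum_list s) (r - p)"
    by (metis add_diff_cancel_left' imageI)
qed

text \<open>The row of \<open>m\<close> is expanded over all monomials in the tail; the projection
  discards columns outside the index set, and the delta in \<open>Ejmat\<close> restricts to columns
  that share the prefix of \<open>m\<close>.\<close>

lemma vec_eval_unit_Ejmat:
  assumes m: "m \<in> Sset N r" and p: "p < r"
  shows "(\<Sum>n\<in>Sset N r. Ejmat (r - p) N r m n * list_monom n x) = evenpos r (ihara_op p r (list_monom m)) x"
proof -
  let ?s = "take p m" and ?t = "drop p m"
  note sp = Sset_split[OF m less_imp_le[OF p]]
  let ?M = "sum_list ?t"
  have "ihara_op p r (list_monom m) = (\<lambda>x. \<Sum>n\<in>Lset ?M (r - p). ecoef ?t n * list_monom (?s @ n) x)"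
  proof
    fix x
    have "ihara_op p r (list_monom (?s @ ?t)) x = list_monom ?s x * ihara_op 0 (r - p) (list_monom ?t) (\<lambda>i. x (p + i))"
      using ihara_op_list_monom_append[OF sp(4) p, of ?t x] .
    also have "\<dots> = list_monom ?s x * (\<Sum>n\<in>Lset ?M (r - p). ecoef ?t n * list_monom n (\<lambda>i. x (p + i)))"
      using ihara_op_list_monom_zero[OF sp(2)] p by simp
    also have "\<dots> = (\<Sum>n\<in>Lset ?M (r - p). ecoef ?t n * list_monom (?s @ n) x)"
      using sp(4) by (simp add: list_monom_append sum_distrib_left mult_ac)
    finally show "ihara_op p r (list_monom m) x = \<dots>" by simp
  qed
  then have "evenpos r (ihara_op p r (list_monom m)) x = (\<Sum>n\<in>Lset ?M (r - p). ecoef ?t n * evenpos r (list_monom (?s @ n)) x)"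
    by (simp add: evenpos_sum)
  also have "\<dots> = (\<Sum>n\<in>Lset ?M (r - p). if n \<in> Sset ?M (r - p) then ecoef ?t n * list_monom (?s @ n) x else 0)"
  proof (rule sum.cong[OF refl])
    fix n assume n: "n \<in> Lset ?M (r - p)"
    have "?s @ n \<in> Lset N r"
      using n sp p by (auto simp: Lset_def Sset_def nth_append)
    moreover have "?s @ n \<in> Sset N r \<longleftrightarrow> n \<in> Sset ?M (r - p)"
      using Sset_append_iff[OF sp(4) less_imp_le[OF p], of n N] sp(1,3) by (metis add_diff_cancel_left' le_add1)
    ultimately show "ecoef ?t n * evenpos r (list_monom (?s @ n)) x = (if n \<in> Sset ?M (r - p) then ecoef ?t n * list_monom (?s @ n) x else 0)"
      by (simp add: evenpos_list_monom)
  qed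
  also have "\<dots> = (\<Sum>n\<in>Sset ?M (r - p). ecoef ?t n * list_monom (?s @ n) x)"
    using Sset_subset_Lset[of ?M "r - p"] finite_Lset[of ?M "r - p"]
    by (simp add: sum.inter_restrict[symmetric] Int_absorb1)
  also have "\<dots> = (\<Sum>n\<in>(@) ?s ` Sset ?M (r - p). ecoef ?t (drop p n) * list_monom n x)"
    using sp(4) by (simp add: sum.reindex inj_on_def)
  also have "(@) ?s ` Sset ?M (r - p) = {n \<in> Sset N r. take p n = ?s}"
  proof -
    have "?M = N - sum_list ?s" "sum_list ?s \<le> N" using sp(3) by auto
    then show ?thesis using Sset_prefix_eq[OF sp(1) _ less_imp_le[OF p]] by metis
  qed
  also have "(\<Sum>n\<in>{n \<in> Sset N r. take p n = ?s}. ecoef ?t (drop p n) * list_monom n x)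
      = (\<Sum>n\<in>Sset N r. Ejmat (r - p) N r m n * list_monom n x)"
    using p by (auto simp: sum.inter_filter Ejmat_def intro!: sum.cong)
  finally show ?thesis by simp
qed

lemma ihara_op_sum: "ihara_op p r (\<lambda>x. \<Sum>j\<in>J. c j * g j x) = (\<lambda>x. \<Sum>j\<in>J. c j * ihara_op p r (g j) x)"
proof
  fix x
  have "(\<Sum>i\<in>{p+1..<r}. (\<Sum>j\<in>J. c j * g j (shl p i x)) - (\<Sum>j\<in>J. c j * g j (shr p i x)))
      = (\<Sum>i\<in>{p+1..<r}. \<Sum>j\<in>J. c j * (g j (shl p i x) - g j (shr p i x)))"
    by (simp add: sum_subtractf right_diff_distrib)
  also have "\<dots> = (\<Sum>j\<in>J. c j * (\<Sum>i\<in>{p+1..<r}. g j (shl p i x) - g j (shr p i x)))"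
    by (subst sum.swap) (simp add: sum_distrib_left)
  finally show "ihara_op p r (\<lambda>x. \<Sum>j\<in>J. c j * g j x) x = (\<Sum>j\<in>J. c j * ihara_op p r (g j) x)"
    by (simp add: ihara_op_def sum.distrib distrib_left)
qed

lemma vec_eval_rowmul_Ejmat:
  assumes "p < r"
  shows "vec_eval N r (rowmul N r v (Ejmat (r - p) N r)) x = evenpos r (ihara_op p r (vec_eval N r v)) x"
proof -
  have "vec_eval N r (rowmul N r v (Ejmat (r - p) N r)) x
      = (\<Sum>n\<in>Sset N r. \<Sum>m\<in>Sset N r. v m * (Ejmat (r - p) N r m n * list_monom n x))"
    by (simp add: vec_eval_def rowmul_def sum_distrib_right mult.assoc)
  also have "\<dots> = (\<Sum>m\<in>Sset N r. v m * (\<Sum>n\<in>Sset N r. Ejmat (r - p) N r m n * list_monom n x))"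
    by (subst sum.swap) (simp add: sum_distrib_left)
  also have "\<dots> = (\<Sum>m\<in>Sset N r. v m * evenpos r (ihara_op p r (list_monom m)) x)"
    using vec_eval_unit_Ejmat[OF _ assms] by simp
  also have "\<dots> = evenpos r (ihara_op p r (vec_eval N r v)) x"
    unfolding vec_eval_def[abs_def] ihara_op_sum evenpos_sum ..
  finally show ?thesis .
qed

section \<open>Compatibility with the projection and the period relation\<close>

lemma ihara_op_add: "ihara_op p r (\<lambda>x. G x + H x) = (\<lambda>x. ihara_op p r G x + ihara_op p r H x)"
  by (simp add: ihara_op_def fun_eq_iff sum.distrib sum_subtractf)

text \<open>A merged pair of variables changes sign together with the variable that it replaces, so each term of the
  Ihara action is odd under flipping one or two signs.\<close>

lemma evenpos_ihara_op_odd: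
  assumes "0 < j" "j < r"
    and even0: "\<And>y. D (y(0 := - y 0)) = D y"
    and odd: "\<And>y. D (y(j := - y j)) = - D y"
  shows "evenpos r (ihara_op 0 r D) = (\<lambda>x. 0)"
proof -
  have "evenpos r (\<lambda>x. D (shl 0 i x)) = (\<lambda>x. 0) \<and> evenpos r (\<lambda>x. D (shr 0 i x)) = (\<lambda>x. 0)" if i: "i \<in> {1..<r}" for i
  proof -
    consider "j < i" | "j > i" | "j = i" by linarith
    then show ?thesis
    proof cases
      case 1
      \<comment> \<open>For \<open>j < i\<close>, slot \<open>j\<close> holds
        \<open>x (j - 1)\<close> in both substitutions, and that variable occurs in no other
        slot.\<close>
      have "shl 0 i (x(j - 1 := - x (j - 1))) = (shl 0 i x)(j := - shl 0 i x j)"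
        "shr 0 i (x(j - 1 := - x (j - 1))) = (shr 0 i x)(j := - shr 0 i x j)" for x
        using 1 assms(1) by (auto simp: fun_eq_iff shl_def shr_def)
      then show ?thesis
        using i 1 odd by (intro conjI evenpos_odd[of "j - 1"]) auto
    next
      case 2
      have "shl 0 i (x(j := - x j)) = (shl 0 i x)(j := - shl 0 i x j)"
        "shr 0 i (x(j := - x j)) = (shr 0 i x)(j := - shr 0 i x j)" for x
        using 2 by (auto simp: fun_eq_iff shl_def shr_def)
      then show ?thesis
        using assms(2) odd by (intro conjI evenpos_odd[of j]) auto
    next
      case 3
      \<comment> \<open>For \<open>j = i\<close>, slot \<open>j\<close> holds
        \<open>x (i - 1)\<close> under \<open>shl\<close> and \<open>x i\<close> under
        \<open>shr\<close>, and both variables occur in slot 0. Flipping both negates slots 0 and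
        \<open>j\<close>; evenness in slot 0 leaves the sign from slot \<open>j\<close>.\<close>
      have fl: "shl 0 i ((x(j := - x j))(j - 1 := - (x(j := - x j)) (j - 1)))
          = ((shl 0 i x)(0 := - shl 0 i x 0))(j := - ((shl 0 i x)(0 := - shl 0 i x 0)) j)"
        "shr 0 i ((x(j := - x j))(j - 1 := - (x(j := - x j)) (j - 1)))
          = ((shr 0 i x)(0 := - shr 0 i x 0))(j := - ((shr 0 i x)(0 := - shr 0 i x 0)) j)" for x
        using 3 assms(1) by (auto simp: fun_eq_iff shl_def shr_def)
      have neg: "D ((y(0 := - y 0))(j := - (y(0 := - y 0)) j)) = - D y" for y
        unfolding odd even0 ..
      have "j - 1 < r" using assms(2) by simp
      then show ?thesis
        by (intro conjI evenpos_odd2[OF assms(2)]) (assumption | subst fl, rule neg)+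
    qed
  qed
  moreover have "evenpos r D = (\<lambda>x. 0)" using assms(2) odd by (rule evenpos_odd)
  ultimately show ?thesis
    unfolding ihara_op_def[abs_def] by (simp add: evenpos_add evenpos_sum_simple evenpos_diff)
qed

text \<open>For \<open>j \<noteq> i\<close> both terms miss a variable and are killed; for
  \<open>j = i\<close> the two terms differ only in slot \<open>j\<close> and cancel.\<close>

lemma evenpos_ihara_op_indep:
  assumes "0 < j" "j < r" and ind: "\<And>y c. D (y(j := c)) = D y"
  shows "evenpos r (ihara_op 0 r D) = (\<lambda>x. 0)"
proof -
  have "evenpos r (\<lambda>x. D (shl 0 i x) - D (shr 0 i x)) = (\<lambda>x. 0)" if i: "i \<in> {1..<r}" for i
  proof -
    consider "j < i" | "j > i" | "j = i" by linarith
    then show ?thesis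
    proof cases
      case 1
      have "shl 0 i (x(j - 1 := c)) = (shl 0 i x)(j := c)"
        "shr 0 i (x(j - 1 := c)) = (shr 0 i x)(j := c)" for x c
        using 1 assms(1) by (auto simp: fun_eq_iff shl_def shr_def)
      then show ?thesis
        using i 1 ind by (intro evenpos_indep[of "j - 1"]) auto
    next
      case 2
      have "shl 0 i (x(j := c)) = (shl 0 i x)(j := c)"
        "shr 0 i (x(j := c)) = (shr 0 i x)(j := c)" for x c
        using 2 by (auto simp: fun_eq_iff shl_def shr_def)
      then show ?thesis
        using assms(2) ind by (intro evenpos_indep[of j]) auto
    next
      case 3
      have "shr 0 i x = (shl 0 i x)(j := shr 0 i x j)" for x
        using 3 by (auto simp: fun_eq_iff shl_def shr_def)
      then have "D (shr 0 i x) = D (shl 0 i x)" for x using ind by metis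
      then show ?thesis by (simp add: evenpos_zero)
    qed
  qed
  moreover have "evenpos r D = (\<lambda>x. 0)" using assms(2) ind by (rule evenpos_indep)
  ultimately show ?thesis
    unfolding ihara_op_def[abs_def] by (simp add: evenpos_add evenpos_sum_simple)
qed

text \<open>\<open>D\<close> differs from its projection by a part \<open>U\<close> odd in slot
  \<open>j\<close> and a part \<open>V\<close> independent of it, and the two preceding results
  annihilate both.\<close>

lemma evenpos_ihara_op_evenpos_at:
  assumes j: "0 < j" "j < r" and even0: "\<And>y. D (y(0 := - y 0)) = D y"
  shows "evenpos r (ihara_op 0 r (evenpos_at j D)) = evenpos r (ihara_op 0 r D)"
proof -
  define U where "U = (\<lambda>y. (D y - D (y(j := - y j))) / 2)"
  define V where "V = (\<lambda>y. D (y(j := 0)))"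
  have tw: "y(0 := a, j := b) = y(j := b, 0 := a)" for y :: "nat \<Rightarrow> rat" and a b
    using j by (intro fun_upd_twist) simp
  have e0: "D (y(0 := - y 0, j := b)) = D (y(j := b))" for y b
    using even0[of "y(j := b)"] j by (simp add: tw)
  have "U (y(0 := - y 0)) = U y" for y
    using j by (simp add: U_def even0 e0)
  moreover have "U (y(j := - y j)) = - U y" for y
    by (simp add: U_def field_simps)
  ultimately have U: "evenpos r (ihara_op 0 r U) = (\<lambda>x. 0)" using j by (intro evenpos_ihara_op_odd[of j]) auto
  have V: "evenpos r (ihara_op 0 r V) = (\<lambda>x. 0)" using j by (intro evenpos_ihara_op_indep[of j]) (auto simp: V_def)
  have D: "D = (\<lambda>y. evenpos_at j D y + (U y + V y))"
    by (auto simp: fun_eq_iff evenpos_at_def U_def V_def field_simps)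
  have "ihara_op 0 r D = (\<lambda>x. ihara_op 0 r (evenpos_at j D) x + (ihara_op 0 r U x + ihara_op 0 r V x))"
    by (subst D) (simp only: ihara_op_add)
  then show ?thesis by (simp only: evenpos_add U V) simp
qed

text \<open>The first stage does nothing, since \<open>D\<close> is already projected in slot 0;
  later stages act on other slots and preserve evenness there.\<close>

lemma evenpos_even0:
  assumes "\<And>y. D (y(0 := - y 0)) = D y" "D = evenpos_at 0 D"
  shows "evenpos s D (y(0 := - y 0)) = evenpos s D y"
proof (induction s arbitrary: y)
  case 0
  show ?case unfolding evenpos.simps by (rule assms(1))
next
  case (Suc s)
  show ?case
  proof (cases "s = 0")
    case True
    then show ?thesis using assms by (simp del: fun_upd_apply)
  next
    case False
    then have *: "(y(0 := - y 0))(s := t) = (y(s := t))(0 := - (y(s := t)) 0)" for t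
      by (auto simp: fun_eq_iff)
    show ?thesis unfolding evenpos.simps evenpos_at_def * Suc using False by simp
  qed
qed

text \<open>The projections in slots other than 0 are removed one at a time. That argument excludes
  slot 0, where \<open>D\<close> is therefore assumed to be projected already.\<close>

lemma evenpos_ihara_op_evenpos:
  assumes "\<And>y. D (y(0 := - y 0)) = D y" "D = evenpos_at 0 D" "s \<le> r"
  shows "evenpos r (ihara_op 0 r (evenpos s D)) = evenpos r (ihara_op 0 r D)"
  using assms(3)
proof (induction s)
  case (Suc s)
  show ?case
  proof (cases "s = 0")
    case True
    then show ?thesis using assms(2) by simp
  next
    case False
    then have "evenpos r (ihara_op 0 r (evenpos_at s (evenpos s D))) = evenpos r (ihara_op 0 r (evenpos s D))"
      using Suc.prems by (intro evenpos_ihara_op_evenpos_at evenpos_even0 assms(1,2)) auto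
    then show ?thesis using Suc by simp
  qed
qed simp

lemma vec_eval_cong: "(\<And>i. i < r \<Longrightarrow> x i = y i) \<Longrightarrow> vec_eval N r v x = vec_eval N r v y"
  unfolding vec_eval_def by (intro sum.cong refl arg_cong2[of _ _ _ _ "(*)"] list_monom_cong) (auto simp: Sset_def)

lemma list_monom_upd:
  assumes "i < length n"
  shows "list_monom n (x(i := t)) = t ^ (n ! i - 1) * (\<Prod>j\<in>{..<length n} - {i}. x j ^ (n ! j - 1))"
  unfolding list_monom_def using assms by (subst prod.remove[of _ i]) (auto intro!: prod.cong)

lemma vec_eval_even:
  assumes "i < r"
  shows "vec_eval N r v (x(i := - t)) = vec_eval N r v (x(i := t))"
  unfolding vec_eval_def
proof (rule sum.cong[OF refl])
  fix n assume "n \<in> Sset N r"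
  then have "i < length n" "even (n ! i - 1)" using assms by (auto simp: Sset_def)
  then show "v n * list_monom n (x(i := - t)) = v n * list_monom n (x(i := t))"
    by (simp add: list_monom_upd)
qed

lemma vec_eval_zero_at:
  assumes "i < r"
  shows "vec_eval N r v (x(i := 0)) = 0"
  unfolding vec_eval_def
proof (rule sum.neutral, rule ballI)
  fix n assume "n \<in> Sset N r"
  then have "i < length n" "3 \<le> n ! i" using assms by (auto simp: Sset_def)
  then show "v n * list_monom n (x(i := 0)) = 0"
    by (simp add: list_monom_upd)
qed

lemma vec_eval_even': "i < r \<Longrightarrow> vec_eval N r v (x(i := - x i)) = vec_eval N r v x"
  using vec_eval_even[of i r N v x "x i"] by simp

lemma evenpos_vec_eval: "evenpos r (vec_eval N r v) = vec_eval N r v"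
  unfolding vec_eval_def[abs_def] evenpos_sum
  by (auto simp: fun_eq_iff intro!: sum.cong) (metis evenpos_list_monom Sset_subset_Lset subsetD)

section \<open>The period relation and the identities it implies\<close>

definition period_rel :: "((nat \<Rightarrow> rat) \<Rightarrow> rat) \<Rightarrow> bool" where
  "period_rel G \<longleftrightarrow> (\<forall>x. G x = G (x(0 := x 1 - x 0)) - G (x(0 := x 1 - x 0, 1 := x 0)))"

text \<open>At the swapped point the right side of the relation changes sign, once evenness turns
  \<open>x 0 - x 1\<close> into \<open>x 1 - x 0\<close>.\<close>

lemma period_rel_antisym:
  assumes "period_rel G" and even: "\<And>x t. G (x(0 := - t)) = G (x(0 := t))"
  shows "G (x(0 := x 1, 1 := x 0)) = - G x"
proof -
  let ?y = "x(0 := x 1, 1 := x 0)"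
  have "G ?y = G (?y(0 := ?y 1 - ?y 0)) - G (?y(0 := ?y 1 - ?y 0, 1 := ?y 0))"
    using assms(1) unfolding period_rel_def by blast
  moreover have "?y(0 := ?y 1 - ?y 0) = (x(1 := x 0))(0 := - (x 1 - x 0))"
    "?y(0 := ?y 1 - ?y 0, 1 := ?y 0) = x(0 := - (x 1 - x 0))"
    by (auto simp: fun_eq_iff)
  moreover have "G x = G (x(0 := x 1 - x 0)) - G (x(0 := x 1 - x 0, 1 := x 0))"
    using assms(1) unfolding period_rel_def by blast
  moreover have "x(0 := x 1 - x 0, 1 := x 0) = (x(1 := x 0))(0 := x 1 - x 0)"
    by (auto simp: fun_eq_iff)
  ultimately show ?thesis by (simp only: even)
qed

text \<open>The relation cancels \<open>G x\<close> against the term \<open>i = 1\<close>. For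
  \<open>i \<ge> 2\<close> the substitutions at position 0 are those at position 1 with the first
  two slots swapped, so antisymmetry negates the remaining sum. This turns \<open>F\<close> into the
  negative of \<open>Ejmat (r - 1)\<close>.\<close>

lemma ihara_op_period_rel:
  assumes "period_rel G" and even: "\<And>x t. G (x(0 := - t)) = G (x(0 := t))" and r: "2 \<le> r"
  shows "ihara_op 0 r G x = G x - ihara_op 1 r G x"
proof -
  have s: "G (shl 0 i x) = - G (shl 1 i x)" "G (shr 0 i x) = - G (shr 1 i x)" if "i \<in> {2..<r}" for i
  proof -
    have "shl 0 i x = (shl 1 i x)(0 := shl 1 i x 1, 1 := shl 1 i x 0)"
      "shr 0 i x = (shr 1 i x)(0 := shr 1 i x 1, 1 := shr 1 i x 0)"
      using that by (auto simp: fun_eq_iff shl_def shr_def)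
    then show "G (shl 0 i x) = - G (shl 1 i x)" "G (shr 0 i x) = - G (shr 1 i x)"
      using period_rel_antisym[OF assms(1) even] by metis+
  qed
  have "shl 0 1 x = x(0 := x 1 - x 0, 1 := x 0)" "shr 0 1 x = x(0 := x 1 - x 0)"
    by (auto simp: fun_eq_iff shl_def shr_def)
  then have 1: "G x + (G (shl 0 1 x) - G (shr 0 1 x)) = 0"
    using assms(1) unfolding period_rel_def by (metis (no_types, lifting) add.commute diff_add_cancel diff_self add_diff_eq diff_diff_eq2)
  have "{0 + 1..<r} = insert 1 {2..<r}" using r by auto
  then have "ihara_op 0 r G x = (\<Sum>i\<in>{2..<r}. G (shl 0 i x) - G (shr 0 i x))"
    using 1 by (simp add: ihara_op_def)
  also have "\<dots> = - (\<Sum>i\<in>{2..<r}. G (shl 1 i x) - G (shr 1 i x))"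
    unfolding sum_negf[symmetric] using s by (intro sum.cong) auto
  finally show ?thesis by (simp add: ihara_op_def numeral_2_eq_2)
qed

text \<open>No projection stands between the two operators, so the claim is a finite cancellation
  among values of \<open>g\<close> governed by \<open>rel\<close> and \<open>anti\<close>.\<close>

lemma ihara_op_ihara_op_prel3:
  assumes "period_rel G" and even: "\<And>x t. G (x(0 := - t)) = G (x(0 := t))"
    and loc: "\<And>x y. (\<And>i. i < 3 \<Longrightarrow> x i = y i) \<Longrightarrow> G x = G y"
  shows "ihara_op 0 3 (ihara_op 1 3 G) x = 0"
proof -
  define g where "g a b c = G (\<lambda>i. if i = 0 then a else if i = 1 then b else c)" for a b c
  have G: "G x = g (x 0) (x 1) (x 2)" for x
    unfolding g_def by (rule loc) (auto simp: less_Suc_eq numeral_3_eq_3 numeral_2_eq_2)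
  have rel: "g a b c = g (b - a) b c - g (b - a) a c" for a b c
    using assms(1)[unfolded period_rel_def, rule_format, of "\<lambda>i. if i = 0 then a else if i = 1 then b else c"]
    unfolding G by simp
  have anti: "g b a c = - g a b c" for a b c
    using period_rel_antisym[OF assms(1) even, of "\<lambda>i. if i = 0 then a else if i = 1 then b else c"]
    unfolding G by simp
  have sets: "{Suc 0..<3} = {1, 2::nat}" "{Suc (Suc 0)..<3} = {2::nat}" by auto
  define h where "h a b c = g a b c + (g a (c - b) b - g a (c - b) c)" for a b c
  have h: "ihara_op 1 3 G x = h (x 0) (x 1) (x 2)" for x
    by (simp add: ihara_op_def sets G shl_def shr_def h_def)
  define a b c where "a = x 0" and "b = x 1" and "c = x 2"
  have "ihara_op 0 3 (ihara_op 1 3 G) x = h a b c + (h (b - a) a c - h (b - a) b c) + (h (c - b) a b - h (c - b) a c)"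
    by (simp add: ihara_op_def[of 0] sets h[unfolded One_nat_def] shl_def shr_def a_def b_def c_def)
  also have "\<dots> = 0"
    \<comment> \<open>The relation at \<open>(a, b)\<close> removes three terms. The relation at
      \<open>(b - a, c - a)\<close>, with difference \<open>c - b\<close>, eliminates the terms
      containing \<open>c - a\<close>; what remains cancels in pairs by antisymmetry.\<close>
    using rel[of a b c] rel[of "b - a" "c - a" c] anti[of a "c - b" c] anti[of "b - a" "c - b" c]
      rel[of "b - a" "c - a" a] anti[of "b - a" "c - b" a] anti[of a "c - b" b] anti[of "b - a" "c - b" b]
    by (simp add: h_def)
  finally show ?thesis .
qed

lemma ihara_op_ihara_op_prel4:
  assumes "period_rel G" and even: "\<And>x t. G (x(0 := - t)) = G (x(0 := t))"
    and loc: "\<And>x y. (\<And>i. i < 4 \<Longrightarrow> x i = y i) \<Longrightarrow> G x = G y"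
  shows "ihara_op 0 4 (ihara_op 1 4 G) x = 0"
proof -
  let ?p = "\<lambda>a b c d i. if i = 0 then a else if i = 1 then b else if i = 2 then c else d"
  define g where "g a b c d = G (?p a b c d)" for a b c d
  have G: "G x = g (x 0) (x 1) (x 2) (x 3)" for x
    unfolding g_def by (rule loc) (auto simp: less_Suc_eq eval_nat_numeral)
  have rel: "g a b c d = g (b - a) b c d - g (b - a) a c d" for a b c d
    using assms(1)[unfolded period_rel_def, rule_format, of "?p a b c d"]
    unfolding G by simp
  have anti: "g b a c d = - g a b c d" for a b c d
    using period_rel_antisym[OF assms(1) even, of "?p a b c d"]
    unfolding G by simp
  have sets: "{Suc 0..<4} = {1, 2, 3::nat}" "{Suc (Suc 0)..<4} = {2, 3::nat}" by auto
  define h where "h a b c d = g a b c d + (g a (c - b) b d - g a (c - b) c d) + (g a (d - c) b c - g a (d - c) b d)" for a b c d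
  have h: "ihara_op 1 4 G x = h (x 0) (x 1) (x 2) (x 3)" for x
    by (simp add: ihara_op_def sets G shl_def shr_def h_def)
  define a b c d where "a = x 0" and "b = x 1" and "c = x 2" and "d = x 3"
  have "ihara_op 0 4 (ihara_op 1 4 G) x = h a b c d + (h (b - a) a c d - h (b - a) b c d)
      + (h (c - b) a b d - h (c - b) a c d) + (h (d - c) a b c - h (d - c) a b d)"
    by (simp add: ihara_op_def[of 0] sets h[unfolded One_nat_def] shl_def shr_def a_def b_def c_def d_def)
  also have "\<dots> = 0"
    \<comment> \<open>The same pattern with one more variable; the relation at
      \<open>(c - b, d - b)\<close>, with difference \<open>d - c\<close>, joins the others.\<close>
    using rel[of a b c d] rel[of "b - a" "c - a" c d] rel[of "b - a" "c - a" a d] rel[of "c - b" "d - b" a d] rel[of "c - b" "d - b" a b]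
      anti[of a "c - b" c d] anti[of "b - a" "c - b" c d]
      anti[of a "c - b" b d] anti[of a "d - c" b d] anti[of "b - a" "c - b" b d] anti[of "b - a" "d - c" b d]
      anti[of "b - a" "d - c" a d] anti[of "b - a" "c - b" a d] anti[of "c - b" "d - c" a d]
      anti[of a "d - c" b c] anti[of "b - a" "d - c" b c]
      anti[of "b - a" "d - c" a c] anti[of "c - b" "d - c" a c] anti[of "c - b" "d - c" a b]
    by (simp add: h_def)
  finally show ?thesis .
qed

section \<open>Consequences of hypothesis (H)\<close>

definition supported :: "nat \<Rightarrow> nat \<Rightarrow> (nat list \<Rightarrow> rat) \<Rightarrow> bool" where
  "supported N r v \<longleftrightarrow> (\<forall>n. n \<notin> Sset N r \<longrightarrow> v n = 0)"

lemma supported_rowmul: "supported N r (rowmul N r v A)"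
  by (simp add: supported_def rowmul_def)

lemma supported_vec_eval_zero: "supported N r v \<Longrightarrow> (\<And>x. vec_eval N r v x = 0) \<Longrightarrow> v = (\<lambda>_. 0)"
  using vec_eval_eq_zero_imp[of N r v] by (auto simp: supported_def fun_eq_iff)

text \<open>In depth 2 the operator at position 1 has an empty sum and is the identity, so the
  operator at position 0 annihilates the function.\<close>

lemma period_rel_imp_left_kernel2:
  assumes "period_rel (vec_eval N 2 v)"
  shows "rowmul N 2 v (Ejmat 2 N 2) = (\<lambda>_. 0)"
proof (rule supported_vec_eval_zero[OF supported_rowmul])
  fix x
  have "ihara_op 0 2 (vec_eval N 2 v) x = 0" for x
    using ihara_op_period_rel[OF assms vec_eval_even, of 2 x] by (simp add: ihara_op_def[of "Suc 0"])
  then have "ihara_op 0 2 (vec_eval N 2 v) = (\<lambda>_. 0)" by auto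
  then show "vec_eval N 2 (rowmul N 2 v (Ejmat 2 N 2)) x = 0"
    using vec_eval_rowmul_Ejmat[of 0 2 N v x] by (simp add: evenpos_zero)
qed

text \<open>The operator at position 1 leaves slot 0 alone, so its result \<open>D\<close> is still
  even there and zero at 0. Hence the projection between the factors may be dropped, and the
  identity in three or four variables applies.\<close>

lemma period_rel_imp_left_kernel:
  assumes "period_rel (vec_eval N r v)" "r = 3 \<or> r = 4"
  shows "rowmul N r (rowmul N r v (Ejmat (r - 1) N r)) (Ejmat r N r) = (\<lambda>_. 0)"
proof (rule supported_vec_eval_zero[OF supported_rowmul])
  fix x
  let ?G = "vec_eval N r v" and ?v' = "rowmul N r v (Ejmat (r - 1) N r)"
  define D where "D = ihara_op 1 r ?G"
  have r: "1 < r" "0 < r" using assms(2) by auto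
  have vec_eval': "vec_eval N r ?v' = evenpos r D"
    using vec_eval_rowmul_Ejmat[OF r(1), of N v] by (auto simp: D_def)
  have sh: "shl 1 i (y(0 := t)) = (shl 1 i y)(0 := t)" "shr 1 i (y(0 := t)) = (shr 1 i y)(0 := t)"
    if "i \<in> {1 + 1..<r}" for i y t
    using that by (auto simp: fun_eq_iff shl_def shr_def)
  have D_even: "D (y(0 := - t)) = D (y(0 := t))" for y t
    unfolding D_def ihara_op_def using sh r by (simp add: vec_eval_even)
  have D_zero: "D (y(0 := 0)) = 0" for y
    unfolding D_def ihara_op_def using sh r by (simp add: vec_eval_zero_at)
  have D_even': "D (y(0 := - y 0)) = D y" for y using D_even[of y "y 0"] by simp
  have "D = evenpos_at 0 D" unfolding evenpos_at_def D_even' D_zero by simp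
  then have "evenpos r (ihara_op 0 r (evenpos r D)) = evenpos r (ihara_op 0 r D)"
    using D_even' by (intro evenpos_ihara_op_evenpos) auto
  moreover have "ihara_op 0 r D y = 0" for y
  proof -
    have e: "?G (x(0 := - t)) = ?G (x(0 := t))" for x t by (rule vec_eval_even[OF r(2)])
    have c: "(\<And>i. i < r \<Longrightarrow> x i = y i) \<Longrightarrow> ?G x = ?G y" for x y by (rule vec_eval_cong)
    have "ihara_op 0 r (ihara_op 1 r ?G) y = 0" if "r = 3"
      using assms(1) e c unfolding that by (rule ihara_op_ihara_op_prel3)
    moreover have "ihara_op 0 r (ihara_op 1 r ?G) y = 0" if "r = 4"
      using assms(1) e c unfolding that by (rule ihara_op_ihara_op_prel4)
    ultimately show ?thesis unfolding D_def using assms(2) by blast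
  qed
  then have "ihara_op 0 r D = (\<lambda>_. 0)" by auto
  ultimately show "vec_eval N r (rowmul N r ?v' (Ejmat r N r)) x = 0"
    using vec_eval_rowmul_Ejmat[OF r(2), of N ?v' x, unfolded vec_eval'] by (simp add: evenpos_zero)
qed

section \<open>From row vectors to elements of \<open>Wsp\<close>\<close>

definition mpoly_of_vec :: "nat \<Rightarrow> nat \<Rightarrow> (nat list \<Rightarrow> rat) \<Rightarrow> mpoly" where
  "mpoly_of_vec N r v = (\<Sum>n\<in>Sset N r. Poly_Mapping.single (expo n) (v n))"

lemma mpoly_eval_mpoly_of_vec: "mpoly_eval (mpoly_of_vec N r v) x = vec_eval N r v x"
  by (simp add: mpoly_of_vec_def mpoly_eval_sum mpoly_eval_single mono_eval_expo vec_eval_def)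

lemma keys_mpoly_of_vec: "Poly_Mapping.keys (mpoly_of_vec N r v) \<subseteq> expo ` Sset N r"
proof -
  have "Poly_Mapping.keys (mpoly_of_vec N r v) \<subseteq> (\<Union>n\<in>Sset N r. Poly_Mapping.keys (Poly_Mapping.single (expo n) (v n)))"
    unfolding mpoly_of_vec_def by (rule keys_sum)
  then show ?thesis by (auto split: if_splits)
qed

lemma coeff_at_mpoly_of_vec:
  assumes "n \<in> Sset N r"
  shows "coeff_at (mpoly_of_vec N r v) n = v n"
proof -
  have "expo m = expo n \<longleftrightarrow> m = n" if "m \<in> Sset N r" for m
    using that assms expo_eq_imp Sset_subset_Lset by blast
  then have "coeff_at (mpoly_of_vec N r v) n = (\<Sum>m\<in>Sset N r. if m = n then v m else 0)"
    unfolding coeff_at_def mpoly_of_vec_def lookup_sum lookup_single when_def by (intro sum.cong) auto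
  then show ?thesis using assms by simp
qed

text \<open>The relation between functions lifts to polynomials, because a polynomial that vanishes
  at all points is zero.\<close>

lemma mpoly_of_vec_in_Wsp:
  assumes "period_rel (vec_eval N r v)"
  shows "mpoly_of_vec N r v \<in> Wsp N r"
proof -
  let ?P = "mpoly_of_vec N r v"
  let ?\<sigma> = "\<lambda>k. if k = 0 then mvar 1 - mvar 0 else mvar k"
  let ?\<tau> = "\<lambda>k. if k = 0 then mvar 1 - mvar 0 else if k = 1 then mvar 0 else mvar k"
  have "mpoly_eval (?P - (msubst ?\<sigma> ?P - msubst ?\<tau> ?P)) x = 0" for x
  proof -
    have *: "(\<lambda>i. mpoly_eval (?\<sigma> i) x) = x(0 := x 1 - x 0)"
      "(\<lambda>i. mpoly_eval (?\<tau> i) x) = x(0 := x 1 - x 0, 1 := x 0)"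
      by (auto simp: fun_eq_iff mpoly_eval_mvar mpoly_eval_diff)
    have "vec_eval N r v x = vec_eval N r v (x(0 := x 1 - x 0)) - vec_eval N r v (x(0 := x 1 - x 0, 1 := x 0))"
      using assms unfolding period_rel_def by blast
    then show ?thesis unfolding mpoly_eval_diff[of ?P] mpoly_eval_diff[of "msubst _ _"] mpoly_eval_msubst mpoly_eval_mpoly_of_vec * by linarith
  qed
  then have "?P = msubst ?\<sigma> ?P - msubst ?\<tau> ?P" using mpoly_eval_eq_zero_imp eq_iff_diff_eq_0 by blast
  then show ?thesis unfolding Wsp_def Vsp_def using keys_mpoly_of_vec by blast
qed

text \<open>On period polynomials \<open>F\<close> acts as the negative of
  \<open>Ejmat (r - 1)\<close>, so a vector killed by the latter has the same image under the map of
  (H) as the zero polynomial.\<close>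

lemma hypH_injective:
  assumes "hypH" "2 \<le> r" "supported N r v" "period_rel (vec_eval N r v)"
    and "rowmul N r v (Ejmat (r - 1) N r) = (\<lambda>_. 0)"
  shows "v = (\<lambda>_. 0)"
proof -
  let ?P = "mpoly_of_vec N r v" and ?G = "vec_eval N r v"
  let ?f = "\<lambda>P. rowmul N r (piv N r P) (Fmat N r)"
  have piv: "piv N r ?P = v"
    using assms(3) by (auto simp: piv_def coeff_at_mpoly_of_vec supported_def fun_eq_iff)
  have "?f ?P = (\<lambda>n. if n \<in> Sset N r then rowmul N r v (Ejmat r N r) n - v n else 0)"
  proof -
    have "(\<Sum>m\<in>Sset N r. v m * (if m = n then 1 else 0)) = v n" if "n \<in> Sset N r" for n
      using that by (simp add: if_distrib cong: if_cong)
    then show ?thesis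
      unfolding piv
      unfolding rowmul_def Fmat_def Emat_def right_diff_distrib sum_subtractf
      by (auto simp: fun_eq_iff Ejmat_def)
  qed
  then have "vec_eval N r (?f ?P) x = vec_eval N r (rowmul N r v (Ejmat r N r)) x - ?G x" for x
    by (simp add: vec_eval_def left_diff_distrib sum_subtractf)
  also have "\<dots> x = evenpos r (\<lambda>y. ?G y - ihara_op 1 r ?G y) x - ?G x" for x
  proof -
    have "ihara_op 0 r ?G = (\<lambda>y. ?G y - ihara_op 1 r ?G y)"
      using assms(2,4) by (intro ext ihara_op_period_rel vec_eval_even) auto
    then show ?thesis using vec_eval_rowmul_Ejmat[of 0 r N v x] assms(2) by simp
  qed
  also have "\<dots> x = - vec_eval N r (rowmul N r v (Ejmat (r - 1) N r)) x" for x
    using assms(2) vec_eval_rowmul_Ejmat[of 1 r N v x] by (simp add: evenpos_diff evenpos_vec_eval)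
  also have "\<dots> x = 0" for x
    using assms(5) by (simp add: vec_eval_def)
  finally have "?f ?P = (\<lambda>_. 0)" by (intro supported_vec_eval_zero[OF supported_rowmul])
  moreover have "?f 0 = (\<lambda>_. 0)" by (auto simp: fun_eq_iff rowmul_def piv_def coeff_at_def)
  moreover have "0 \<in> Wsp N r" by (simp add: Wsp_def Vsp_def msubst_def)
  moreover have "?P \<in> Wsp N r" by (rule mpoly_of_vec_in_Wsp[OF assms(4)])
  moreover have "inj_on ?f (Wsp N r)" using assms(1,2) unfolding hypH_def by blast
  ultimately have "?P = 0" by (metis (no_types, lifting) inj_onD)
  then have "v = piv N r 0" using piv by simp
  also have "\<dots> = (\<lambda>_. 0)" by (simp add: piv_def coeff_at_def fun_eq_iff)
  finally show ?thesis .
qed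

text \<open>An entry of \<open>Ejmat j\<close> vanishes unless the first \<open>r - j\<close> places
  agree. So for \<open>c \<le> r - j\<close> the matrix is block diagonal along prefixes of length
  \<open>c\<close>, and each block is a matrix of the same kind in depth
  \<open>r - c\<close>.\<close>

lemma rowmul_Ejmat_append:
  assumes s: "s \<in> Sset (sum_list s) c" and "sum_list s \<le> N" "j \<le> r" "c \<le> r - j"
    and n: "n \<in> Sset (N - sum_list s) (r - c)"
  shows "rowmul N r v (Ejmat j N r) (s @ n) =
    rowmul (N - sum_list s) (r - c) (\<lambda>m. v (s @ m)) (Ejmat j (N - sum_list s) (r - c)) n"
proof -
  have l: "length s = c" using s by (simp add: Sset_def)
  have cr: "c \<le> r" using assms(4) by simp
  have sn: "s @ n \<in> Sset N r" using Sset_append_iff[OF l cr] s n assms(2) by blast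
  have z: "Ejmat j N r m (s @ n) = 0" if "take c m \<noteq> s" for m
  proof -
    have "take (r - j) m \<noteq> take (r - j) (s @ n)"
    proof
      assume "take (r - j) m = take (r - j) (s @ n)"
      then have "take c (take (r - j) m) = take c (take (r - j) (s @ n))" by (rule arg_cong)
      then have "take c m = take c (s @ n)" unfolding take_take min_absorb1[OF assms(4)] .
      then show False using that l by simp
    qed
    then show ?thesis unfolding Ejmat_def by (rule if_not_P)
  qed
  have "rowmul N r v (Ejmat j N r) (s @ n) = (\<Sum>m\<in>{m \<in> Sset N r. take c m = s}. v m * Ejmat j N r m (s @ n))"
    unfolding rowmul_def if_P[OF sn] using z by (intro sum.mono_neutral_right) auto
  also have "\<dots> = (\<Sum>m\<in>Sset (N - sum_list s) (r - c). v (s @ m) * Ejmat j N r (s @ m) (s @ n))"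
    unfolding Sset_prefix_eq[OF s assms(2) cr, symmetric] by (simp add: sum.reindex inj_on_def)
  also have "\<dots> = (\<Sum>m\<in>Sset (N - sum_list s) (r - c). v (s @ m) * Ejmat j (N - sum_list s) (r - c) m n)"
  proof -
    have "r - c - j = r - j - c" by simp
    then have "Ejmat j N r (s @ m) (s @ n) = Ejmat j (N - sum_list s) (r - c) m n" for m
      using l assms(4) by (simp add: Ejmat_def)
    then show ?thesis by simp
  qed
  finally show ?thesis using n by (simp add: rowmul_def)
qed

text \<open>\<open>M\<close> is the weight of the tail; the tail is summed outermost so that each
  inner sum is a slice with fixed tail.\<close>

lemma sum_Sset_split:
  assumes "p \<le> r"
  shows "(\<Sum>n\<in>Sset N r. f n) = (\<Sum>M\<le>N. \<Sum>k\<in>Sset M (r - p). \<Sum>s\<in>Sset (N - M) p. f (s @ k))"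
proof -
  let ?T = "SIGMA M:{..N}. Sset M (r - p) \<times> Sset (N - M) p"
  have "(\<Sum>M\<le>N. \<Sum>k\<in>Sset M (r - p). \<Sum>s\<in>Sset (N - M) p. f (s @ k)) = (\<Sum>(M, k, s)\<in>?T. f (s @ k))"
    by (simp add: sum.cartesian_product sum.Sigma)
  also have "\<dots> = (\<Sum>n\<in>Sset N r. f n)"
  proof (rule sum.reindex_bij_witness[of _ "\<lambda>n. (sum_list (drop p n), drop p n, take p n)" "\<lambda>(M, k, s). s @ k"])
    fix t assume "t \<in> ?T"
    then obtain M k s where t: "t = (M, k, s)" "M \<le> N" "k \<in> Sset M (r - p)" "s \<in> Sset (N - M) p" by auto
    have len: "length s = p" "length k = r - p" "sum_list k = M" "sum_list s = N - M" using t by (auto simp: Sset_def)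
    show "(sum_list (drop p (case t of (M, k, s) \<Rightarrow> s @ k)), drop p (case t of (M, k, s) \<Rightarrow> s @ k),
        take p (case t of (M, k, s) \<Rightarrow> s @ k)) = t"
      using t len by simp
    show "(case t of (M, k, s) \<Rightarrow> s @ k) \<in> Sset N r"
      using Sset_append_iff[OF len(1) assms, of k N] t len by auto
    show "f (case t of (M, k, s) \<Rightarrow> s @ k) = (case t of (M, k, s) \<Rightarrow> f (s @ k))" using t by simp
  next
    fix n assume n: "n \<in> Sset N r"
    show "(case (sum_list (drop p n), drop p n, take p n) of (M, k, s) \<Rightarrow> s @ k) = n" by simp
    have "N - sum_list (drop p n) = sum_list (take p n)" using Sset_split(3)[OF n assms] by simp
    then show "(sum_list (drop p n), drop p n, take p n) \<in> ?T"
      using Sset_split[OF n assms] by simp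
  qed
  finally show ?thesis by simp
qed

text \<open>The relation moves only the first two variables, so after expansion by tails the
  monomial of the tail is a common factor.\<close>

lemma period_rel_if_tails:
  assumes r: "2 \<le> r" and tails: "\<And>M k. M \<le> N \<Longrightarrow> k \<in> Sset M (r - 2) \<Longrightarrow> period_rel (vec_eval (N - M) 2 (\<lambda>s. v (s @ k)))"
  shows "period_rel (vec_eval N r v)"
proof -
  have vec_eval: "vec_eval N r v x = (\<Sum>M\<le>N. \<Sum>k\<in>Sset M (r - 2). vec_eval (N - M) 2 (\<lambda>s. v (s @ k)) x * list_monom k (\<lambda>i. x (2 + i)))" for x
  proof -
    have "vec_eval N r v x = (\<Sum>M\<le>N. \<Sum>k\<in>Sset M (r - 2). \<Sum>s\<in>Sset (N - M) 2. v (s @ k) * list_monom (s @ k) x)"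
      unfolding vec_eval_def by (rule sum_Sset_split[OF r])
    also have "\<dots> = (\<Sum>M\<le>N. \<Sum>k\<in>Sset M (r - 2). vec_eval (N - M) 2 (\<lambda>s. v (s @ k)) x * list_monom k (\<lambda>i. x (2 + i)))"
      by (intro sum.cong refl) (auto simp: vec_eval_def sum_distrib_right list_monom_append Sset_def mult.assoc intro!: sum.cong)
    finally show ?thesis .
  qed
  show ?thesis
    unfolding period_rel_def
  proof
    fix x :: "nat \<Rightarrow> rat"
    show "vec_eval N r v x = vec_eval N r v (x(0 := x 1 - x 0)) - vec_eval N r v (x(0 := x 1 - x 0, 1 := x 0))"
      unfolding vec_eval sum_subtractf[symmetric]
    proof (intro sum.cong refl)
      fix M k assume "M \<in> {..N}" "k \<in> Sset M (r - 2)"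
      then have "period_rel (vec_eval (N - M) 2 (\<lambda>s. v (s @ k)))" using tails by simp
      then have *: "vec_eval (N - M) 2 (\<lambda>s. v (s @ k)) x = vec_eval (N - M) 2 (\<lambda>s. v (s @ k)) (x(0 := x 1 - x 0))
        - vec_eval (N - M) 2 (\<lambda>s. v (s @ k)) (x(0 := x 1 - x 0, 1 := x 0))"
        unfolding period_rel_def by blast
      show "vec_eval (N - M) 2 (\<lambda>s. v (s @ k)) x * list_monom k (\<lambda>i. x (2 + i)) =
        vec_eval (N - M) 2 (\<lambda>s. v (s @ k)) (x(0 := x 1 - x 0)) * list_monom k (\<lambda>i. (x(0 := x 1 - x 0)) (2 + i)) -
        vec_eval (N - M) 2 (\<lambda>s. v (s @ k)) (x(0 := x 1 - x 0, 1 := x 0)) * list_monom k (\<lambda>i. (x(0 := x 1 - x 0, 1 := x 0)) (2 + i))"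
        by (subst *) (simp add: left_diff_distrib)
    qed
  qed
qed

lemma vec_eval_lincomb: "vec_eval N r (\<lambda>n. \<Sum>j\<in>J. c j * u j n) = (\<lambda>x. \<Sum>j\<in>J. c j * vec_eval N r (u j) x)"
proof
  fix x
  show "vec_eval N r (\<lambda>n. \<Sum>j\<in>J. c j * u j n) x = (\<Sum>j\<in>J. c j * vec_eval N r (u j) x)"
    unfolding vec_eval_def sum_distrib_right sum_distrib_left by (subst sum.swap) (simp add: mult.assoc)
qed

lemma period_rel_lincomb:
  assumes "\<And>j. j \<in> J \<Longrightarrow> period_rel (G j)"
  shows "period_rel (\<lambda>x. \<Sum>j\<in>J. c j * G j x)"
  unfolding period_rel_def
proof
  fix x
  have "G j x = G j (x(0 := x 1 - x 0)) - G j (x(0 := x 1 - x 0, 1 := x 0))" if "j \<in> J" for j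
    using assms[OF that] unfolding period_rel_def by blast
  then show "(\<Sum>j\<in>J. c j * G j x) = (\<Sum>j\<in>J. c j * G j (x(0 := x 1 - x 0))) - (\<Sum>j\<in>J. c j * G j (x(0 := x 1 - x 0, 1 := x 0)))"
    unfolding sum_subtractf[symmetric] right_diff_distrib[symmetric] by (intro sum.cong refl) metis
qed

section \<open>Linear algebra\<close>

definition qscale :: "rat \<Rightarrow> (nat list \<Rightarrow> rat) \<Rightarrow> nat list \<Rightarrow> rat" where
  "qscale c v = (\<lambda>n. c * v n)"

interpretation vs: vector_space qscale
  by unfold_locales (simp_all add: qscale_def fun_eq_iff algebra_simps)

lemma qdim_eq: "qdim V = vs.dim V"
  by (simp add: qdim_def qscale_def[abs_def])

lemma sum_qscale_apply: "(\<Sum>i\<in>I. qscale (c i) (u i)) n = (\<Sum>i\<in>I. c i * u i n)"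
  by (induction I rule: infinite_finite_induct) (simp_all add: qscale_def)

lemma sum_qscale_eq_0_iff: "(\<Sum>i\<in>I. qscale (c i) (u i)) = 0 \<longleftrightarrow> (\<forall>n. (\<Sum>i\<in>I. c i * u i n) = 0)"
  by (simp add: fun_eq_iff sum_qscale_apply)

text \<open>Independence of an indexed family, so that families can be joined over disjoint sums
  without first knowing that the vectors are distinct; distinctness is a consequence.\<close>

definition fam_indep :: "'j set \<Rightarrow> ('j \<Rightarrow> nat list \<Rightarrow> rat) \<Rightarrow> bool" where
  "fam_indep J u \<longleftrightarrow> finite J \<and> (\<forall>t. (\<forall>n. (\<Sum>j\<in>J. t j * u j n) = 0) \<longrightarrow> (\<forall>j\<in>J. t j = 0))"

lemma fam_indepD: "fam_indep J u \<Longrightarrow> (\<And>n. (\<Sum>j\<in>J. t j * u j n) = 0) \<Longrightarrow> j \<in> J \<Longrightarrow> t j = 0"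
  unfolding fam_indep_def by blast

lemma fam_indep_imp_independent:
  assumes "fam_indep J u"
  shows "inj_on u J" "vs.independent (u ` J)"
proof -
  have fin: "finite J" using assms by (simp add: fam_indep_def)
  show inj: "inj_on u J"
  proof (rule inj_onI, rule ccontr)
    fix i j assume ij: "i \<in> J" "j \<in> J" "u i = u j" "i \<noteq> j"
    \<comment> \<open>A vector occurring at two indices would give a nontrivial relation with
      coefficients 1 and -1.\<close>
    let ?t = "\<lambda>k. if k = i then 1 else if k = j then - 1 else (0::rat)"
    have "(\<Sum>k\<in>J. ?t k * u k n) = 0" for n
    proof -
      have "(\<Sum>k\<in>J. ?t k * u k n) = (\<Sum>k\<in>{i, j}. ?t k * u k n)"
        using ij fin by (intro sum.mono_neutral_right) auto
      then show ?thesis using ij by simp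
    qed
    then have "?t i = 0" using assms ij(1) by (intro fam_indepD[of J u ?t])
    then show False by simp
  qed
  show "vs.independent (u ` J)"
  proof (rule vs.independent_if_scalars_zero)
    fix f x assume f: "(\<Sum>x\<in>u ` J. qscale (f x) x) = 0" and "x \<in> u ` J"
    then obtain j where j: "j \<in> J" "x = u j" by blast
    have "(\<Sum>j\<in>J. f (u j) * u j n) = 0" for n
      using f[unfolded sum_qscale_eq_0_iff] by (simp add: sum.reindex[OF inj])
    then show "f x = 0" unfolding j(2) using fam_indepD[OF assms, of "\<lambda>j. f (u j)"] j(1) by blast
  qed (use fin in simp)
qed

lemma independent_imp_fam_indep:
  assumes "vs.independent B" "finite B"
  shows "fam_indep B (\<lambda>b. b)"
  unfolding fam_indep_def
proof (intro conjI allI impI ballI)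
  fix t b assume "\<forall>n. (\<Sum>b\<in>B. t b * b n) = 0" "b \<in> B"
  then show "t b = 0"
    using vs.independentD[OF assms(1) assms(2) order_refl, of t b] by (simp add: sum_qscale_eq_0_iff)
qed fact

lemma card_le_if_fam_indep:
  assumes "fam_indep J u" "u ` J \<subseteq> vs.span T" "finite T"
  shows "card J \<le> card T"
proof -
  have "card (u ` J) \<le> card T"
    using vs.independent_span_bound[OF assms(3) fam_indep_imp_independent(2)[OF assms(1)] assms(2)] by simp
  then show ?thesis using card_image[OF fam_indep_imp_independent(1)[OF assms(1)]] by simp
qed

definition unitv :: "nat list \<Rightarrow> nat list \<Rightarrow> rat" where
  "unitv n = (\<lambda>m. if m = n then 1 else 0)"

lemma fam_indep_unitv: "finite S \<Longrightarrow> fam_indep S unitv"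
  unfolding fam_indep_def unitv_def
proof (intro conjI allI impI ballI)
  fix t :: "nat list \<Rightarrow> rat" and j
  assume S: "finite S" "\<forall>n. (\<Sum>j\<in>S. t j * (if n = j then 1 else 0)) = 0" "j \<in> S"
  then have "(\<Sum>k\<in>S. t k * (if j = k then 1 else 0)) = 0" by blast
  then show "t j = 0" using S by (simp add: if_distrib cong: if_cong)
qed simp

lemma in_span_unitv_iff:
  assumes "finite S"
  shows "v \<in> vs.span (unitv ` S) \<longleftrightarrow> (\<forall>n. n \<notin> S \<longrightarrow> v n = 0)"
proof
  assume "v \<in> vs.span (unitv ` S)"
  then obtain c where "v = (\<Sum>x\<in>unitv ` S. qscale (c x) x)"
    using vs.span_finite[of "unitv ` S"] assms by auto
  then show "\<forall>n. n \<notin> S \<longrightarrow> v n = 0"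
    by (auto simp: sum_qscale_apply unitv_def intro!: sum.neutral)
next
  assume v: "\<forall>n. n \<notin> S \<longrightarrow> v n = 0"
  have "v = (\<Sum>m\<in>S. qscale (v m) (unitv m))"
    using v assms by (auto simp: fun_eq_iff sum_qscale_apply unitv_def if_distrib cong: if_cong)
  moreover have "(\<Sum>m\<in>S. qscale (v m) (unitv m)) \<in> vs.span (unitv ` S)"
    by (intro vs.span_sum vs.span_scale vs.span_base) auto
  ultimately show "v \<in> vs.span (unitv ` S)" by simp
qed

lemma card_unitv: "finite S \<Longrightarrow> card (unitv ` S) = card S"
  by (intro card_image fam_indep_imp_independent(1) fam_indep_unitv)

text \<open>A basis \<open>B0\<close> of the kernel is extended to a basis of the span; the added
  vectors \<open>R\<close> span a complement on which \<open>f\<close> is injective, recorded as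
  independence of their images.\<close>

lemma rank_nullity:
  assumes add: "\<And>x y. f (x + y) = f x + f y" and scale: "\<And>c x. f (qscale c x) = qscale c (f x)"
    and B: "finite B" "vs.independent B"
  obtains B0 R where "finite B0" "vs.independent B0" "B0 \<subseteq> {v \<in> vs.span B. f v = 0}"
    "{v \<in> vs.span B. f v = 0} \<subseteq> vs.span B0"
    "fam_indep R f" "R \<subseteq> vs.span B" "card B \<le> card B0 + card R"
proof -
  let ?K = "{v \<in> vs.span B. f v = 0}"
  have f0: "f 0 = 0" using scale[of 0 0] by simp
  have fsum: "f (\<Sum>i\<in>I. qscale (c i) (u i)) = (\<Sum>i\<in>I. qscale (c i) (f (u i)))" for I c and u :: "'i \<Rightarrow> _"
    by (induction I rule: infinite_finite_induct) (simp_all only: sum.infinite sum.empty sum.insert f0 add scale simp_thms)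
  obtain B0 where B0: "B0 \<subseteq> ?K" "vs.independent B0" "?K \<subseteq> vs.span B0"
    using vs.maximal_independent_subset by blast
  have finB0: "finite B0" using vs.independent_span_bound[OF B(1) B0(2)] B0(1) by blast
  obtain B1 where B1: "B0 \<subseteq> B1" "B1 \<subseteq> vs.span B" "vs.independent B1" "vs.span B \<subseteq> vs.span B1"
    using vs.maximal_independent_subset_extend[of B0 "vs.span B"] B0(1,2) by blast
  have finB1: "finite B1" using vs.independent_span_bound[OF B(1) B1(3) B1(2)] by simp
  have cB: "card B \<le> card B1"
    using vs.independent_span_bound[OF finB1 B(2)] B1(4) vs.span_superset by blast
  let ?R = "B1 - B0"
  have fam: "fam_indep ?R f"
    unfolding fam_indep_def
  proof (intro conjI allI impI ballI)
    fix t b assume t: "\<forall>n. (\<Sum>b\<in>?R. t b * f b n) = 0" and b: "b \<in> ?R"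
    let ?y = "\<Sum>b\<in>?R. qscale (t b) b"
    have "f ?y = 0" unfolding fsum sum_qscale_eq_0_iff by (rule t)
    moreover have "?y \<in> vs.span B" using B1(2) by (intro vs.span_sum vs.span_scale) auto
    ultimately have "?y \<in> vs.span B0" using B0(3) by blast
    then obtain s where s: "?y = (\<Sum>b\<in>B0. qscale (s b) b)"
      using vs.span_finite[OF finB0] by auto
    \<comment> \<open>Expanding \<open>?y\<close> in the kernel basis gives a relation on the
      extended basis, whose coefficients off \<open>B0\<close> are those of
      \<open>t\<close>.\<close>
    let ?t = "\<lambda>b. if b \<in> B0 then - s b else t b"
    have "(\<Sum>b\<in>B1. qscale (?t b) b) = (\<Sum>b\<in>?R. qscale (?t b) b) + (\<Sum>b\<in>B0. qscale (?t b) b)"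
      by (rule sum.subset_diff[OF B1(1) finB1])
    also have "\<dots> = ?y - (\<Sum>b\<in>B0. qscale (s b) b)"
      by (simp add: sum_negf)
    finally have "(\<Sum>b\<in>B1. qscale (?t b) b) = 0" using s by simp
    then have "?t b = 0" using vs.independentD[OF B1(3) finB1 order_refl, of ?t b] b by simp
    then show "t b = 0" using b by simp
  qed (use finB1 in simp)
  show ?thesis
  proof (rule that[OF finB0 B0(2,1,3) fam])
    show "?R \<subseteq> vs.span B" using B1(2) by blast
    show "card B \<le> card B0 + card ?R"
      using cB card_Diff_subset[OF finB0 B1(1)] card_mono[OF finB1 B1(1)] by simp
  qed
qed

text \<open>The column space is orthogonal to the left kernel, and the standard bilinear form over the rationals
  is anisotropic.\<close>

lemma card_left_kernel_le_qdim_rker: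
  assumes fam: "fam_indep J u"
    and sup: "\<And>j n. j \<in> J \<Longrightarrow> n \<notin> Sset N r \<Longrightarrow> u j n = 0"
    and ker: "\<And>j n. j \<in> J \<Longrightarrow> n \<in> Sset N r \<Longrightarrow> (\<Sum>m\<in>Sset N r. u j m * C m n) = 0"
  shows "card J \<le> qdim (rker N r C)"
proof -
  let ?S = "Sset N r"
  define B where "B = unitv ` ?S"
  have finB: "finite B" by (simp add: B_def)
  have cB: "card B = card ?S" by (simp add: B_def card_unitv)
  have span: "v \<in> vs.span B \<longleftrightarrow> (\<forall>n. n \<notin> ?S \<longrightarrow> v n = 0)" for v
    unfolding B_def by (rule in_span_unitv_iff) simp
  define f where "f v = (\<lambda>m. if m \<in> ?S then \<Sum>n\<in>?S. C m n * v n else 0)" for v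
  have f_add: "f (x + y) = f x + f y" for x y
    by (auto simp: f_def fun_eq_iff distrib_left sum.distrib)
  have f_scale: "f (qscale c x) = qscale c (f x)" for c x
    by (auto simp: f_def qscale_def fun_eq_iff sum_distrib_left mult_ac)
  have indB: "vs.independent B"
    unfolding B_def by (rule fam_indep_imp_independent(2)[OF fam_indep_unitv]) simp
  obtain B0 R where B0: "finite B0" "vs.independent B0" "B0 \<subseteq> {v \<in> vs.span B. f v = 0}"
    and "{v \<in> vs.span B. f v = 0} \<subseteq> vs.span B0"
    and R: "fam_indep R f" and "R \<subseteq> vs.span B" and cd: "card B \<le> card B0 + card R"
    by (rule rank_nullity[OF f_add f_scale finB indB])
  have rker: "rker N r C = {v \<in> vs.span B. f v = 0}"
    unfolding rker_def span f_def by (auto simp: fun_eq_iff)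
  have finJ: "finite J" and finR: "finite R" using fam R by (simp_all add: fam_indep_def)
  have orth: "(\<Sum>m\<in>?S. u j m * f v m) = 0" if "j \<in> J" for j v
  proof -
    have "(\<Sum>m\<in>?S. u j m * f v m) = (\<Sum>m\<in>?S. \<Sum>n\<in>?S. v n * (u j m * C m n))"
      by (simp add: f_def sum_distrib_left mult_ac)
    also have "\<dots> = (\<Sum>n\<in>?S. v n * (\<Sum>m\<in>?S. u j m * C m n))"
      by (subst sum.swap) (simp add: sum_distrib_left)
    finally show ?thesis using ker[OF \<open>j \<in> J\<close>] by simp
  qed
  have fsup: "f v n = 0" if "n \<notin> ?S" for v n using that by (simp add: f_def)
  let ?u = "case_sum f u"
  have "fam_indep (R <+> J) ?u"
    unfolding fam_indep_def
  proof (intro conjI allI impI)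
    show "finite (R <+> J)" using finR finJ by simp
    fix t assume "\<forall>n. (\<Sum>j\<in>R <+> J. t j * ?u j n) = 0"
    then have t: "(\<Sum>d\<in>R. t (Inl d) * f d n) + (\<Sum>j\<in>J. t (Inr j) * u j n) = 0" for n
      using finR finJ by (simp add: sum.Plus)
    define y where "y n = (\<Sum>d\<in>R. t (Inl d) * f d n)" for n
    have yJ: "y n = - (\<Sum>j\<in>J. t (Inr j) * u j n)" for n using t[of n] by (simp add: y_def eq_neg_iff_add_eq_0)
    have uy: "(\<Sum>m\<in>?S. u j m * y m) = 0" if "j \<in> J" for j
    proof -
      have "(\<Sum>m\<in>?S. u j m * y m) = (\<Sum>m\<in>?S. \<Sum>d\<in>R. t (Inl d) * (u j m * f d m))"
        by (simp add: y_def sum_distrib_left mult_ac)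
      also have "\<dots> = (\<Sum>d\<in>R. t (Inl d) * (\<Sum>m\<in>?S. u j m * f d m))"
        by (subst sum.swap) (simp add: sum_distrib_left)
      finally show ?thesis using orth[OF that] by simp
    qed
    \<comment> \<open>\<open>y\<close> lies in the column space and, by \<open>yJ\<close>, also in
      the span of the left kernel vectors, hence is orthogonal to itself.\<close>
    have "(\<Sum>m\<in>?S. y m * y m) = - (\<Sum>m\<in>?S. \<Sum>j\<in>J. t (Inr j) * (u j m * y m))"
      by (subst (1) yJ) (simp add: sum_distrib_right sum_negf mult.assoc)
    also have "(\<Sum>m\<in>?S. \<Sum>j\<in>J. t (Inr j) * (u j m * y m)) = (\<Sum>j\<in>J. t (Inr j) * (\<Sum>m\<in>?S. u j m * y m))"
      by (subst sum.swap) (simp add: sum_distrib_left)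
    finally have "(\<Sum>m\<in>?S. y m * y m) = 0" using uy by simp
    then have "\<forall>m\<in>?S. y m * y m = 0"
      by (subst (asm) sum_nonneg_eq_0_iff) auto
    then have y0: "y m = 0" for m
      using fsup by (cases "m \<in> ?S") (auto simp: y_def intro!: sum.neutral)
    have "t (Inl d) = 0" if "d \<in> R" for d
      using fam_indepD[OF R, of "\<lambda>d. t (Inl d)"] y0 that by (simp add: y_def)
    moreover have "t (Inr j) = 0" if "j \<in> J" for j
      using fam_indepD[OF fam, of "\<lambda>j. t (Inr j)"] y0 yJ that by simp
    ultimately show "\<forall>j\<in>R <+> J. t j = 0" by auto
  qed
  moreover have "?u ` (R <+> J) \<subseteq> vs.span B"
    using fsup sup by (auto simp: span)
  ultimately have "card (R <+> J) \<le> card B" using finB by (rule card_le_if_fam_indep)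
  \<comment> \<open>The joined family has \<open>card R + card J\<close> members in a space of
    dimension \<open>card B\<close>, which is at most \<open>card B0 + card R\<close>.\<close>
  then have "card J \<le> card B0" using cd finR finJ by (simp add: card_Plus)
  also have "card B0 \<le> vs.dim (rker N r C)"
  proof -
    obtain B' where B': "B' \<subseteq> rker N r C" "vs.independent B'" "rker N r C \<subseteq> vs.span B'" "card B' = vs.dim (rker N r C)"
      using vs.basis_exists by blast
    have "finite B'" using vs.independent_span_bound[OF finB B'(2)] B'(1) rker by blast
    then show ?thesis
      using vs.independent_span_bound[of B' B0] B0 B' rker by auto
  qed
  finally show ?thesis by (simp add: qdim_eq)
qed

section \<open>Lower bound for the space of even period polynomials\<close>

lemma vec_eval2: "vec_eval q 2 v x = (\<Sum>n\<in>Sset q 2. v n * (x 0 ^ (n ! 0 - 1) * x 1 ^ (n ! 1 - 1)))"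
  unfolding vec_eval_def by (intro sum.cong refl) (auto simp: Sset_def list_monom_def numeral_2_eq_2)

definition antisym2 :: "nat \<Rightarrow> (nat list \<Rightarrow> rat) set" where
  "antisym2 q = {v. supported q 2 v \<and> (\<forall>a b. v [b, a] = - v [a, b])}"

lemma Sset2_eq_pair: "n \<in> Sset q 2 \<Longrightarrow> n = [n ! 0, n ! 1]"
  by (auto simp: Sset_def length_Suc_conv numeral_2_eq_2)

lemma Sset2_iff: "[a, b] \<in> Sset q 2 \<longleftrightarrow> a + b = q \<and> 3 \<le> a \<and> odd a \<and> 3 \<le> b \<and> odd b"
  unfolding Sset_iff by auto

text \<open>The six transformations carry the points \<open>y \<ge> 3\<close> into six disjoint
  intervals. These avoid the short orbits: 0 and 1 (with infinity), and -1, 1/2, 2.\<close>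

lemma card_ge_orbit_points:
  fixes Z :: "rat set"
  assumes fin: "finite Z" and base: "{-1, 0, 1/2, 1, 2} \<subseteq> Z"
    and orb: "\<And>y. y \<in> Y \<Longrightarrow> {y, 1 - y, 1 / y, 1 / (1 - y), 1 - 1 / y, 1 - 1 / (1 - y)} \<subseteq> Z"
    and Y: "finite Y" "\<And>y. y \<in> Y \<Longrightarrow> 3 \<le> y"
  shows "6 * card Y + 5 \<le> card Z"
proof -
  let ?f1 = "\<lambda>y::rat. y" and ?f2 = "\<lambda>y::rat. 1 - y" and ?f3 = "\<lambda>y::rat. 1 / y" and ?f4 = "\<lambda>y::rat. 1 / (1 - y)"
    and ?f5 = "\<lambda>y::rat. 1 - 1 / y" and ?f6 = "\<lambda>y::rat. 1 - 1 / (1 - y)"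
  let ?P = "{-1, 0, 1/2, 1, 2} :: rat set"
  have inj: "inj_on ?f1 Y" "inj_on ?f2 Y" "inj_on ?f3 Y" "inj_on ?f4 Y" "inj_on ?f5 Y" "inj_on ?f6 Y"
    by (auto simp: inj_on_def)
  \<comment> \<open>\<open>\<rho>\<close> numbers the interval containing a point, with 0 for none,
    which yields all the disjointness claims at once.\<close>
  define \<rho> :: "rat \<Rightarrow> nat" where "\<rho> x = (if 3 \<le> x then 1 else if x \<le> -2 then 2 else if 0 < x \<and> x \<le> 1/3 then 3
    else if -1/2 \<le> x \<and> x < 0 then 4 else if 2/3 \<le> x \<and> x < 1 then 5 else if 1 < x \<and> x \<le> 3/2 then 6 else 0)" for x
  define F where "F k = [?P, ?f1 ` Y, ?f2 ` Y, ?f3 ` Y, ?f4 ` Y, ?f5 ` Y, ?f6 ` Y] ! k" for k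
  have F: "F 0 = ?P" "F 1 = ?f1 ` Y" "F 2 = ?f2 ` Y" "F 3 = ?f3 ` Y" "F 4 = ?f4 ` Y" "F 5 = ?f5 ` Y" "F 6 = ?f6 ` Y"
    by (simp_all add: F_def)
  have "\<rho> (?f1 y) = 1" "\<rho> (?f2 y) = 2" "\<rho> (?f3 y) = 3" "\<rho> (?f4 y) = 4" "\<rho> (?f5 y) = 5" "\<rho> (?f6 y) = 6" if "y \<in> Y" for y
  proof -
    have y: "3 \<le> y" using Y(2) that .
    define u w where "u = 1 / y" and "w = 1 / (1 - y)"
    have i1: "0 < u" "u \<le> 1/3" using y by (auto simp: u_def field_simps)
    have i2: "w < 0" "-1/2 \<le> w" using y by (auto simp: w_def field_simps)
    show "\<rho> (?f1 y) = 1" "\<rho> (?f2 y) = 2" "\<rho> (?f3 y) = 3" "\<rho> (?f4 y) = 4" "\<rho> (?f5 y) = 5" "\<rho> (?f6 y) = 6"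
      unfolding \<rho>_def u_def[symmetric] w_def[symmetric] using y i1 i2 by auto
  qed
  moreover have "\<rho> x = 0" if "x \<in> ?P" for x using that by (auto simp: \<rho>_def)
  moreover define K :: "nat set" where "K = {0, 1, 2, 3, 4, 5, 6}"
  ultimately have r: "\<rho> x = k" if "k \<in> K" "x \<in> F k" for k x
    using that unfolding K_def by (auto simp only: F insert_iff empty_iff image_iff)
  have "card (\<Union>k\<in>K. F k) = (\<Sum>k\<in>K. card (F k))"
  proof (rule card_UN_disjoint)
    show "finite K" "\<forall>k\<in>K. finite (F k)" using Y(1) by (simp_all add: K_def F[unfolded One_nat_def])
    show "\<forall>k\<in>K. \<forall>l\<in>K. k \<noteq> l \<longrightarrow> F k \<inter> F l = {}" using r by blast
  qed
  also have "\<dots> = 6 * card Y + 5"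
    using inj unfolding K_def by (simp add: F[unfolded One_nat_def] card_image)
  finally have "card (\<Union>k\<in>K. F k) = 6 * card Y + 5" .
  moreover have "(\<Union>k\<in>K. F k) \<subseteq> Z"
  proof -
    have "?f1 ` Y \<subseteq> Z" "?f2 ` Y \<subseteq> Z" "?f3 ` Y \<subseteq> Z" "?f4 ` Y \<subseteq> Z" "?f5 ` Y \<subseteq> Z" "?f6 ` Y \<subseteq> Z"
      using orb by auto
    then show ?thesis unfolding K_def UN_insert UN_empty F using base by (intro Un_least) auto
  qed
  ultimately show ?thesis using card_mono[OF fin] by metis
qed

text \<open>\<open>T\<close> is the defect of the relation at \<open>(x, 1)\<close>. Its degree is
  at most \<open>2 * h\<close>, whereas the prescribed zeros, their orbits and the five exceptional
  points are \<open>6 * (h div 3) + 5\<close> roots.\<close>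

lemma antisym2_period_rel:
  assumes v: "v \<in> antisym2 (2 * h + 2)"
    and G: "\<And>x y. G x y = vec_eval (2 * h + 2) 2 v (\<lambda>i. if i = 0 then x else y)"
    and T: "\<And>x. T x = G x 1 - G (1 - x) 1 + G (1 - x) x"
    and zero: "\<And>i. i < h div 3 \<Longrightarrow> T (of_nat i + 3) = 0"
  shows "period_rel (vec_eval (2 * h + 2) 2 v)"
proof -
  let ?q = "2 * h + 2" and ?S = "Sset (2 * h + 2) 2"
  have Gs: "G x y = (\<Sum>n\<in>?S. v n * (x ^ (n ! 0 - 1) * y ^ (n ! 1 - 1)))" for x y
    unfolding G vec_eval2 by simp
  have vec_eval: "vec_eval ?q 2 v x = G (x 0) (x 1)" for x unfolding Gs vec_eval2 ..
  have exps: "even (n ! 0 - 1)" "even (n ! 1 - 1)" "0 < n ! 0 - 1" "0 < n ! 1 - 1"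
    "(n ! 0 - 1) + (n ! 1 - 1) = 2 * h" if "n \<in> ?S" for n
    using that Sset2_eq_pair[OF that] Sset2_iff[of "n ! 0" "n ! 1" ?q] by auto
  have even1: "G (- x) y = G x y" and even2: "G x (- y) = G x y" for x y
    unfolding Gs using exps by (auto intro!: sum.cong)
  have zero1: "G 0 y = 0" and zero2: "G x 0 = 0" for x y
    unfolding Gs using exps by (auto intro!: sum.neutral)
  have hom: "G (c * x) (c * y) = c ^ (2 * h) * G x y" for c x y
  proof -
    have "(c * x) ^ (n ! 0 - 1) * (c * y) ^ (n ! 1 - 1) = c ^ (2 * h) * (x ^ (n ! 0 - 1) * y ^ (n ! 1 - 1))"
      if "n \<in> ?S" for n
      unfolding exps(5)[OF that, symmetric] power_add power_mult_distrib by (simp only: mult_ac)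
    then show ?thesis unfolding Gs sum_distrib_left by (auto intro!: sum.cong)
  qed
  have anti: "G y x = - G x y" for x y
  proof -
    have "G y x = (\<Sum>n\<in>?S. v (rev n) * (y ^ (rev n ! 0 - 1) * x ^ (rev n ! 1 - 1)))"
      unfolding Gs
    proof (rule sum.reindex_bij_witness[of _ rev rev])
      show "rev n \<in> ?S" if "n \<in> ?S" for n using that unfolding Sset_iff by simp
      then show "rev n \<in> ?S" if "n \<in> ?S" for n using that .
    qed auto
    also have "\<dots> = (\<Sum>n\<in>?S. - (v n * (x ^ (n ! 0 - 1) * y ^ (n ! 1 - 1))))"
    proof (rule sum.cong[OF refl])
      fix n assume "n \<in> ?S"
      then obtain a b where n: "n = [a, b]" using Sset2_eq_pair by blast
      have "v [b, a] = - v [a, b]" using v unfolding antisym2_def by blast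
      then show "v (rev n) * (y ^ (rev n ! 0 - 1) * x ^ (rev n ! 1 - 1)) = - (v n * (x ^ (n ! 0 - 1) * y ^ (n ! 1 - 1)))"
        unfolding n by simp
    qed
    finally show ?thesis by (simp add: Gs sum_negf)
  qed
  have diag: "G x x = 0" for x using anti[of x x] by simp
  have T1: "T (1 - x) = - T x" for x
    unfolding T using anti[of "1 - x" x] by simp
  have T2: "x ^ (2 * h) * T (1 / x) = - T x" if "x \<noteq> 0" for x
  proof -
    have "x ^ (2 * h) * T (1 / x) = G (x * (1 / x)) (x * 1) - G (x * (1 - 1 / x)) (x * 1) + G (x * (1 - 1 / x)) (x * (1 / x))"
      unfolding T hom by (simp add: algebra_simps)
    also have "\<dots> = G 1 x - G (x - 1) x + G (x - 1) 1"
      using that by (simp add: right_diff_distrib)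
    also have "\<dots> = - T x"
      unfolding T using anti[of x 1] even1[of "1 - x"] by simp
    finally show ?thesis .
  qed
  define p where "p = (\<Sum>n\<in>?S. smult (v n) ([:0, 1:] ^ (n ! 0 - 1) - [:1, -1:] ^ (n ! 0 - 1)
      + [:1, -1:] ^ (n ! 0 - 1) * [:0, 1:] ^ (n ! 1 - 1)))"
  have pT: "poly p x = T x" for x
    unfolding p_def T Gs by (simp add: poly_sum sum.distrib sum_subtractf algebra_simps)
  have deg: "degree p \<le> 2 * h"
    unfolding p_def
  proof (rule degree_sum_le)
    fix n assume n: "n \<in> ?S"
    have d: "degree ([:0, 1::rat:] ^ a) \<le> a" "degree ([:1, -1::rat:] ^ a) \<le> a" for a
      using degree_power_le[of "[:0, 1::rat:]" a] degree_power_le[of "[:1, -1::rat:]" a] by auto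
    have "degree ([:1, -1::rat:] ^ (n ! 0 - 1) * [:0, 1:] ^ (n ! 1 - 1)) \<le> (n ! 0 - 1) + (n ! 1 - 1)"
      by (rule order_trans[OF degree_mult_le add_mono[OF d(2) d(1)]])
    then show "degree (smult (v n) ([:0, 1:] ^ (n ! 0 - 1) - [:1, -1:] ^ (n ! 0 - 1)
      + [:1, -1:] ^ (n ! 0 - 1) * [:0, 1:] ^ (n ! 1 - 1))) \<le> 2 * h"
      using exps(5)[OF n] d(1)[of "n ! 0 - 1"] d(2)[of "n ! 0 - 1"]
      by (intro order_trans[OF degree_smult_le] degree_add_le degree_diff_le) auto
  qed simp
  have "p = 0"
  proof (rule ccontr)
    assume "p \<noteq> 0"
    let ?Z = "{x. poly p x = 0}"
    define Y where "Y = (\<lambda>i. of_nat i + 3 :: rat) ` {..<h div 3}"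
    have z1: "1 - x \<in> ?Z" if "x \<in> ?Z" for x using that T1[of x] by (simp add: pT)
    have z2: "1 / x \<in> ?Z" if "x \<in> ?Z" "x \<noteq> 0" for x using that T2[of x] by (simp add: pT)
    \<comment> \<open>The point -1 is fixed by \<open>x \<mapsto> 1 / x\<close>, under which
      \<open>T\<close> changes sign, the factor \<open>(-1) ^ (2 * h)\<close> being 1.\<close>
    have m1: "-1 \<in> ?Z" using T2[of "-1"] by (simp add: pT)
    have z0: "0 \<in> ?Z" by (simp add: pT T zero1 zero2 diag)
    have t2: "2 \<in> ?Z" using z1[OF m1] by simp
    have "6 * card Y + 5 \<le> card ?Z"
    proof (rule card_ge_orbit_points)
      show "finite ?Z" using \<open>p \<noteq> 0\<close> by (rule poly_roots_finite)
      show "{-1, 0, 1/2, 1, 2} \<subseteq> ?Z"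
        using m1 z0 t2 z2[OF t2] z1[OF z0] by simp
      show "finite Y" by (simp add: Y_def)
      show Y3: "3 \<le> y" if "y \<in> Y" for y using that by (auto simp: Y_def)
      fix y assume y: "y \<in> Y"
      have yZ: "y \<in> ?Z" using y zero by (auto simp: Y_def pT)
      have "y \<noteq> 0" "1 - y \<noteq> 0" using Y3[OF y] by auto
      then show "{y, 1 - y, 1 / y, 1 / (1 - y), 1 - 1 / y, 1 - 1 / (1 - y)} \<subseteq> ?Z"
        using yZ z1[OF yZ] z2[OF yZ] z2[OF z1[OF yZ]] z1[OF z2[OF yZ]] z1[OF z2[OF z1[OF yZ]]] by simp
    qed
    moreover have "card Y = h div 3"
      unfolding Y_def by (subst card_image) (auto simp: inj_on_def)
    ultimately show False
      \<comment> \<open>Since \<open>h mod 3 \<le> 2\<close>,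
        \<open>2 * h \<le> 6 * (h div 3) + 4\<close>.\<close>
      using card_poly_roots_bound[OF \<open>p \<noteq> 0\<close>] deg by presburger
  qed
  then have T0: "T x = 0" for x using pT[of x] by simp
  \<comment> \<open>The relation is homogenised again from \<open>T (a / b) = 0\<close>; at
    \<open>b = 0\<close> both sides vanish directly.\<close>
  have rel: "G a b = G (b - a) b - G (b - a) a" for a b
  proof (cases "b = 0")
    case True
    then show ?thesis using diag[of a] by (simp add: zero2 even1)
  next
    case False
    have "b ^ (2 * h) * T (a / b) = G (b * (a / b)) (b * 1) - G (b * (1 - a / b)) (b * 1) + G (b * (1 - a / b)) (b * (a / b))"
      unfolding T hom by (simp add: algebra_simps)
    then show ?thesis using False T0[of "a / b"] by (simp add: right_diff_distrib)
  qed
  show ?thesis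
    unfolding period_rel_def
  proof
    fix x :: "nat \<Rightarrow> rat"
    have upd: "(x(0 := s)) 0 = s" "(x(0 := s)) 1 = x 1" "(x(0 := s, 1 := t)) 0 = s" "(x(0 := s, 1 := t)) 1 = t" for s t
      by simp_all
    show "vec_eval ?q 2 v x = vec_eval ?q 2 v (x(0 := x 1 - x 0)) - vec_eval ?q 2 v (x(0 := x 1 - x 0, 1 := x 0))"
      unfolding vec_eval upd by (rule rel)
  qed
qed

text \<open>There are \<open>(h - 1) div 2\<close> independent antisymmetric even polynomials of
  degree \<open>2 * h\<close>, and the vanishing of \<open>T\<close> at \<open>h div 3\<close>
  points costs at most that many dimensions.\<close>

lemma period_vectors_exist:
  obtains B where "finite B" "vs.independent B" "(h - 1) div 2 \<le> card B + h div 3"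
    "\<And>w. w \<in> B \<Longrightarrow> supported (2 * h + 2) 2 w \<and> period_rel (vec_eval (2 * h + 2) 2 w)"
proof -
  let ?q = "2 * h + 2"
  define I where "I = {1..<Suc ((h - 1) div 2)}"
  define a where "a i = [2 * i + 1, 2 * (h - i) + 1]" for i
  define b where "b i = [2 * (h - i) + 1, 2 * i + 1]" for i
  define \<beta> where "\<beta> i = (\<lambda>n. unitv (a i) n - unitv (b i) n)" for i
  have I: "1 \<le> i" "2 * i < h" if "i \<in> I" for i using that by (auto simp: I_def)
  have fam: "fam_indep I \<beta>"
    unfolding fam_indep_def
  proof (intro conjI allI impI ballI)
    show fin: "finite I" by (simp add: I_def)
    fix t i assume t: "\<forall>n. (\<Sum>j\<in>I. t j * \<beta> j n) = 0" and i: "i \<in> I"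
    have "\<beta> j (a i) = (if j = i then 1 else 0)" if "j \<in> I" for j
      using I[OF that] I[OF i] by (auto simp: \<beta>_def a_def b_def unitv_def)
    then have "(\<Sum>j\<in>I. t j * \<beta> j (a i)) = (\<Sum>j\<in>I. if j = i then t j else 0)"
      by (intro sum.cong) auto
    then show "t i = 0" using t i by (simp add: sum.delta[OF fin])
  qed
  let ?B = "\<beta> ` I"
  have sub: "vs.subspace (antisym2 ?q)"
    unfolding vs.subspace_def
  proof (intro conjI ballI allI)
    have D: "n \<notin> Sset ?q 2 \<Longrightarrow> v n = 0" "v [b, a] = - v [a, b]" if "v \<in> antisym2 ?q" for v n a b
      using that unfolding antisym2_def supported_def by blast+
    have intro: "v \<in> antisym2 ?q" if "\<And>n. n \<notin> Sset ?q 2 \<Longrightarrow> v n = 0" "\<And>a b. v [b, a] = - v [a, b]" for v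
      using that unfolding antisym2_def supported_def by blast
    show "0 \<in> antisym2 ?q" by (rule intro) simp_all
    show "x + y \<in> antisym2 ?q" if "x \<in> antisym2 ?q" "y \<in> antisym2 ?q" for x y
    proof (rule intro)
      show "(x + y) n = 0" if "n \<notin> Sset ?q 2" for n using D(1)[OF \<open>x \<in> _\<close> that] D(1)[OF \<open>y \<in> _\<close> that] by simp
      show "(x + y) [b, a] = - (x + y) [a, b]" for a b
        using D(2)[OF \<open>x \<in> _\<close>, of b a] D(2)[OF \<open>y \<in> _\<close>, of b a] by simp
    qed
    show "qscale c x \<in> antisym2 ?q" if "x \<in> antisym2 ?q" for c x
    proof (rule intro)
      show "qscale c x n = 0" if "n \<notin> Sset ?q 2" for n using D(1)[OF \<open>x \<in> _\<close> that] by (simp add: qscale_def)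
      show "qscale c x [b, a] = - qscale c x [a, b]" for a b
        using D(2)[OF that, of b a] by (simp add: qscale_def)
    qed
  qed
  have "\<beta> i \<in> antisym2 ?q" if "i \<in> I" for i
  proof -
    have "a i \<in> Sset ?q 2" "b i \<in> Sset ?q 2"
      unfolding a_def b_def Sset2_iff using I[OF that] by auto
    then show ?thesis by (auto simp: antisym2_def supported_def \<beta>_def unitv_def a_def b_def)
  qed
  then have span: "vs.span ?B \<subseteq> antisym2 ?q"
    by (intro vs.span_minimal sub) auto
  define G where "G v x y = vec_eval ?q 2 v (\<lambda>i. if i = 0 then x else y)" for v x y
  define T where "T v x = G v x 1 - G v (1 - x) 1 + G v (1 - x) x" for v x
  \<comment> \<open>The values of \<open>T\<close> at 3, 4, ... are stored at the singleton lists
    \<open>[i]\<close>, so that \<open>f\<close> maps the vector space to itself as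
    \<open>rank_nullity\<close> requires.\<close>
  let ?E = "(\<lambda>i. [i]) ` {..<h div 3}"
  define f where "f v = (\<lambda>l. if l \<in> ?E then T v (of_nat (hd l) + 3) else 0)" for v
  have vec_eval_add: "vec_eval ?q 2 (v + w) x = vec_eval ?q 2 v x + vec_eval ?q 2 w x" for v w x
    by (simp add: vec_eval_def distrib_right sum.distrib)
  have vec_eval_scale: "vec_eval ?q 2 (qscale c v) x = c * vec_eval ?q 2 v x" for c v x
    by (simp add: vec_eval_def qscale_def sum_distrib_left mult.assoc)
  have f_add: "f (v + w) = f v + f w" for v w
    by (rule ext) (simp only: f_def T_def G_def vec_eval_add plus_fun_apply, simp)
  have f_scale: "f (qscale c v) = qscale c (f v)" for c v
  proof -
    have "T (qscale c v) x = c * T v x" for x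
      unfolding T_def G_def vec_eval_scale by (simp add: algebra_simps)
    moreover have "qscale c u l = c * u l" for u l by (simp add: qscale_def)
    ultimately have "f (qscale c v) l = qscale c (f v) l" for l
      by (cases "l \<in> ?E") (simp_all only: f_def if_True if_False mult_zero_right)
    then show ?thesis by (rule ext)
  qed
  have finB: "finite ?B" by (simp add: I_def)
  have indB: "vs.independent ?B" by (rule fam_indep_imp_independent(2)[OF fam])
  obtain B0 R where B0: "finite B0" "vs.independent B0" "B0 \<subseteq> {v \<in> vs.span ?B. f v = 0}"
    and "{v \<in> vs.span ?B. f v = 0} \<subseteq> vs.span B0"
    and R: "fam_indep R f" and "R \<subseteq> vs.span ?B" and cd: "card ?B \<le> card B0 + card R"
    by (rule rank_nullity[OF f_add f_scale finB indB])
  have "f ` R \<subseteq> vs.span (unitv ` ?E)" by (auto simp: in_span_unitv_iff f_def)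
  then have "card R \<le> card (unitv ` ?E)" by (intro card_le_if_fam_indep[OF R]) auto
  also have "\<dots> \<le> h div 3"
    by (rule order_trans[OF card_image_le order_trans[OF card_image_le]]) auto
  finally have "card R \<le> h div 3" .
  moreover have "card ?B = (h - 1) div 2"
    using card_image[OF fam_indep_imp_independent(1)[OF fam]] by (simp add: I_def)
  moreover have "supported ?q 2 w \<and> period_rel (vec_eval ?q 2 w)" if "w \<in> B0" for w
  proof
    have w: "w \<in> antisym2 ?q" "f w = 0" using that B0(3) span by auto
    then show "supported ?q 2 w" by (simp add: antisym2_def)
    have "T w (of_nat i + 3) = 0" if "i < h div 3" for i
      using fun_cong[OF w(2), of "[i]"] that by (simp add: f_def)
    then show "period_rel (vec_eval ?q 2 w)"
      by (intro antisym2_period_rel[OF w(1) G_def T_def])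
  qed
  ultimately show ?thesis using cd B0 by (intro that[of B0]) auto
qed

section \<open>Generating series\<close>

lemma fps_mult_inverse_eqI:
  fixes f d g :: "rat fps"
  assumes "f * d = g" "fps_nth d 0 \<noteq> 0"
  shows "g * inverse d = f"
proof -
  have "g * inverse d = f * (d * inverse d)" unfolding assms(1)[symmetric] by (rule mult.assoc)
  also have "d * inverse d = 1" by (rule inverse_mult_eq_1'[OF assms(2)])
  finally show ?thesis by simp
qed

lemma fpsO_nth: "fps_nth fpsO n = (if odd n \<and> 3 \<le> n then 1 else 0)"
proof -
  define f :: "rat fps" where "f = Abs_fps (\<lambda>n. if odd n \<and> 3 \<le> n then 1 else 0)"
  have "f * (1 - fps_X ^ 2) = fps_X ^ 3"
  proof (rule fps_ext)
    fix n
    have "fps_nth (f * (1 - fps_X ^ 2)) n = fps_nth f n - fps_nth (f * fps_X ^ 2) n"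
      by (simp add: algebra_simps)
    also have "\<dots> = fps_nth (fps_X ^ 3) n"
      by (auto simp: fps_X_power_mult_right_nth f_def fps_X_power_nth) presburger
    finally show "fps_nth (f * (1 - fps_X ^ 2)) n = fps_nth (fps_X ^ 3) n" .
  qed
  then have eq: "fpsO = f" unfolding fpsO_def by (rule fps_mult_inverse_eqI) (simp add: fps_X_power_nth)
  show ?thesis unfolding eq f_def by simp
qed

lemma fpsO_square_nth: "fps_nth (fpsO ^ 2) p = of_nat (card (Sset p 2))"
proof -
  let ?K = "{i \<in> {0..p}. (odd i \<and> 3 \<le> i) \<and> odd (p - i) \<and> 3 \<le> p - i}"
  have "fps_nth (fpsO ^ 2) p = (\<Sum>i=0..p. if (odd i \<and> 3 \<le> i) \<and> odd (p - i) \<and> 3 \<le> p - i then 1 else 0)"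
    unfolding power2_eq_square fps_mult_nth fpsO_nth by (intro sum.cong) auto
  also have "\<dots> = of_nat (card ?K)"
  proof -
    have "(\<Sum>i=0..p. if Q i then 1 else 0) = (of_nat (card {i \<in> {0..p}. Q i}) :: rat)" for Q
      by (simp add: sum.inter_filter[symmetric])
    then show ?thesis .
  qed
  also have "card ?K = card (Sset p 2)"
  proof (rule bij_betw_same_card[of "\<lambda>i. [i, p - i]"])
    have "Sset p 2 \<subseteq> (\<lambda>i. [i, p - i]) ` ?K"
    proof
      fix n assume n: "n \<in> Sset p 2"
      then obtain a b where ab: "n = [a, b]" by (auto simp: Sset_def length_Suc_conv numeral_2_eq_2)
      then have "a + b = p" "3 \<le> a" "odd a" "3 \<le> b" "odd b" using n by (auto simp: Sset_iff)
      then show "n \<in> (\<lambda>i. [i, p - i]) ` ?K" using ab by (auto simp: image_iff)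
    qed
    moreover have "(\<lambda>i. [i, p - i]) ` ?K \<subseteq> Sset p 2" by (auto simp: Sset_iff)
    ultimately show "bij_betw (\<lambda>i. [i, p - i]) ?K (Sset p 2)"
      unfolding bij_betw_def by (auto simp: inj_on_def)
  qed
  finally show ?thesis .
qed

text \<open>With \<open>q = 2 * h + 2\<close> this is \<open>(h - 1) div 2 - h div 3\<close>; the truncated subtractions are harmless.\<close>

definition sdim :: "nat \<Rightarrow> nat" where
  "sdim q = (if even q then (q div 2 - 2) div 2 - (q div 2 - 1) div 3 else 0)"

text \<open>Comparison of coefficients for the denominator \<open>1 - x^4 - x^6 + x^10\<close>, with
  the terms distributed over both sides to avoid subtraction of naturals.\<close>

lemma sdim_recurrence:
  "sdim q + (if q < 10 then 0 else sdim (q - 10)) =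
   (if q < 4 then 0 else sdim (q - 4)) + (if q < 6 then 0 else sdim (q - 6)) + (if q = 12 then 1 else 0)"
proof (cases "even q")
  case False
  then show ?thesis by (auto simp: sdim_def)
next
  case True
  then obtain m where q: "q = 2 * m" by blast
  have s: "sdim (2 * k) = (k - 2) div 2 - (k - 1) div 3" for k by (simp add: sdim_def)
  have d: "2 * m - 10 = 2 * (m - 5)" "2 * m - 4 = 2 * (m - 2)" "2 * m - 6 = 2 * (m - 3)" by auto
  \<comment> \<open>Small values, where the conditions on \<open>q\<close> vary and predecessors may
    truncate, are computed one by one.\<close>
  consider "m < 8" | n where "m = n + 8" by (metis add.commute le_Suc_ex linorder_not_less)
  then show ?thesis
  proof cases
    case 1
    then have "m \<in> {0, 1, 2, 3, 4, 5, 6, 7}" by auto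
    then show ?thesis unfolding q d s by auto
  next
    case 2
    have key: "(n + 6) div 2 - (n + 7) div 3 + ((n + 1) div 2 - (n + 2) div 3) =
      ((n + 4) div 2 - (n + 5) div 3) + ((n + 3) div 2 - (n + 4) div 3)"
    proof -
      \<comment> \<open>Raising \<open>n\<close> by 6 adds 3 to each half and 2 to each third, so
        six residues remain to be checked.\<close>
      define k r where "k = n div 6" and "r = n mod 6"
      have "r < 6" by (simp add: r_def)
      then have r: "r \<in> {0, 1, 2, 3, 4, 5}" by auto
      have n: "n + c = (r + c) + 6 * k" for c by (simp add: k_def r_def)
      have d: "((r + c) + 6 * k) div 2 = (r + c) div 2 + 3 * k" "((r + c) + 6 * k) div 3 = (r + c) div 3 + 2 * k" for c
        by presburger+
      show ?thesis unfolding n d using r by auto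
    qed
    have e: "m - 2 = n + 6" "m - 1 = n + 7" "m - 5 - 2 = n + 1" "m - 5 - 1 = n + 2" "n + 6 - 2 = n + 4"
      "n + 6 - 1 = n + 5" "m - 3 - 2 = n + 3" "m - 3 - 1 = n + 4"
      and c: "(2 * m < 10) = False" "(2 * m < 4) = False" "(2 * m < 6) = False" "(2 * m = 12) = False"
      using 2 by auto
    show ?thesis unfolding q d s c if_False e(3-8) e(1,2) by (simp only: key add_0_right)
  qed
qed

lemma fpsS_nth: "fps_nth fpsS q = of_nat (sdim q)"
proof -
  define f :: "rat fps" where "f = Abs_fps (\<lambda>n. of_nat (sdim n))"
  have "f * ((1 - fps_X ^ 4) * (1 - fps_X ^ 6)) = fps_X ^ 12"
  proof (rule fps_ext)
    fix n
    have "(1 - fps_X ^ 4) * (1 - fps_X ^ 6) = (1 - fps_X ^ 4 - fps_X ^ 6 + fps_X ^ 10 :: rat fps)"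
      by (simp add: algebra_simps flip: power_add)
    then have "fps_nth (f * ((1 - fps_X ^ 4) * (1 - fps_X ^ 6))) n
        = fps_nth f n - fps_nth (f * fps_X ^ 4) n - fps_nth (f * fps_X ^ 6) n + fps_nth (f * fps_X ^ 10) n"
      by (simp add: algebra_simps)
    also have "\<dots> = (of_nat (sdim n + (if n < 10 then 0 else sdim (n - 10)))
        - of_nat ((if n < 4 then 0 else sdim (n - 4)) + (if n < 6 then 0 else sdim (n - 6))) :: rat)"
      unfolding fps_X_power_mult_right_nth f_def by (auto simp: algebra_simps)
    also have "\<dots> = fps_nth (fps_X ^ 12) n"
      unfolding sdim_recurrence by (simp add: fps_X_power_nth)
    finally show "fps_nth (f * ((1 - fps_X ^ 4) * (1 - fps_X ^ 6))) n = fps_nth (fps_X ^ 12) n" .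
  qed
  then have eq: "fpsS = f" unfolding fpsS_def by (rule fps_mult_inverse_eqI) (simp add: fps_X_power_nth)
  show ?thesis unfolding eq f_def by simp
qed

text \<open>Sum \<open>(Of p - s p) * (K (N - p) - s (N - p)) \<ge> 0\<close> over \<open>p\<close>,
  and add \<open>Of p \<le> K p + C p\<close> multiplied by \<open>s (N - p)\<close>; the mixed sums
  of \<open>K\<close> and \<open>s\<close> agree after reversal.\<close>

lemma convolution_bound:
  fixes Of K C s :: "nat \<Rightarrow> nat"
  assumes "\<And>p. s p \<le> K p" "\<And>p. K p \<le> Of p" "\<And>p. Of p \<le> K p + C p"
  shows "3 * (\<Sum>p\<le>N. Of p * s (N - p)) \<le>
    (\<Sum>p\<le>N. Of p * K (N - p)) + (\<Sum>p\<le>N. Of p * s (N - p)) + (\<Sum>p\<le>N. C p * s (N - p)) + (\<Sum>p\<le>N. s p * s (N - p))"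
proof -
  have rev: "(\<Sum>p\<le>N. K p * s (N - p)) = (\<Sum>p\<le>N. s p * K (N - p))"
    by (rule sum.reindex_bij_witness[of _ "\<lambda>p. N - p" "\<lambda>p. N - p"]) auto
  have "(Of p * s (N - p)) + (s p * K (N - p)) \<le> Of p * K (N - p) + s p * s (N - p)" for p
  proof -
    obtain a b where "Of p = s p + a" "K (N - p) = s (N - p) + b"
      using assms(1)[of "N - p"] order_trans[OF assms(1) assms(2), of p] le_Suc_ex by metis
    then show ?thesis by (simp add: algebra_simps)
  qed
  then have 1: "(\<Sum>p\<le>N. Of p * s (N - p)) + (\<Sum>p\<le>N. s p * K (N - p)) \<le> (\<Sum>p\<le>N. Of p * K (N - p)) + (\<Sum>p\<le>N. s p * s (N - p))"
    unfolding sum.distrib[symmetric] by (intro sum_mono)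
  have "(\<Sum>p\<le>N. Of p * s (N - p)) \<le> (\<Sum>p\<le>N. (K p + C p) * s (N - p))"
    by (intro sum_mono mult_right_mono assms) simp
  also have "\<dots> = (\<Sum>p\<le>N. s p * K (N - p)) + (\<Sum>p\<le>N. C p * s (N - p))"
    unfolding rev[symmetric] sum.distrib[symmetric] by (simp add: distrib_right)
  finally show ?thesis using 1 by linarith
qed

section \<open>The left kernel in depth 4\<close>

lemma rowmul_lincomb:
  "rowmul N r (\<lambda>n. \<Sum>j\<in>J. c j * u j n) A = (\<lambda>n. \<Sum>j\<in>J. c j * rowmul N r (u j) A n)"
proof
  fix n
  have "(\<Sum>m\<in>Sset N r. (\<Sum>j\<in>J. c j * u j m) * A m n) = (\<Sum>j\<in>J. c j * (\<Sum>m\<in>Sset N r. u j m * A m n))"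
    unfolding sum_distrib_right sum_distrib_left by (subst sum.swap) (simp add: mult.assoc)
  then show "rowmul N r (\<lambda>n. \<Sum>j\<in>J. c j * u j n) A n = (\<Sum>j\<in>J. c j * rowmul N r (u j) A n)"
    by (simp add: rowmul_def)
qed

lemma rowmul_add: "rowmul N r (\<lambda>n. u n + v n) A = (\<lambda>n. rowmul N r u A n + rowmul N r v A n)"
  by (simp add: rowmul_def fun_eq_iff distrib_right sum.distrib)

lemma rowmul_zero: "rowmul N r (\<lambda>_. 0) A = (\<lambda>_. 0)"
  by (simp add: rowmul_def fun_eq_iff)

lemma rowmul_cong:
  assumes "\<And>m. m \<in> Sset N r \<Longrightarrow> u m = v m"
  shows "rowmul N r u A = rowmul N r v A"
  unfolding rowmul_def by (auto simp: assms intro!: ext sum.cong)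

lemma rowmul_matmul: "rowmul N r v (matmul N r A B) = rowmul N r (rowmul N r v A) B"
proof
  fix n
  have "(\<Sum>m\<in>Sset N r. v m * (\<Sum>k\<in>Sset N r. A m k * B k n)) = (\<Sum>k\<in>Sset N r. (\<Sum>m\<in>Sset N r. v m * A m k) * B k n)"
    unfolding sum_distrib_right sum_distrib_left by (subst sum.swap) (simp add: mult.assoc)
  then show "rowmul N r v (matmul N r A B) n = rowmul N r (rowmul N r v A) B n"
    by (simp add: rowmul_def matmul_def)
qed

lemma rowmul_Cmat4:
  "rowmul N 4 v (Cmat4 N) = rowmul N 4 (rowmul N 4 (rowmul N 4 v (Ejmat 2 N 4)) (Ejmat 3 N 4)) (Ejmat 4 N 4)"
proof -
  have "Emat N 4 = Ejmat 4 N 4" by (simp add: fun_eq_iff Emat_def Ejmat_def)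
  then show ?thesis by (simp add: Cmat4_def rowmul_matmul)
qed

text \<open>The subspaces \<open>A\<^sub>1 \<otimes> W \<otimes> A\<^sub>1\<close> and \<open>W \<otimes> A\<^sub>2\<close>, described by their slices.\<close>

definition midW :: "nat \<Rightarrow> (nat list \<Rightarrow> rat) \<Rightarrow> bool" where
  "midW N v \<longleftrightarrow> supported N 4 v \<and> (\<forall>i l q. i + q + l = N \<longrightarrow> period_rel (vec_eval q 2 (\<lambda>s. v (i # s @ [l]))))"

definition frontW :: "nat \<Rightarrow> (nat list \<Rightarrow> rat) \<Rightarrow> bool" where
  "frontW N v \<longleftrightarrow> supported N 4 v \<and> (\<forall>k q. q + sum_list k = N \<longrightarrow> period_rel (vec_eval q 2 (\<lambda>s. v (s @ k))))"

lemma supported_lincomb: "(\<And>j. j \<in> J \<Longrightarrow> supported N r (u j)) \<Longrightarrow> supported N r (\<lambda>n. \<Sum>j\<in>J. c j * u j n)"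
  unfolding supported_def by (simp add: sum.neutral)

lemma midW_lincomb: "(\<And>j. j \<in> J \<Longrightarrow> midW N (u j)) \<Longrightarrow> midW N (\<lambda>n. \<Sum>j\<in>J. c j * u j n)"
  unfolding midW_def vec_eval_lincomb by (intro conjI supported_lincomb allI impI period_rel_lincomb) blast+

lemma frontW_lincomb: "(\<And>j. j \<in> J \<Longrightarrow> frontW N (u j)) \<Longrightarrow> frontW N (\<lambda>n. \<Sum>j\<in>J. c j * u j n)"
  unfolding frontW_def vec_eval_lincomb by (intro conjI supported_lincomb allI impI period_rel_lincomb) blast+

lemma Sset_ConsE:
  assumes "n \<in> Sset N (Suc r)"
  obtains i m where "n = [i] @ m" "[i] \<in> Sset (sum_list [i]) 1" "i \<le> N" "m \<in> Sset (N - i) r"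
proof -
  obtain i m where n: "n = i # m" using assms by (cases n) (auto simp: Sset_def)
  have "[i] @ m \<in> Sset N (Suc r)" using assms n by simp
  then have "[i] \<in> Sset (sum_list [i]) 1 \<and> m \<in> Sset (N - sum_list [i]) (Suc r - 1) \<and> sum_list [i] \<le> N"
    by (subst (asm) Sset_append_iff[of "[i]" 1]) simp_all
  then show ?thesis using n by (intro that[of i m]) auto
qed

lemma midW_slice:
  assumes "midW N v" "i \<le> N"
  shows "period_rel (vec_eval (N - i) 3 (\<lambda>m. v ([i] @ m)))"
proof (rule period_rel_if_tails)
  fix M k assume M: "M \<le> N - i" and k: "k \<in> Sset M (3 - 2)"
  obtain l where l: "k = [l]" "l = M" using k by (auto simp: Sset_def length_Suc_conv)
  have "i + (N - i - M) + l = N" using M assms(2) l by simp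
  then show "period_rel (vec_eval (N - i - M) 2 (\<lambda>s. v ([i] @ s @ k)))"
    using assms(1) l(1) unfolding midW_def by simp
qed simp

lemma rowmul_slice:
  assumes i: "[i] \<in> Sset (sum_list [i]) 1" "i \<le> N" and m: "m \<in> Sset (N - i) 3" and j: "j \<le> 3"
  shows "rowmul N 4 v (Ejmat j N 4) ([i] @ m) = rowmul (N - i) 3 (\<lambda>m. v ([i] @ m)) (Ejmat j (N - i) 3) m"
  using rowmul_Ejmat_append[OF i(1), of N j 4 m v] i(2) m j by simp

text \<open>\<open>Ejmat 2\<close> and \<open>Ejmat 3\<close> are block diagonal along the first of
  four places. Fixing it reduces the claim to depth 3, where the slices satisfy the period
  relation.\<close>

lemma midW_left_kernel:
  assumes v: "midW N v"
  shows "rowmul N 4 (rowmul N 4 v (Ejmat 2 N 4)) (Ejmat 3 N 4) = (\<lambda>_. 0)"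
proof
  fix n
  let ?v2 = "rowmul N 4 v (Ejmat 2 N 4)"
  show "rowmul N 4 ?v2 (Ejmat 3 N 4) n = 0"
  proof (cases "n \<in> Sset N 4")
    case False
    then show ?thesis by (simp add: rowmul_def)
  next
    case True
    then have "n \<in> Sset N (Suc 3)" by simp
    then obtain i m where n: "n = [i] @ m" and i: "[i] \<in> Sset (sum_list [i]) 1" "i \<le> N" and m: "m \<in> Sset (N - i) 3"
      by (rule Sset_ConsE)
    have "rowmul N 4 ?v2 (Ejmat 3 N 4) n = rowmul (N - i) 3 (\<lambda>m. ?v2 ([i] @ m)) (Ejmat 3 (N - i) 3) m"
      unfolding n using rowmul_slice[OF i m] by simp
    also have "rowmul (N - i) 3 (\<lambda>m. ?v2 ([i] @ m)) (Ejmat 3 (N - i) 3)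
        = rowmul (N - i) 3 (rowmul (N - i) 3 (\<lambda>m. v ([i] @ m)) (Ejmat 2 (N - i) 3)) (Ejmat 3 (N - i) 3)"
      by (rule rowmul_cong) (rule rowmul_slice[OF i], auto)
    also have "\<dots> = (\<lambda>_. 0)"
      using period_rel_imp_left_kernel[OF midW_slice[OF v i(2)]] by simp
    finally show ?thesis .
  qed
qed

text \<open>Slice by slice along the first place, this is (H) in depth 3.\<close>

lemma midW_injective:
  assumes "hypH" and v: "midW N v" and z: "rowmul N 4 v (Ejmat 2 N 4) = (\<lambda>_. 0)"
  shows "v = (\<lambda>_. 0)"
proof
  fix n
  have sup: "supported N 4 v" using v by (simp add: midW_def)
  show "v n = 0"
  proof (cases "n \<in> Sset N 4")
    case False
    then show ?thesis using sup by (simp add: supported_def)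
  next
    case True
    then have "n \<in> Sset N (Suc 3)" by simp
    then obtain i m where n: "n = [i] @ m" and i: "[i] \<in> Sset (sum_list [i]) 1" "i \<le> N" and m: "m \<in> Sset (N - i) 3"
      by (rule Sset_ConsE)
    let ?w = "\<lambda>m. v ([i] @ m)"
    have "rowmul (N - i) 3 ?w (Ejmat (3 - 1) (N - i) 3) = (\<lambda>_. 0)"
    proof
      fix k
      show "rowmul (N - i) 3 ?w (Ejmat (3 - 1) (N - i) 3) k = 0"
      proof (cases "k \<in> Sset (N - i) 3")
        case True
        then show ?thesis using rowmul_slice[OF i True, of 2 v] z by simp
      qed (simp add: rowmul_def)
    qed
    moreover have "supported (N - i) 3 ?w"
      unfolding supported_def
    proof (intro allI impI)
      fix k assume "k \<notin> Sset (N - i) 3"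
      then have "[i] @ k \<notin> Sset N 4" using Sset_append_iff[of "[i]" 1 4 k N] by simp
      then show "?w k = 0" using sup unfolding supported_def by blast
    qed
    ultimately have "?w = (\<lambda>_. 0)"
      by (intro hypH_injective[OF assms(1) _ _ midW_slice[OF v i(2)]]) simp_all
    then show ?thesis unfolding n by (rule fun_cong)
  qed
qed

lemma rowmul_front:
  assumes s: "s \<in> Sset q 2" and m: "m \<in> Sset M 2" and "q + M = N"
  shows "rowmul N 4 v (Ejmat 2 N 4) (s @ m) = rowmul M 2 (\<lambda>m. v (s @ m)) (Ejmat 2 M 2) m"
proof -
  have "sum_list s = q" using s by (simp add: Sset_def)
  moreover have "N - q = M" using assms(3) by simp
  ultimately show ?thesis
    using rowmul_Ejmat_append[of s 2 N 2 4 m v] s m assms(3) by simp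
qed

lemma frontW_period_rel:
  assumes "frontW N v"
  shows "period_rel (vec_eval N 4 v)"
proof (rule period_rel_if_tails)
  fix M k assume M: "M \<le> N" and k: "k \<in> Sset M (4 - 2)"
  then have "N - M + sum_list k = N" by (simp add: Sset_def)
  then show "period_rel (vec_eval (N - M) 2 (\<lambda>s. v (s @ k)))" using assms unfolding frontW_def by blast
qed simp

lemma vec_eval_vec_cong: "(\<And>n. n \<in> Sset N r \<Longrightarrow> u n = v n) \<Longrightarrow> vec_eval N r u = vec_eval N r v"
  by (simp add: vec_eval_def fun_eq_iff)

lemma period_rel_zero: "period_rel (vec_eval q 2 (\<lambda>_. 0))"
  by (simp add: period_rel_def vec_eval_def)

text \<open>\<open>Ejmat 2\<close> mixes only the tails, so each slice of the result is a linear
  combination of slices that satisfy the relation.\<close>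

lemma frontW_rowmul:
  assumes v: "frontW N v"
  shows "frontW N (rowmul N 4 v (Ejmat 2 N 4))"
  unfolding frontW_def
proof (intro conjI allI impI supported_rowmul)
  fix k :: "nat list" and q assume qk: "q + sum_list k = N"
  let ?M = "sum_list k"
  show "period_rel (vec_eval q 2 (\<lambda>s. rowmul N 4 v (Ejmat 2 N 4) (s @ k)))"
  proof (cases "k \<in> Sset ?M 2")
    case True
    have "rowmul N 4 v (Ejmat 2 N 4) (s @ k) = (\<Sum>m\<in>Sset ?M 2. Ejmat 2 ?M 2 m k * v (s @ m))" if "s \<in> Sset q 2" for s
      using rowmul_front[OF that True qk] True by (simp add: rowmul_def mult.commute)
    then have "vec_eval q 2 (\<lambda>s. rowmul N 4 v (Ejmat 2 N 4) (s @ k)) = vec_eval q 2 (\<lambda>s. \<Sum>m\<in>Sset ?M 2. Ejmat 2 ?M 2 m k * v (s @ m))"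
      by (rule vec_eval_vec_cong)
    moreover have "period_rel \<dots>"
      unfolding vec_eval_lincomb
    proof (rule period_rel_lincomb)
      fix m assume "m \<in> Sset ?M 2"
      then have "q + sum_list m = N" using qk by (simp add: Sset_def)
      then show "period_rel (vec_eval q 2 (\<lambda>s. v (s @ m)))" using v unfolding frontW_def by blast
    qed
    ultimately show ?thesis by simp
  next
    case False
    have "rowmul N 4 v (Ejmat 2 N 4) (s @ k) = 0" if "s \<in> Sset q 2" for s
    proof -
      have l: "length s = 2" "sum_list s = q" using that by (simp_all add: Sset_def)
      have "s @ k \<notin> Sset N 4"
        using Sset_append_iff[OF l(1), of 4 k N] False qk l(2) by auto
      then show ?thesis by (simp add: rowmul_def)
    qed
    then have "vec_eval q 2 (\<lambda>s. rowmul N 4 v (Ejmat 2 N 4) (s @ k)) = vec_eval q 2 (\<lambda>_. 0)"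
      by (rule vec_eval_vec_cong)
    then show ?thesis using period_rel_zero by simp
  qed
qed

lemma frontW_left_kernel:
  assumes "frontW N v"
  shows "rowmul N 4 (rowmul N 4 v (Ejmat 3 N 4)) (Ejmat 4 N 4) = (\<lambda>_. 0)"
  using period_rel_imp_left_kernel[OF frontW_period_rel[OF assms]] by simp

text \<open>This is (H) in depth 4.\<close>

lemma frontW_injective:
  assumes "hypH" "frontW N v" "rowmul N 4 v (Ejmat 3 N 4) = (\<lambda>_. 0)"
  shows "v = (\<lambda>_. 0)"
  using hypH_injective[OF assms(1) _ _ frontW_period_rel[OF assms(2)]] assms(2,3) unfolding frontW_def by simp

text \<open>An independent set of period polynomials of prescribed size; it is not claimed to span
  them all.\<close>

definition period_basis :: "nat \<Rightarrow> (nat list \<Rightarrow> rat) set \<Rightarrow> bool" where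
  "period_basis q W \<longleftrightarrow>
    finite W \<and> vs.independent W \<and> card W = sdim q \<and> (\<forall>w\<in>W. supported q 2 w \<and> period_rel (vec_eval q 2 w))"

lemma period_basis_exists: "\<exists>W. period_basis q W"
proof (cases "even q \<and> 2 \<le> q")
  case True
  define h where "h = q div 2 - 1"
  have q: "q = 2 * h + 2" using True by (auto simp: h_def)
  obtain B where B: "finite B" "vs.independent B" "(h - 1) div 2 \<le> card B + h div 3"
    "\<And>w. w \<in> B \<Longrightarrow> supported (2 * h + 2) 2 w \<and> period_rel (vec_eval (2 * h + 2) 2 w)"
    using period_vectors_exist by blast
  have "sdim q = (h - 1) div 2 - h div 3" using q by (simp add: sdim_def)
  then have "sdim q \<le> card B" using B(3) by linarith
  then obtain W where W: "W \<subseteq> B" "card W = sdim q" by (rule obtain_subset_with_card_n)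
  show ?thesis
    unfolding period_basis_def
  proof (intro exI conjI ballI)
    show "finite W" using W(1) B(1) by (rule finite_subset)
    show "vs.independent W" using B(2) W(1) by (rule vs.independent_mono)
    show "card W = sdim q" by fact
  qed (use W(1) B(4) q in auto)
next
  case False
  then have "sdim q = 0" by (auto simp: sdim_def)
  then show ?thesis by (intro exI[of _ "{}"]) (simp add: period_basis_def vs.independent_empty)
qed

text \<open>\<open>K\<close> is a basis of the left kernel in depth 2, and \<open>C\<close> spans a
  complement of it, encoded by the independence of the images.\<close>

definition kernel_basis :: "nat \<Rightarrow> (nat list \<Rightarrow> rat) set \<Rightarrow> (nat list \<Rightarrow> rat) set \<Rightarrow> bool" where
  "kernel_basis p K C \<longleftrightarrow> finite K \<and> vs.independent K \<and> (\<forall>v\<in>K. supported p 2 v \<and> rowmul p 2 v (Ejmat 2 p 2) = (\<lambda>_. 0))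
    \<and> {v. supported p 2 v \<and> rowmul p 2 v (Ejmat 2 p 2) = (\<lambda>_. 0)} \<subseteq> vs.span K
    \<and> fam_indep C (\<lambda>c. rowmul p 2 c (Ejmat 2 p 2)) \<and> (\<forall>c\<in>C. supported p 2 c)
    \<and> card (Sset p 2) \<le> card K + card C \<and> card K \<le> card (Sset p 2)"

lemma kernel_basis_exists: "\<exists>K C. kernel_basis p K C"
proof -
  let ?S = "Sset p 2" and ?f = "\<lambda>v. rowmul p 2 v (Ejmat 2 p 2)"
  define B where "B = unitv ` ?S"
  have span: "v \<in> vs.span B \<longleftrightarrow> supported p 2 v" for v
    unfolding B_def supported_def by (rule in_span_unitv_iff) simp
  have add: "?f (x + y) = ?f x + ?f y" for x y
    by (auto simp: rowmul_def fun_eq_iff distrib_right sum.distrib)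
  have scale: "?f (qscale c x) = qscale c (?f x)" for c x
    by (auto simp: rowmul_def qscale_def fun_eq_iff sum_distrib_left mult.assoc)
  have finB: "finite B" by (simp add: B_def)
  have indB: "vs.independent B"
    unfolding B_def by (rule fam_indep_imp_independent(2)[OF fam_indep_unitv]) simp
  obtain K C where KC: "finite K" "vs.independent K" "K \<subseteq> {v \<in> vs.span B. ?f v = 0}"
    "{v \<in> vs.span B. ?f v = 0} \<subseteq> vs.span K" "fam_indep C ?f" "C \<subseteq> vs.span B" "card B \<le> card K + card C"
    by (rule rank_nullity[OF add scale finB indB])
  have z: "(?f v = 0) = (?f v = (\<lambda>_. 0))" for v by (simp add: fun_eq_iff)
  have cB: "card B = card ?S" by (simp add: B_def card_unitv)
  have "\<forall>v\<in>K. supported p 2 v \<and> ?f v = (\<lambda>_. 0)" using KC(3) unfolding span z by blast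
  moreover have "{v. supported p 2 v \<and> ?f v = (\<lambda>_. 0)} \<subseteq> vs.span K" using KC(4) unfolding span z .
  moreover have "\<forall>c\<in>C. supported p 2 c" using KC(6) span by blast
  moreover have "card K \<le> card ?S"
    using vs.independent_span_bound[OF finB KC(2)] KC(3) cB by auto
  ultimately have "kernel_basis p K C"
    unfolding kernel_basis_def using KC(1,2,5) KC(7)[unfolded cB] by (intro conjI) assumption+
  then show ?thesis by blast
qed

section \<open>Tensors generating the three summands of the left kernel\<close>

lemma sum_fiber:
  assumes "finite J" "e ` W \<subseteq> J" "inj_on e W" "\<And>j. j \<in> J \<Longrightarrow> j \<notin> e ` W \<Longrightarrow> F j = 0"
  shows "(\<Sum>j\<in>J. F j) = (\<Sum>w\<in>W. F (e w))"
proof -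
  have "(\<Sum>j\<in>J. F j) = (\<Sum>j\<in>e ` W. F j)"
    using assms by (intro sum.mono_neutral_right) auto
  then show ?thesis by (simp add: sum.reindex[OF assms(3)])
qed

lemma period_rel_scale:
  assumes "period_rel (vec_eval q 2 w)"
  shows "period_rel (vec_eval q 2 (\<lambda>s. c * w s))"
  using period_rel_lincomb[of "{()}" "\<lambda>_. vec_eval q 2 w" "\<lambda>_. c"] vec_eval_lincomb[of q 2 "\<lambda>_. c" "\<lambda>_. w" "{()}"] assms by simp

lemma Sset_appendI: "s \<in> Sset p a \<Longrightarrow> k \<in> Sset M b \<Longrightarrow> s @ k \<in> Sset (p + M) (a + b)"
  unfolding Sset_iff by auto

lemma Sset4_splitE:
  assumes "n \<in> Sset N 4"
  obtains s k p M where "n = s @ k" "s \<in> Sset p 2" "k \<in> Sset M 2" "p + M = N"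
proof -
  note sp = Sset_split[OF assms, of 2, simplified]
  show ?thesis by (rule that[OF _ sp(1,2,3)]) simp
qed

text \<open>In \<open>tailv s w\<close> the vector \<open>w\<close> follows the unit vector at
  \<open>s\<close>; in \<open>midv s w\<close> it stands between the two entries of
  \<open>s\<close>; \<open>frontv c w\<close> is the tensor \<open>w \<otimes> c\<close>.\<close>

definition tailv :: "nat list \<Rightarrow> (nat list \<Rightarrow> rat) \<Rightarrow> nat list \<Rightarrow> rat" where
  "tailv s w n = (if take 2 n = s then w (drop 2 n) else 0)"

definition midv :: "nat list \<Rightarrow> (nat list \<Rightarrow> rat) \<Rightarrow> nat list \<Rightarrow> rat" where
  "midv s w n = (if length n = 4 \<and> [n ! 0, n ! 3] = s then w [n ! 1, n ! 2] else 0)"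

definition frontv :: "(nat list \<Rightarrow> rat) \<Rightarrow> (nat list \<Rightarrow> rat) \<Rightarrow> nat list \<Rightarrow> rat" where
  "frontv c w n = w (take 2 n) * c (drop 2 n)"

lemma supported_tailv:
  assumes "s \<in> Sset p 2" "supported M 2 w" "p + M = N"
  shows "supported N 4 (tailv s w)"
  unfolding supported_def
proof (intro allI impI)
  fix n assume n: "n \<notin> Sset N 4"
  show "tailv s w n = 0"
  proof (rule ccontr)
    assume "tailv s w n \<noteq> 0"
    then have "take 2 n = s" "drop 2 n \<in> Sset M 2" using assms(2) by (auto simp: tailv_def supported_def split: if_splits)
    then have "take 2 n @ drop 2 n \<in> Sset (p + M) (2 + 2)" using assms(1) by (intro Sset_appendI) simp_all
    then show False using n assms(3) by simp
  qed
qed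

text \<open>Along front pairs the block at \<open>s\<close> sees \<open>w\<close>, which the depth 2
  matrix kills, and every other block sees zero.\<close>

lemma tailv_left_kernel:
  assumes s: "s \<in> Sset p 2" and w: "rowmul M 2 w (Ejmat 2 M 2) = (\<lambda>_. 0)" and "p + M = N"
  shows "rowmul N 4 (tailv s w) (Ejmat 2 N 4) = (\<lambda>_. 0)"
proof
  fix n
  show "rowmul N 4 (tailv s w) (Ejmat 2 N 4) n = 0"
  proof (cases "n \<in> Sset N 4")
    case True
    then obtain s' k p' M' where n: "n = s' @ k" "s' \<in> Sset p' 2" "k \<in> Sset M' 2" "p' + M' = N"
      by (rule Sset4_splitE)
    have l: "length s' = 2" using n(2) by (simp add: Sset_def)
    have eq: "rowmul N 4 (tailv s w) (Ejmat 2 N 4) n = rowmul M' 2 (\<lambda>m. tailv s w (s' @ m)) (Ejmat 2 M' 2) k"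
      unfolding n(1) by (rule rowmul_front[OF n(2-4)])
    show ?thesis
    proof (cases "s' = s")
      case True
      then have "p' = p" using n(2) s by (simp add: Sset_def)
      then have "M' = M" using n(4) assms(3) by simp
      then show ?thesis unfolding eq using l True w by (simp add: tailv_def)
    next
      case False
      then show ?thesis unfolding eq using l by (simp add: tailv_def rowmul_zero)
    qed
  qed (simp add: rowmul_def)
qed

lemma length4E:
  assumes "length n = 4"
  obtains a b c d where "n = [a, b, c, d]"
  using assms by (auto simp: length_Suc_conv eval_nat_numeral)

lemma midW_midv:
  assumes s: "s \<in> Sset p 2" and w: "supported M 2 w" "period_rel (vec_eval M 2 w)" and N: "p + M = N"
  shows "midW N (midv s w)"
  unfolding midW_def
proof (intro conjI allI impI)
  show "supported N 4 (midv s w)"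
    unfolding supported_def
  proof (intro allI impI)
    fix n assume n: "n \<notin> Sset N 4"
    show "midv s w n = 0"
    proof (rule ccontr)
      assume "midv s w n \<noteq> 0"
      then have h: "length n = 4" "[n ! 0, n ! 3] = s" "[n ! 1, n ! 2] \<in> Sset M 2"
        using w(1) by (auto simp: midv_def supported_def split: if_splits)
      obtain a b c d where abcd: "n = [a, b, c, d]" using h(1) by (rule length4E)
      have "[a, d] \<in> Sset p 2" "[b, c] \<in> Sset M 2" using h(2,3) s abcd by auto
      then have "n \<in> Sset N 4" using N abcd by (auto simp: Sset_iff)
      then show False using n by simp
    qed
  qed
  fix i l q assume q: "i + q + l = N"
  have e: "midv s w (i # t @ [l]) = (if [i, l] = s then w t else 0)" if t: "t \<in> Sset q 2" for t
  proof -
    obtain b c where "t = [b, c]" using Sset2_eq_pair[OF t] by blast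
    then show ?thesis by (simp add: midv_def)
  qed
  show "period_rel (vec_eval q 2 (\<lambda>t. midv s w (i # t @ [l])))"
  proof (cases "[i, l] = s")
    case True
    then have "i + l = p" using s by (auto simp: Sset_def)
    then have "q = M" using q N by simp
    moreover have "vec_eval q 2 (\<lambda>t. midv s w (i # t @ [l])) = vec_eval q 2 w"
      using e True by (intro vec_eval_vec_cong) simp
    ultimately show ?thesis using w(2) by simp
  next
    case False
    have "vec_eval q 2 (\<lambda>t. midv s w (i # t @ [l])) = vec_eval q 2 (\<lambda>_. 0)"
      using e False by (intro vec_eval_vec_cong) simp
    then show ?thesis using period_rel_zero by simp
  qed
qed

lemma frontW_frontv:
  assumes c: "supported p 2 c" and w: "supported M 2 w" "period_rel (vec_eval M 2 w)" and N: "p + M = N"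
  shows "frontW N (frontv c w)"
  unfolding frontW_def
proof (intro conjI allI impI)
  show "supported N 4 (frontv c w)"
    unfolding supported_def
  proof (intro allI impI)
    fix n assume n: "n \<notin> Sset N 4"
    show "frontv c w n = 0"
    proof (rule ccontr)
      assume "frontv c w n \<noteq> 0"
      then have "take 2 n \<in> Sset M 2" "drop 2 n \<in> Sset p 2" using c w(1) by (auto simp: frontv_def supported_def)
      then have "take 2 n @ drop 2 n \<in> Sset (M + p) (2 + 2)" by (rule Sset_appendI)
      then show False using n N by (simp add: add.commute)
    qed
  qed
  fix k :: "nat list" and q assume q: "q + sum_list k = N"
  have e: "vec_eval q 2 (\<lambda>s. frontv c w (s @ k)) = vec_eval q 2 (\<lambda>s. c k * w s)"
    by (rule vec_eval_vec_cong) (auto simp: frontv_def Sset_def)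
  show "period_rel (vec_eval q 2 (\<lambda>s. frontv c w (s @ k)))"
  proof (cases "c k = 0")
    case True
    then show ?thesis unfolding e using period_rel_zero by simp
  next
    case False
    then have "k \<in> Sset p 2" using c by (auto simp: supported_def)
    then have "q = M" using q N by (simp add: Sset_def)
    then show ?thesis unfolding e using w(2) by (intro period_rel_scale) simp
  qed
qed

text \<open>The three sums count the generators of \<open>A_2 \<otimes> L\<close>,
  \<open>A_1 \<otimes> W \<otimes> A_1\<close> and \<open>W \<otimes> M\<close>; the main work is
  the independence of the joined family.\<close>

lemma left_kernel_bound:
  assumes H: "hypH"
    and W: "\<And>q. period_basis q (W q)" and KC: "\<And>p. kernel_basis p (K p) (C p)"
  shows "(\<Sum>p\<le>N. card (Sset p 2) * card (K (N - p))) + (\<Sum>p\<le>N. card (Sset p 2) * card (W (N - p)))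
    + (\<Sum>p\<le>N. card (C p) * card (W (N - p))) \<le> qdim (rker N 4 (Cmat4 N))"
proof -
  have Wfin: "finite (W q)" and Wfam: "fam_indep (W q) (\<lambda>w. w)" for q
    using W[of q] by (auto simp: period_basis_def intro: independent_imp_fam_indep)
  have Wsupp: "supported q 2 w" and Wprel: "period_rel (vec_eval q 2 w)" if "w \<in> W q" for q w
    using W[of q] that by (auto simp: period_basis_def)
  have Kfin: "finite (K p)" and Kfam: "fam_indep (K p) (\<lambda>w. w)" for p
    using KC[of p] by (auto simp: kernel_basis_def intro: independent_imp_fam_indep)
  have Ksupp: "supported p 2 v" and Kker: "rowmul p 2 v (Ejmat 2 p 2) = (\<lambda>_. 0)" if "v \<in> K p" for p v
    using KC[of p] that by (auto simp: kernel_basis_def)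
  have Cfam: "fam_indep (C p) (\<lambda>c. rowmul p 2 c (Ejmat 2 p 2))" for p
    using KC[of p] by (simp add: kernel_basis_def)
  have Cfin: "finite (C p)" for p using Cfam[of p] by (simp add: fam_indep_def)
  have Csupp: "supported p 2 c" if "c \<in> C p" for p c using KC[of p] that by (simp add: kernel_basis_def)
  \<comment> \<open>\<open>p\<close> is the weight of the factor not taken from \<open>K\<close> or
    \<open>W\<close>: the front pair, the outer pair, and the tail respectively.\<close>
  define J1 where "J1 = (SIGMA p:{..N}. Sset p 2 \<times> K (N - p))"
  define J2 where "J2 = (SIGMA p:{..N}. Sset p 2 \<times> W (N - p))"
  define J3 where "J3 = (SIGMA p:{..N}. C p \<times> W (N - p))"
  define u1 where "u1 = (\<lambda>(p::nat, s, w). tailv s w)"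
  define u2 where "u2 = (\<lambda>(p::nat, s, w). midv s w)"
  define u3 where "u3 = (\<lambda>(p::nat, c, w). frontv c w)"
  have fin: "finite J1" "finite J2" "finite J3"
    unfolding J1_def J2_def J3_def using Wfin Kfin Cfin by auto
  have u1: "supported N 4 (u1 j)" "rowmul N 4 (u1 j) (Ejmat 2 N 4) = (\<lambda>_. 0)" if jJ: "j \<in> J1" for j
  proof -
    obtain p s w where j: "j = (p, s, w)" "p \<le> N" "s \<in> Sset p 2" "w \<in> K (N - p)" using jJ by (auto simp: J1_def)
    have "p + (N - p) = N" using j(2) by simp
    then show "supported N 4 (u1 j)" "rowmul N 4 (u1 j) (Ejmat 2 N 4) = (\<lambda>_. 0)"
      using supported_tailv[OF j(3) Ksupp[OF j(4)]] tailv_left_kernel[OF j(3) Kker[OF j(4)]]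
      by (simp_all add: u1_def j(1))
  qed
  have u2: "midW N (u2 j)" if jJ: "j \<in> J2" for j
  proof -
    obtain p s w where j: "j = (p, s, w)" "p \<le> N" "s \<in> Sset p 2" "w \<in> W (N - p)" using jJ by (auto simp: J2_def)
    have "p + (N - p) = N" using j(2) by simp
    then show ?thesis using midW_midv[OF j(3) Wsupp[OF j(4)] Wprel[OF j(4)]] by (simp add: u2_def j(1))
  qed
  have u3: "frontW N (u3 j)" if jJ: "j \<in> J3" for j
  proof -
    obtain p c w where j: "j = (p, c, w)" "p \<le> N" "c \<in> C p" "w \<in> W (N - p)" using jJ by (auto simp: J3_def)
    have "p + (N - p) = N" using j(2) by simp
    then show ?thesis using frontW_frontv[OF Csupp[OF j(3)] Wsupp[OF j(4)] Wprel[OF j(4)]] by (simp add: u3_def j(1))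
  qed
  let ?J = "J1 <+> (J2 <+> J3)" and ?u = "case_sum u1 (case_sum u2 u3)"
  have fam: "fam_indep ?J ?u"
    unfolding fam_indep_def
  proof (intro conjI allI impI)
    show "finite ?J" using fin by simp
    fix t assume t: "\<forall>n. (\<Sum>j\<in>?J. t j * ?u j n) = 0"
    define t1 where "t1 j = t (Inl j)" for j
    define t2 where "t2 j = t (Inr (Inl j))" for j
    define t3 where "t3 j = t (Inr (Inr j))" for j
    define x where "x = (\<lambda>n. \<Sum>j\<in>J1. t1 j * u1 j n)"
    define y where "y = (\<lambda>n. \<Sum>j\<in>J2. t2 j * u2 j n)"
    define z where "z = (\<lambda>n. \<Sum>j\<in>J3. t3 j * u3 j n)"
    have xyz: "x n + (y n + z n) = 0" for n
    proof -
      have "(\<Sum>j\<in>?J. t j * ?u j n) = x n + (y n + z n)"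
        using fin by (simp add: sum.Plus x_def y_def z_def t1_def t2_def t3_def)
      then show ?thesis using t by simp
    qed
    have x2: "rowmul N 4 x (Ejmat 2 N 4) = (\<lambda>_. 0)"
      unfolding x_def rowmul_lincomb using u1(2) by simp
    have y_mid: "midW N y" unfolding y_def by (intro midW_lincomb u2)
    have z_front: "frontW N z" unfolding z_def by (intro frontW_lincomb u3)
    let ?y2 = "rowmul N 4 y (Ejmat 2 N 4)" and ?z2 = "rowmul N 4 z (Ejmat 2 N 4)"
    have yz2: "(\<lambda>n. ?y2 n + ?z2 n) = (\<lambda>_. 0)"
    proof -
      have "rowmul N 4 (\<lambda>n. x n + (y n + z n)) (Ejmat 2 N 4) = (\<lambda>_. 0)"
        unfolding xyz by (rule rowmul_zero)
      then show ?thesis unfolding rowmul_add x2 by simp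
    qed
    \<comment> \<open>\<open>Ejmat 2\<close> has removed \<open>x\<close>, and
      \<open>Ejmat 3\<close> now removes the image of \<open>y\<close>. The image of
      \<open>z\<close> is still in \<open>W \<otimes> A_2\<close>, so (H) in depth 4 makes it zero;
      then (H) in depth 3 gives \<open>y = 0\<close>.\<close>
    have "rowmul N 4 (\<lambda>n. ?y2 n + ?z2 n) (Ejmat 3 N 4) = (\<lambda>_. 0)"
      unfolding yz2 by (rule rowmul_zero)
    then have "rowmul N 4 ?z2 (Ejmat 3 N 4) = (\<lambda>_. 0)"
      unfolding rowmul_add midW_left_kernel[OF y_mid] by simp
    then have z2: "?z2 = (\<lambda>_. 0)" by (rule frontW_injective[OF H frontW_rowmul[OF z_front]])
    have "?y2 = (\<lambda>_. 0)" using yz2 unfolding z2 by simp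
    then have y0: "y = (\<lambda>_. 0)" by (rule midW_injective[OF H y_mid])
    \<comment> \<open>Only the image of \<open>z\<close> is known to vanish. At each front pair
      \<open>s\<close> the slice of \<open>z\<close> is a combination of \<open>C\<close> with zero
      image, so the independence of the images of \<open>C\<close>, and then of \<open>W\<close>,
      kills the coefficients.\<close>
    have T3: "t3 j = 0" if jJ: "j \<in> J3" for j
    proof -
      obtain p c0 w0 where j: "j = (p, c0, w0)" "p \<le> N" "c0 \<in> C p" "w0 \<in> W (N - p)" using jJ by (auto simp: J3_def)
      have "(\<Sum>w\<in>W (N - p). t3 (p, c0, w) * w s) = 0" for s
      proof (cases "s \<in> Sset (N - p) 2")
        case False
        then have "w s = 0" if "w \<in> W (N - p)" for w using Wsupp[OF that] by (simp add: supported_def)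
        then show ?thesis by (intro sum.neutral) simp
      next
        case True
        then have ls: "length s = 2" by (simp add: Sset_def)
        define \<gamma> where "\<gamma> c = (\<Sum>w\<in>W (N - p). t3 (p, c, w) * w s)" for c
        have zs: "z (s @ m) = (\<Sum>c\<in>C p. \<gamma> c * c m)" if m: "m \<in> Sset p 2" for m
        proof -
          let ?e = "\<lambda>(c, w). (p, c, w)"
          have "z (s @ m) = (\<Sum>cw\<in>C p \<times> W (N - p). t3 (?e cw) * u3 (?e cw) (s @ m))"
            unfolding z_def
          proof (rule sum_fiber[OF fin(3)])
            show "?e ` (C p \<times> W (N - p)) \<subseteq> J3" using j(2) by (auto simp: J3_def)
            show "inj_on ?e (C p \<times> W (N - p))" by (auto simp: inj_on_def)
            fix i assume i: "i \<in> J3" "i \<notin> ?e ` (C p \<times> W (N - p))"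
            then obtain p' c w where i': "i = (p', c, w)" "c \<in> C p'" "w \<in> W (N - p')" by (auto simp: J3_def)
            then have "p' \<noteq> p" using i(2) by force
            then have "m \<notin> Sset p' 2" using m by (auto simp: Sset_def)
            then have "c m = 0" using Csupp[OF i'(2)] by (simp add: supported_def)
            then show "t3 i * u3 i (s @ m) = 0" using ls by (simp add: i'(1) u3_def frontv_def)
          qed
          also have "\<dots> = (\<Sum>c\<in>C p. \<Sum>w\<in>W (N - p). t3 (p, c, w) * (w s * c m))"
            using ls by (simp add: sum.cartesian_product u3_def frontv_def case_prod_unfold)
          also have "\<dots> = (\<Sum>c\<in>C p. \<gamma> c * c m)"
            by (simp add: \<gamma>_def sum_distrib_right mult.assoc)
          finally show ?thesis .
        qed
        have "rowmul p 2 (\<lambda>m. \<Sum>c\<in>C p. \<gamma> c * c m) (Ejmat 2 p 2) k = 0" for k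
        proof (cases "k \<in> Sset p 2")
          case k: True
          have e: "rowmul p 2 (\<lambda>m. \<Sum>c\<in>C p. \<gamma> c * c m) (Ejmat 2 p 2) = rowmul p 2 (\<lambda>m. z (s @ m)) (Ejmat 2 p 2)"
            by (rule rowmul_cong) (simp add: zs)
          have "rowmul p 2 (\<lambda>m. z (s @ m)) (Ejmat 2 p 2) k = ?z2 (s @ k)"
            using rowmul_front[OF True k, of N z] j(2) by simp
          then show ?thesis unfolding e z2 .
        qed (simp add: rowmul_def)
        then have "\<gamma> c0 = 0"
          unfolding rowmul_lincomb using fam_indepD[OF Cfam] j(3) by blast
        then show ?thesis by (simp add: \<gamma>_def)
      qed
      then have "t3 (p, c0, w0) = 0"
        using fam_indepD[OF Wfam[of "N - p"], of "\<lambda>w. t3 (p, c0, w)"] j(4) by blast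
      then show ?thesis using j(1) by simp
    qed
    then have z0: "z n = 0" for n by (simp add: z_def)
    have T2: "t2 j = 0" if jJ: "j \<in> J2" for j
    proof -
      obtain p s w0 where j: "j = (p, s, w0)" "p \<le> N" "s \<in> Sset p 2" "w0 \<in> W (N - p)" using jJ by (auto simp: J2_def)
      obtain i l where s: "s = [i, l]" using Sset2_eq_pair[OF j(3)] by blast
      have "(\<Sum>w\<in>W (N - p). t2 (p, s, w) * w n) = 0" for n
      proof (cases "length n = 2")
        case False
        then have "w n = 0" if "w \<in> W (N - p)" for w using Wsupp[OF that] by (auto simp: supported_def Sset_def)
        then show ?thesis by (intro sum.neutral) simp
      next
        case True
        then obtain b c where n: "n = [b, c]" by (auto simp: length_Suc_conv numeral_2_eq_2)
        \<comment> \<open>Only tensors with outer pair \<open>s\<close> contribute at this index,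
          which isolates a relation within \<open>W (N - p)\<close>.\<close>
        have "y [i, b, c, l] = (\<Sum>w\<in>W (N - p). t2 (p, s, w) * u2 (p, s, w) [i, b, c, l])"
          unfolding y_def
        proof (rule sum_fiber[OF fin(2)])
          show "(\<lambda>w. (p, s, w)) ` W (N - p) \<subseteq> J2" using j(2,3) by (auto simp: J2_def)
          show "inj_on (\<lambda>w. (p, s, w)) (W (N - p))" by (auto simp: inj_on_def)
          fix i' assume i': "i' \<in> J2" "i' \<notin> (\<lambda>w. (p, s, w)) ` W (N - p)"
          then obtain p' s' w where q: "i' = (p', s', w)" "s' \<in> Sset p' 2" "w \<in> W (N - p')" by (auto simp: J2_def)
          have "s' \<noteq> s"
          proof
            assume "s' = s"
            moreover from this have "p' = p" using q(2) j(3) by (simp add: Sset_def)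
            ultimately show False using i'(2) q by blast
          qed
          then show "t2 i' * u2 i' [i, b, c, l] = 0" using s by (auto simp: q(1) u2_def midv_def)
        qed
        then show ?thesis using y0 by (simp add: u2_def midv_def s n)
      qed
      then have "t2 (p, s, w0) = 0"
        using fam_indepD[OF Wfam[of "N - p"], of "\<lambda>w. t2 (p, s, w)"] j(4) by blast
      then show ?thesis using j(1) by simp
    qed
    have x0: "x n = 0" for n using xyz[of n] z0[of n] y0 by simp
    have T1: "t1 j = 0" if jJ: "j \<in> J1" for j
    proof -
      obtain p s w0 where j: "j = (p, s, w0)" "p \<le> N" "s \<in> Sset p 2" "w0 \<in> K (N - p)" using jJ by (auto simp: J1_def)
      have ls: "length s = 2" using j(3) by (simp add: Sset_def)
      have "(\<Sum>w\<in>K (N - p). t1 (p, s, w) * w n) = 0" for n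
      proof -
        have "x (s @ n) = (\<Sum>w\<in>K (N - p). t1 (p, s, w) * u1 (p, s, w) (s @ n))"
          unfolding x_def
        proof (rule sum_fiber[OF fin(1)])
          show "(\<lambda>w. (p, s, w)) ` K (N - p) \<subseteq> J1" using j(2,3) by (auto simp: J1_def)
          show "inj_on (\<lambda>w. (p, s, w)) (K (N - p))" by (auto simp: inj_on_def)
          fix i' assume i': "i' \<in> J1" "i' \<notin> (\<lambda>w. (p, s, w)) ` K (N - p)"
          then obtain p' s' w where q: "i' = (p', s', w)" "s' \<in> Sset p' 2" "w \<in> K (N - p')" by (auto simp: J1_def)
          have "s' \<noteq> s"
          proof
            assume "s' = s"
            moreover from this have "p' = p" using q(2) j(3) by (simp add: Sset_def)
            ultimately show False using i'(2) q by blast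
          qed
          then show "t1 i' * u1 i' (s @ n) = 0" using ls by (auto simp: q(1) u1_def tailv_def)
        qed
        then show ?thesis using x0 ls by (simp add: u1_def tailv_def)
      qed
      then have "t1 (p, s, w0) = 0"
        using fam_indepD[OF Kfam[of "N - p"], of "\<lambda>w. t1 (p, s, w)"] j(4) by blast
      then show ?thesis using j(1) by simp
    qed
    show "\<forall>j\<in>?J. t j = 0"
      using T1 T2 T3 unfolding t1_def t2_def t3_def by auto
  qed
  \<comment> \<open>The three families die after one, two and three factors of the product
    respectively.\<close>
  have u_props: "supported N 4 (?u j) \<and> rowmul N 4 (?u j) (Cmat4 N) = (\<lambda>_. 0)" if "j \<in> ?J" for j
  proof -
    have "supported N 4 (u1 i) \<and> rowmul N 4 (u1 i) (Cmat4 N) = (\<lambda>_. 0)" if "i \<in> J1" for i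
      unfolding rowmul_Cmat4 u1(2)[OF that] rowmul_zero using u1(1)[OF that] by simp
    moreover have "supported N 4 (u2 i) \<and> rowmul N 4 (u2 i) (Cmat4 N) = (\<lambda>_. 0)" if "i \<in> J2" for i
      unfolding rowmul_Cmat4 midW_left_kernel[OF u2[OF that]] rowmul_zero
      using u2[OF that] by (simp add: midW_def)
    moreover have "supported N 4 (u3 i) \<and> rowmul N 4 (u3 i) (Cmat4 N) = (\<lambda>_. 0)" if "i \<in> J3" for i
      unfolding rowmul_Cmat4 frontW_left_kernel[OF frontW_rowmul[OF u3[OF that]]]
      using u3[OF that] by (simp add: frontW_def)
    ultimately show ?thesis using that by auto
  qed
  have "card ?J \<le> qdim (rker N 4 (Cmat4 N))"
  proof (rule card_left_kernel_le_qdim_rker[OF fam])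
    fix j n assume j: "j \<in> ?J"
    show "?u j n = 0" if "n \<notin> Sset N 4" using u_props[OF j] that unfolding supported_def by blast
    show "(\<Sum>m\<in>Sset N 4. ?u j m * Cmat4 N m n) = 0" if "n \<in> Sset N 4"
      using fun_cong[OF conjunct2[OF u_props[OF j]], of n] that by (simp add: rowmul_def)
  qed
  moreover have "card J1 = (\<Sum>p\<le>N. card (Sset p 2) * card (K (N - p)))"
    "card J2 = (\<Sum>p\<le>N. card (Sset p 2) * card (W (N - p)))"
    "card J3 = (\<Sum>p\<le>N. card (C p) * card (W (N - p)))"
    unfolding J1_def J2_def J3_def using Wfin Kfin Cfin by (simp_all add: card_cartesian_product)
  ultimately show ?thesis using fin by (simp add: card_Plus)
qed

theorem theorem1p2:
  assumes "hypH"
  shows "\<forall>N. of_nat (if N > 0 then qdim (rker N 4 (Cmat4 N)) else 0)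
             \<ge> fps_nth (3 * fpsO ^ 2 * fpsS - fpsS ^ 2) N"
proof
  fix N
  obtain W where W: "\<And>q. period_basis q (W q)" using period_basis_exists by metis
  obtain K C where KC: "\<And>p. kernel_basis p (K p) (C p)" using kernel_basis_exists by metis
  have cW: "card (W q) = sdim q" for q using W[of q] by (simp add: period_basis_def)
  \<comment> \<open>Period polynomials lie in the left kernel in depth 2, which gives the comparison
    that \<open>convolution_bound\<close> requires.\<close>
  have sK: "sdim q \<le> card (K q)" for q
  proof -
    have "W q \<subseteq> vs.span (K q)"
      using W[of q] KC[of q] period_rel_imp_left_kernel2[of q] unfolding period_basis_def kernel_basis_def by blast
    then show ?thesis
      using vs.independent_span_bound[of "K q" "W q"] W[of q] KC[of q] unfolding period_basis_def kernel_basis_def by simp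
  qed
  let ?O = "\<lambda>p. card (Sset p 2)"
  have "3 * (\<Sum>p\<le>N. ?O p * sdim (N - p)) \<le>
    (\<Sum>p\<le>N. ?O p * card (K (N - p))) + (\<Sum>p\<le>N. ?O p * sdim (N - p)) + (\<Sum>p\<le>N. card (C p) * sdim (N - p))
    + (\<Sum>p\<le>N. sdim p * sdim (N - p))"
    using sK KC unfolding kernel_basis_def by (intro convolution_bound) auto
  also have "\<dots> \<le> qdim (rker N 4 (Cmat4 N)) + (\<Sum>p\<le>N. sdim p * sdim (N - p))"
    using left_kernel_bound[OF assms W KC, of N] by (simp add: cW)
  finally have bound: "3 * (\<Sum>p\<le>N. ?O p * sdim (N - p)) \<le> qdim (rker N 4 (Cmat4 N)) + (\<Sum>p\<le>N. sdim p * sdim (N - p))" .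
  have e1: "3 * fpsO ^ 2 * fpsS = fpsO ^ 2 * fpsS + fpsO ^ 2 * fpsS + fpsO ^ 2 * fpsS"
    by (simp add: algebra_simps)
  have e2: "fps_nth (fpsO ^ 2 * fpsS) N = of_nat (\<Sum>p\<le>N. ?O p * sdim (N - p))"
    unfolding fps_mult_nth fpsO_square_nth fpsS_nth by (simp add: atLeast0AtMost)
  have e3: "fps_nth (fpsS ^ 2) N = of_nat (\<Sum>p\<le>N. sdim p * sdim (N - p))"
    unfolding power2_eq_square fps_mult_nth fpsS_nth by (simp add: atLeast0AtMost)
  have eq: "fps_nth (3 * fpsO ^ 2 * fpsS - fpsS ^ 2) N
      = of_nat (3 * (\<Sum>p\<le>N. ?O p * sdim (N - p))) - of_nat (\<Sum>p\<le>N. sdim p * sdim (N - p))"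
    unfolding fps_sub_nth e1 fps_add_nth e2 e3 by simp
  have "fps_nth (3 * fpsO ^ 2 * fpsS - fpsS ^ 2) N \<le> of_nat (qdim (rker N 4 (Cmat4 N)))"
    unfolding eq using of_nat_mono[OF bound, where ?'a = rat] by simp
  \<comment> \<open>At \<open>N = 0\<close> the dimension is replaced by 0, so the constant
    coefficient is computed separately.\<close>
  moreover have "fps_nth (3 * fpsO ^ 2 * fpsS - fpsS ^ 2) 0 = 0"
    by (simp add: fpsO_nth fpsS_nth sdim_def)
  ultimately show "of_nat (if N > 0 then qdim (rker N 4 (Cmat4 N)) else 0)
      \<ge> fps_nth (3 * fpsO ^ 2 * fpsS - fpsS ^ 2) N"
    by (cases "N = 0") simp_all
qed

end
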